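(* Let $\Gamma$ be a countable approximately treeable group. Then the model companion $T_\Gamma^*$ of the theory of probability measure-preserving actions of $\Gamma$ exists; that is, for every family $(\Gamma \curvearrowright^{a_i} (X_i,\mu_i))_{i \in I}$ of existentially closed probability measure-preserving actions of $\Gamma$ and every ultrafilter $\mathcal U$ on $I$, the ultraproduct action $\Gamma \curvearrowright \prod_{\mathcal U}(X_i,\mu_i)$ is existentially closed.
   Context: All groups are countable and discrete. A p.m.p. action $\Gamma\curvearrowright^a(X,\mu)$ is an action by measure-preserving automorphisms of a (not necessarily standard) probability space. For $\alpha: Y\to p=\{0,\dots,p-1\}$, a finite $S\subseteq\Gamma$ and an action of $\Gamma$ on $Y$, let $\alpha_S:Y\to p^S$, $\alpha_S(y)(s)=\alpha(s^{-1}y)$. A factor map $\phi:(Y,\nu)\to(X,\mu)$ between p.m.p. actions (measure-preserving and $\Gamma$-equivariant) is existentially closed (e.c.) if for all $p,q\in\mathbb N$, measurable $\alpha:Y\to p$, $\beta:X\to q$, finite $S\subseteq\Gamma$ and $\epsilon>0$ there is measurable $\tilde\alpha:X\to p$ with $|\nu(\alpha_S^{-1}(\pi)\cap\phi^{-1}(\beta^{-1}(j)))-\mu(\tilde\alpha_S^{-1}(\pi)\cap\beta^{-1}(j))|<\epsilon$ for all $\pi\in p^S$, $j<q$ (equivalently, the measure algebra of $X$ with its $\Gamma$-action is existentially closed, in the sense of continuous logic, in that of $Y$). An action is e.c. if every factor map onto it from a p.m.p. action of $\Gamma$ is e.c. The ultraproduct $\prod_{\mathcal U}(X_i,\mu_i)$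 carries the (Loeb-type) ultraproduct measure and diagonal action; its measure algebra is the model-theoretic ultraproduct of the measure algebras. "$T_\Gamma^*$ exists" means the class of e.c. actions is axiomatizable in continuous logic, equivalently closed under ultraproducts. Approximately treeable: for a p.m.p. action $\Gamma\curvearrowright^a(X,\mu)$, let $\mathcal R_a$ be its orbit equivalence relation; a directed measurable graph is a measurable, antisymmetric, irreflexive $\mathcal G\subseteq\mathcal R_a$, and $\mathcal R_{\mathcal G}$ is the equivalence relation of its connected components (ignoring direction). The action is approximately treeable if for every finite $H\subseteq\Gamma$ and $\epsilon>0$ there is an acyclic directed measurable graph $\mathcal G\subseteq\mathcal R_a$ with $\mu(\{x:(h_1x,h_2x)\in\mathcal R_{\mathcal G}\text{ for all }h_1,h_2\in H\})>1-\epsilon$. The group $\Gamma$ is approximately treeable if at least one free p.m.p. action of $\Gamma$ is approximately treeable. *)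

theory Defs
  imports "HOL-Probability.Probability" "HOL-Algebra.Group_Action"
begin

section \<open>Probability measure-preserving actions and factor maps\<close>

text \<open>Actions are pointwise actions (\<^term>\<open>group_action\<close>) on the underlying set of a
  probability space, which need not be standard.\<close>

definition pmp_action :: "('g, 'b) monoid_scheme \<Rightarrow> 'x measure \<Rightarrow> ('g \<Rightarrow> 'x \<Rightarrow> 'x) \<Rightarrow> bool"
  where "pmp_action G M a \<longleftrightarrow>
    prob_space M \<and> group_action G (space M) a \<and>
    (\<forall>g\<in>carrier G. a g \<in> measurable M M \<and> distr M M (a g) = M)"

definition free_pmp_action :: "('g, 'b) monoid_scheme \<Rightarrow> 'x measure \<Rightarrow> ('g \<Rightarrow> 'x \<Rightarrow> 'x) \<Rightarrow> bool"
  where "free_pmp_action G M a \<longleftrightarrow>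
    pmp_action G M a \<and> (\<forall>g\<in>carrier G. g \<noteq> \<one>\<^bsub>G\<^esub> \<longrightarrow> (AE x in M. a g x \<noteq> x))"

definition factor_map ::
  "('g, 'b) monoid_scheme \<Rightarrow> 'y measure \<Rightarrow> ('g \<Rightarrow> 'y \<Rightarrow> 'y) \<Rightarrow>
   'x measure \<Rightarrow> ('g \<Rightarrow> 'x \<Rightarrow> 'x) \<Rightarrow> ('y \<Rightarrow> 'x) \<Rightarrow> bool"
  where "factor_map G Y b X a \<phi> \<longleftrightarrow>
    \<phi> \<in> measurable Y X \<and> distr Y X \<phi> = X \<and>
    (\<forall>g\<in>carrier G. \<forall>y\<in>space Y. \<phi> (b g y) = a g (\<phi> y))"


section \<open>Existentially closed actions\<close>

text \<open>The map \<open>\<alpha>\<^sub>S : Y \<rightarrow> p\<^sup>S\<close>; elements of \<open>p\<^sup>S\<close> are extensional functions on \<open>S\<close>.\<close>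

definition pattern_map ::
  "('g, 'b) monoid_scheme \<Rightarrow> ('g \<Rightarrow> 'y \<Rightarrow> 'y) \<Rightarrow> 'g set \<Rightarrow> ('y \<Rightarrow> nat) \<Rightarrow> 'y \<Rightarrow> 'g \<Rightarrow> nat"
  where "pattern_map G b S \<alpha> y = (\<lambda>s\<in>S. \<alpha> (b (inv\<^bsub>G\<^esub> s) y))"

definition ec_factor_map ::
  "('g, 'b) monoid_scheme \<Rightarrow> 'y measure \<Rightarrow> ('g \<Rightarrow> 'y \<Rightarrow> 'y) \<Rightarrow>
   'x measure \<Rightarrow> ('g \<Rightarrow> 'x \<Rightarrow> 'x) \<Rightarrow> ('y \<Rightarrow> 'x) \<Rightarrow> bool"
  where "ec_factor_map G Y b X a \<phi> \<longleftrightarrow>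
    factor_map G Y b X a \<phi> \<and>
    (\<forall>p q :: nat. \<forall>\<alpha> \<in> measurable Y (count_space {..<p}). \<forall>\<beta> \<in> measurable X (count_space {..<q}).
      \<forall>S. finite S \<and> S \<subseteq> carrier G \<longrightarrow> (\<forall>\<epsilon>>0. \<exists>\<alpha>' \<in> measurable X (count_space {..<p}).
        \<forall>\<pi> \<in> S \<rightarrow>\<^sub>E {..<p}. \<forall>j<q.
          \<bar>measure Y {y \<in> space Y. pattern_map G b S \<alpha> y = \<pi> \<and> \<beta> (\<phi> y) = j}
           - measure X {x \<in> space X. pattern_map G a S \<alpha>' x = \<pi> \<and> \<beta> x = j}\<bar> < \<epsilon>))"

text \<open>HOL cannot quantify over types inside a formula, so the type of the underlying sets of the
  extensions \<open>Y\<close> is a parameter. An action of \<open>G\<close> on a space over \<open>'x\<close> is existentially closed if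
  this holds for every type \<open>'y\<close>; by lemma \<open>ec_action_any_type\<close> below it is enough that it
  holds for the single type \<open>'x \<times> ('g \<Rightarrow> nat)\<close>.\<close>

definition ec_action ::
  "'y itself \<Rightarrow> ('g, 'b) monoid_scheme \<Rightarrow> 'x measure \<Rightarrow> ('g \<Rightarrow> 'x \<Rightarrow> 'x) \<Rightarrow> bool"
  where "ec_action (_ :: 'y itself) G X a \<longleftrightarrow>
    pmp_action G X a \<and>
    (\<forall>(Y :: 'y measure) b \<phi>. pmp_action G Y b \<and> factor_map G Y b X a \<phi> \<longrightarrow>
      ec_factor_map G Y b X a \<phi>)"

lemma group_action_simps:
  assumes "group_action G E a"
  shows "\<And>g x. g \<in> carrier G \<Longrightarrow> x \<in> E \<Longrightarrow> a g x \<in> E"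
    and "\<And>x. x \<in> E \<Longrightarrow> a \<one>\<^bsub>G\<^esub> x = x"
    and "\<And>g h x. g \<in> carrier G \<Longrightarrow> h \<in> carrier G \<Longrightarrow> x \<in> E \<Longrightarrow> a (g \<otimes>\<^bsub>G\<^esub> h) x = a g (a h x)"
proof -
  interpret group_action G E a by fact
  show "\<And>g x. g \<in> carrier G \<Longrightarrow> x \<in> E \<Longrightarrow> a g x \<in> E" using element_image by blast
  show "\<And>x. x \<in> E \<Longrightarrow> a \<one>\<^bsub>G\<^esub> x = x" by (metis id_eq_one restrict_apply')
  show "\<And>g h x. g \<in> carrier G \<Longrightarrow> h \<in> carrier G \<Longrightarrow> x \<in> E \<Longrightarrow> a (g \<otimes>\<^bsub>G\<^esub> h) x = a g (a h x)"
    using composition_rule by blast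
qed

lemma group_actionI:
  assumes G: "group G"
    and ext: "\<And>g. g \<in> carrier G \<Longrightarrow> a g \<in> extensional E"
    and cl: "\<And>g x. g \<in> carrier G \<Longrightarrow> x \<in> E \<Longrightarrow> a g x \<in> E"
    and one: "\<And>x. x \<in> E \<Longrightarrow> a \<one>\<^bsub>G\<^esub> x = x"
    and mult: "\<And>g h x. g \<in> carrier G \<Longrightarrow> h \<in> carrier G \<Longrightarrow> x \<in> E \<Longrightarrow> a (g \<otimes>\<^bsub>G\<^esub> h) x = a g (a h x)"
  shows "group_action G E a"
proof -
  interpret group G by fact
  have B: "a g \<in> Bij E" if g: "g \<in> carrier G" for g
  proof -
    have "bij_betw (a g) E E"
    proof (rule bij_betwI[where g="a (inv\<^bsub>G\<^esub> g)"])
      show "a (inv\<^bsub>G\<^esub> g) (a g x) = x" if "x \<in> E" for x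
        using mult[of "inv\<^bsub>G\<^esub> g" g x] g that one by simp
      show "a g (a (inv\<^bsub>G\<^esub> g) x) = x" if "x \<in> E" for x
        using mult[of g "inv\<^bsub>G\<^esub> g" x] g that one by simp
    qed (use g cl in auto)
    then show ?thesis using ext[OF g] by (simp add: Bij_def)
  qed
  have "a (g \<otimes>\<^bsub>G\<^esub> h) = compose E (a g) (a h)" if "g \<in> carrier G" "h \<in> carrier G" for g h
  proof (rule extensionalityI[of _ E])
    show "a (g \<otimes>\<^bsub>G\<^esub> h) \<in> extensional E" using ext that by simp
    show "compose E (a g) (a h) \<in> extensional E" by (simp add: compose_def)
  qed (use that mult in \<open>auto simp: compose_def\<close>)
  then have "a \<in> hom G (BijGroup E)"
    using B by (auto simp: hom_def BijGroup_def)
  then show ?thesis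
    by (simp add: group_action_def group_hom_def group_hom_axioms_def group_BijGroup G)
qed

lemma count_space_vimage_sets:
  assumes "f \<in> measurable M (count_space K)"
  shows "{x \<in> space M. f x = k} \<in> sets M"
proof (cases "k \<in> K")
  case True
  then have "f -` {k} \<inter> space M \<in> sets M"
    by (intro measurable_sets[OF assms]) simp
  also have "f -` {k} \<inter> space M = {x \<in> space M. f x = k}" by auto
  finally show ?thesis .
next
  case False
  then have "{x \<in> space M. f x = k} = {}"
    using measurable_space[OF assms] by auto
  then show ?thesis by (simp only: sets.empty_sets)
qed

lemma ec_action_any_type:
  fixes G :: "('g, 'b) monoid_scheme" and X :: "'x measure"
  assumes ec: "ec_action TYPE('x \<times> ('g \<Rightarrow> nat)) G X a"
  shows "ec_action TYPE('y) G X a"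
  unfolding ec_action_def
proof (intro conjI allI impI)
  show pX: "pmp_action G X a" using ec by (simp add: ec_action_def)
  fix Y :: "'y measure" and b \<phi>
  assume "pmp_action G Y b \<and> factor_map G Y b X a \<phi>"
  then have pY: "pmp_action G Y b" and f: "factor_map G Y b X a \<phi>" by auto
  have gaX: "group_action G (space X) a" and gaY: "group_action G (space Y) b"
    using pX pY by (auto simp: pmp_action_def)
  interpret G: group G
    using gaX by (simp add: group_action_def group_hom_def)
  interpret Y: prob_space Y using pY by (simp add: pmp_action_def)
  note aX = group_action_simps[OF gaX] and bY = group_action_simps[OF gaY]
  have \<phi>[measurable]: "\<phi> \<in> measurable Y X" and dphi: "distr Y X \<phi> = X"
    and eqv: "\<And>g y. g \<in> carrier G \<Longrightarrow> y \<in> space Y \<Longrightarrow> \<phi> (b g y) = a g (\<phi> y)"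
    using f by (auto simp: factor_map_def)
  have am: "\<And>g. g \<in> carrier G \<Longrightarrow> a g \<in> measurable X X"
    and bm: "\<And>g. g \<in> carrier G \<Longrightarrow> b g \<in> measurable Y Y"
    and bd: "\<And>g. g \<in> carrier G \<Longrightarrow> distr Y Y (b g) = Y"
    using pX pY by (auto simp: pmp_action_def)
  show "ec_factor_map G Y b X a \<phi>"
    unfolding ec_factor_map_def
  proof (intro conjI f allI ballI impI)
    fix p q :: nat and \<alpha> \<beta> S and \<epsilon> :: real
    assume \<alpha>: "\<alpha> \<in> measurable Y (count_space {..<p})"
      and \<beta>: "\<beta> \<in> measurable X (count_space {..<q})"
      and S: "finite S \<and> S \<subseteq> carrier G" and \<epsilon>: "0 < \<epsilon>"
    define C where "C = carrier G"
    define N where "N = X \<Otimes>\<^sub>M PiM C (\<lambda>_. count_space {..<p})"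
    define \<psi> where "\<psi> y = (\<phi> y, pattern_map G b C \<alpha> y)" for y
    define Z where "Z = distr Y N \<psi>"
    define c where "c g = (\<lambda>z\<in>space N. (a g (fst z), \<lambda>h\<in>C. snd z (inv\<^bsub>G\<^esub> g \<otimes>\<^bsub>G\<^esub> h)))" for g
    have spN: "space N = space X \<times> (C \<rightarrow>\<^sub>E {..<p})"
      by (simp add: N_def space_pair_measure space_PiM)
    have pm: "pattern_map G b C \<alpha> \<in> measurable Y (PiM C (\<lambda>_. count_space {..<p}))"
      unfolding pattern_map_def
      by (intro measurable_restrict measurable_compose[OF bm \<alpha>]) (auto simp: C_def)
    have \<psi>: "\<psi> \<in> measurable Y N"
      unfolding N_def \<psi>_def using \<phi> pm by (rule measurable_Pair)
    have c_m: "c g \<in> measurable N N" if g: "g \<in> carrier G" for g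
    proof -
      have 1: "(\<lambda>z. a g (fst z)) \<in> measurable N X"
        unfolding N_def by (rule measurable_compose[OF measurable_fst am[OF g]])
      have 2: "(\<lambda>z. \<lambda>h\<in>C. snd z (inv\<^bsub>G\<^esub> g \<otimes>\<^bsub>G\<^esub> h)) \<in> measurable N (PiM C (\<lambda>_. count_space {..<p}))"
      proof (rule measurable_restrict)
        fix h assume "h \<in> C"
        then have "inv\<^bsub>G\<^esub> g \<otimes>\<^bsub>G\<^esub> h \<in> C" using g by (simp add: C_def)
        then show "(\<lambda>z. snd z (inv\<^bsub>G\<^esub> g \<otimes>\<^bsub>G\<^esub> h)) \<in> measurable N (count_space {..<p})"
          unfolding N_def
          by (intro measurable_compose[OF measurable_snd measurable_component_singleton])
      qed
      have "(\<lambda>z. (a g (fst z), \<lambda>h\<in>C. snd z (inv\<^bsub>G\<^esub> g \<otimes>\<^bsub>G\<^esub> h))) \<in> measurable N N"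
        using measurable_Pair[OF 1 2] by (simp add: N_def)
      then show ?thesis by (rule measurable_cong[THEN iffD1, rotated]) (simp add: c_def)
    qed
    have c\<psi>: "c g (\<psi> y) = \<psi> (b g y)" if g: "g \<in> carrier G" and y: "y \<in> space Y" for g y
    proof -
      have "\<psi> y \<in> space N" using \<psi> y by (rule measurable_space)
      moreover have "\<alpha> (b (inv\<^bsub>G\<^esub> (inv\<^bsub>G\<^esub> g \<otimes>\<^bsub>G\<^esub> h)) y) = \<alpha> (b (inv\<^bsub>G\<^esub> h) (b g y))" if "h \<in> C" for h
        using that g y bY(3)[of "inv\<^bsub>G\<^esub> h" g y] by (simp add: C_def G.inv_mult_group)
      ultimately show ?thesis
        using g y eqv[OF g y]
        by (auto simp: c_def \<psi>_def pattern_map_def C_def intro!: restrict_ext)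
    qed
    have gaZ: "group_action G (space N) c"
    proof (rule group_actionI[OF G.is_group])
      show "c g \<in> extensional (space N)" for g by (simp add: c_def)
      show "c g z \<in> space N" if "g \<in> carrier G" "z \<in> space N" for g z
        using measurable_space[OF c_m] that by blast
      show "c \<one>\<^bsub>G\<^esub> z = z" if z: "z \<in> space N" for z
      proof -
        obtain x f where "z = (x, f)" by (cases z)
        moreover have "(\<lambda>h\<in>C. f (\<one>\<^bsub>G\<^esub> \<otimes>\<^bsub>G\<^esub> h)) = f" if "f \<in> C \<rightarrow>\<^sub>E {..<p}" for f
          using that by (intro extensionalityI[of _ C]) (auto simp: C_def PiE_def)
        ultimately show ?thesis using z aX(2) unfolding c_def spN by auto
      qed
      show "c (g \<otimes>\<^bsub>G\<^esub> h) z = c g (c h z)" 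
        if g: "g \<in> carrier G" and h: "h \<in> carrier G" and z: "z \<in> space N" for g h z
      proof -
        have ch: "c h z \<in> space N" using measurable_space[OF c_m[OF h] z] .
        have "fst z \<in> space X" using z by (auto simp: spN)
        moreover have "snd z (inv\<^bsub>G\<^esub> (g \<otimes>\<^bsub>G\<^esub> h) \<otimes>\<^bsub>G\<^esub> k) = snd z (inv\<^bsub>G\<^esub> h \<otimes>\<^bsub>G\<^esub> (inv\<^bsub>G\<^esub> g \<otimes>\<^bsub>G\<^esub> k))"
          if "k \<in> C" for k
          using that g h by (simp add: C_def G.inv_mult_group G.m_assoc)
        ultimately have "c (g \<otimes>\<^bsub>G\<^esub> h) z =
          (a g (fst (c h z)), \<lambda>k\<in>C. snd (c h z) (inv\<^bsub>G\<^esub> g \<otimes>\<^bsub>G\<^esub> k))"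
          using g h z aX(3)[OF g h]
          by (auto simp: c_def C_def intro!: restrict_ext)
        also have "\<dots> = c g (c h z)" using ch by (simp add: c_def[of g])
        finally show ?thesis .
      qed
    qed
    have spZ: "space Z = space N" and seZ: "sets Z = sets N" by (simp_all add: Z_def)
    have pZ: "pmp_action G Z c"
      unfolding pmp_action_def spZ
    proof (intro conjI ballI gaZ)
      show "prob_space Z" unfolding Z_def by (rule Y.prob_space_distr[OF \<psi>])
      fix g assume g: "g \<in> carrier G"
      show "c g \<in> measurable Z Z"
        using c_m[OF g] measurable_cong_sets[OF seZ seZ] by simp
      have "distr Z Z (c g) = distr Z N (c g)"
        by (rule distr_cong) (auto simp: seZ)
      also have "\<dots> = distr Y N (c g \<circ> \<psi>)"
        unfolding Z_def by (rule distr_distr[OF c_m[OF g] \<psi>])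
      also have "\<dots> = distr Y N (\<psi> \<circ> b g)"
        by (rule distr_cong) (auto simp: c\<psi> g)
      also have "\<dots> = distr (distr Y Y (b g)) N \<psi>"
        by (rule distr_distr[OF \<psi> bm[OF g], symmetric])
      also have "\<dots> = Z" by (simp add: bd g Z_def)
      finally show "distr Z Z (c g) = Z" .
    qed
    have fst_m: "fst \<in> measurable N X" unfolding N_def by (rule measurable_fst)
    have fZ: "factor_map G Z c X a fst"
      unfolding factor_map_def
    proof (intro conjI ballI)
      show "fst \<in> measurable Z X" using fst_m by (simp add: measurable_cong_sets[OF seZ refl])
      have "distr Z X fst = distr Y X (fst \<circ> \<psi>)"
        unfolding Z_def by (rule distr_distr[OF fst_m \<psi>])
      also have "fst \<circ> \<psi> = \<phi>" by (auto simp: \<psi>_def)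
      finally show "distr Z X fst = X" by (simp add: dphi)
    qed (auto simp: c_def spZ)
    define \<gamma> where "\<gamma> z = snd z \<one>\<^bsub>G\<^esub>" for z :: "'x \<times> ('g \<Rightarrow> nat)"
    have \<gamma>: "\<gamma> \<in> measurable N (count_space {..<p})"
      unfolding \<gamma>_def N_def
      by (intro measurable_compose[OF measurable_snd measurable_component_singleton]) (simp add: C_def)
    then have \<gamma>Z: "\<gamma> \<in> measurable Z (count_space {..<p})"
      by (simp add: measurable_cong_sets[OF seZ refl])
    from ec pZ fZ have "ec_factor_map G Z c X a fst" by (simp add: ec_action_def)
    then have "\<exists>\<alpha>'\<in>measurable X (count_space {..<p}). \<forall>\<pi>\<in>S \<rightarrow>\<^sub>E {..<p}. \<forall>j<q.
        \<bar>measure Z {z \<in> space Z. pattern_map G c S \<gamma> z = \<pi> \<and> \<beta> (fst z) = j}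
         - measure X {x \<in> space X. pattern_map G a S \<alpha>' x = \<pi> \<and> \<beta> x = j}\<bar> < \<epsilon>"
      unfolding ec_factor_map_def
      by (elim conjE) (drule spec[of _ p], drule spec[of _ q], drule bspec[OF _ \<gamma>Z],
        drule bspec[OF _ \<beta>], drule spec[of _ S], drule mp[OF _ S], drule spec[of _ \<epsilon>],
        erule mp[OF _ \<epsilon>])
    then obtain \<alpha>' where \<alpha>': "\<alpha>' \<in> measurable X (count_space {..<p})"
      and cl: "\<And>\<pi> j. \<pi> \<in> S \<rightarrow>\<^sub>E {..<p} \<Longrightarrow> j < q \<Longrightarrow>
         \<bar>measure Z {z \<in> space Z. pattern_map G c S \<gamma> z = \<pi> \<and> \<beta> (fst z) = j}
           - measure X {x \<in> space X. pattern_map G a S \<alpha>' x = \<pi> \<and> \<beta> x = j}\<bar> < \<epsilon>"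
      by blast
    have eq: "measure Z {z \<in> space Z. pattern_map G c S \<gamma> z = \<pi> \<and> \<beta> (fst z) = j} =
        measure Y {y \<in> space Y. pattern_map G b S \<alpha> y = \<pi> \<and> \<beta> (\<phi> y) = j}"
      if \<pi>: "\<pi> \<in> S \<rightarrow>\<^sub>E {..<p}" for \<pi> j
    proof -
      define A where "A = {z \<in> space N. pattern_map G c S \<gamma> z = \<pi> \<and> \<beta> (fst z) = j}"
      have "(\<lambda>z. \<gamma> (c (inv\<^bsub>G\<^esub> s) z)) \<in> measurable N (count_space {..<p})" if "s \<in> S" for s
        using that S by (intro measurable_compose[OF c_m \<gamma>]) auto
      then have "{z \<in> space N. \<gamma> (c (inv\<^bsub>G\<^esub> s) z) = k} \<in> sets N" if "s \<in> S" "k < p" for s k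
        using that by (intro count_space_vimage_sets)
      then have 1: "{z \<in> space N. \<forall>s\<in>S. \<gamma> (c (inv\<^bsub>G\<^esub> s) z) = \<pi> s} \<in> sets N"
        using S \<pi> by (intro sets.sets_Collect_finite_All) auto
      have "(\<lambda>z. \<beta> (fst z)) \<in> measurable N (count_space {..<q})"
        by (rule measurable_compose[OF fst_m \<beta>])
      then have 2: "{z \<in> space N. \<beta> (fst z) = j} \<in> sets N"
        by (rule count_space_vimage_sets)
      have "pattern_map G c S \<gamma> z = \<pi> \<longleftrightarrow> (\<forall>s\<in>S. \<gamma> (c (inv\<^bsub>G\<^esub> s) z) = \<pi> s)" for z
      proof
        assume "pattern_map G c S \<gamma> z = \<pi>"
        then show "\<forall>s\<in>S. \<gamma> (c (inv\<^bsub>G\<^esub> s) z) = \<pi> s" by (auto simp: pattern_map_def)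
      next
        assume "\<forall>s\<in>S. \<gamma> (c (inv\<^bsub>G\<^esub> s) z) = \<pi> s"
        then show "pattern_map G c S \<gamma> z = \<pi>"
          using \<pi> by (intro extensionalityI[of _ S]) (auto simp: pattern_map_def PiE_def)
      qed
      then have "A = {z \<in> space N. \<forall>s\<in>S. \<gamma> (c (inv\<^bsub>G\<^esub> s) z) = \<pi> s} \<inter> {z \<in> space N. \<beta> (fst z) = j}"
        by (auto simp: A_def)
      then have "A \<in> sets N" using 1 2 by auto
      then have "measure Z A = measure Y (\<psi> -` A \<inter> space Y)"
        unfolding Z_def by (rule measure_distr[OF \<psi>])
      also have "\<psi> -` A \<inter> space Y = {y \<in> space Y. pattern_map G b S \<alpha> y = \<pi> \<and> \<beta> (\<phi> y) = j}"
      proof -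
        have "pattern_map G c S \<gamma> (\<psi> y) = pattern_map G b S \<alpha> y" if y: "y \<in> space Y" for y
          unfolding pattern_map_def
        proof (rule restrict_ext)
          fix s assume "s \<in> S"
          then have s: "inv\<^bsub>G\<^esub> s \<in> carrier G" using S by auto
          have "\<gamma> (\<psi> y') = \<alpha> y'" if "y' \<in> space Y" for y'
            using bY(2)[OF that] by (simp add: \<gamma>_def \<psi>_def pattern_map_def C_def)
          then show "\<gamma> (c (inv\<^bsub>G\<^esub> s) (\<psi> y)) = \<alpha> (b (inv\<^bsub>G\<^esub> s) y)"
            using c\<psi>[OF s y] bY(1)[OF s y] by simp
        qed
        then show ?thesis
          using measurable_space[OF \<psi>] by (auto simp: A_def) (auto simp: \<psi>_def)
      qed
      finally show ?thesis by (simp add: A_def spZ)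
    qed
    show "\<exists>\<alpha>'\<in>measurable X (count_space {..<p}). \<forall>\<pi>\<in>S \<rightarrow>\<^sub>E {..<p}. \<forall>j<q.
        \<bar>measure Y {y \<in> space Y. pattern_map G b S \<alpha> y = \<pi> \<and> \<beta> (\<phi> y) = j}
         - measure X {x \<in> space X. pattern_map G a S \<alpha>' x = \<pi> \<and> \<beta> x = j}\<bar> < \<epsilon>"
      using \<alpha>' cl eq by auto
  qed
qed



section \<open>Ultraproducts\<close>

definition ultrafilter :: "'i filter \<Rightarrow> bool"
  where "ultrafilter U \<longleftrightarrow>
    U \<noteq> bot \<and> (\<forall>P. eventually P U \<or> eventually (\<lambda>i. \<not> P i) U)"

definition ultra_rel :: "'i filter \<Rightarrow> ('i \<Rightarrow> 'x set) \<Rightarrow> (('i \<Rightarrow> 'x) \<times> ('i \<Rightarrow> 'x)) set"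
  where "ultra_rel U E = {(x, y). x \<in> Pi UNIV E \<and> y \<in> Pi UNIV E \<and> eventually (\<lambda>i. x i = y i) U}"

definition ultra_set :: "'i filter \<Rightarrow> ('i \<Rightarrow> 'x set) \<Rightarrow> ('i \<Rightarrow> 'x) set set"
  where "ultra_set U E = Pi UNIV E // ultra_rel U E"

definition internal_set ::
  "'i filter \<Rightarrow> ('i \<Rightarrow> 'x set) \<Rightarrow> ('i \<Rightarrow> 'x set) \<Rightarrow> ('i \<Rightarrow> 'x) set set"
  where "internal_set U E A = {c \<in> ultra_set U E. \<exists>x\<in>c. eventually (\<lambda>i. x i \<in> A i) U}"

text \<open>The measure on the \<open>\<sigma>\<close>-algebra generated by the internal measurable sets \<open>[A\<^sub>i]\<^sub>U\<close> which gives
  \<open>[A\<^sub>i]\<^sub>U\<close> the measure \<open>lim\<^sub>U \<mu>\<^sub>i(A\<^sub>i)\<close>. The Loeb space is its completion, which has the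
  same measure algebra.\<close>

definition ultraproduct :: "'i filter \<Rightarrow> ('i \<Rightarrow> 'x measure) \<Rightarrow> ('i \<Rightarrow> 'x) set measure"
  where "ultraproduct U X =
    extend_measure (ultra_set U (\<lambda>i. space (X i))) (Pi UNIV (\<lambda>i. sets (X i)))
      (internal_set U (\<lambda>i. space (X i))) (\<lambda>A. Lim U (\<lambda>i. emeasure (X i) (A i)))"

definition ultra_action ::
  "'i filter \<Rightarrow> ('i \<Rightarrow> 'x measure) \<Rightarrow> ('i \<Rightarrow> 'g \<Rightarrow> 'x \<Rightarrow> 'x) \<Rightarrow> 'g \<Rightarrow>
   ('i \<Rightarrow> 'x) set \<Rightarrow> ('i \<Rightarrow> 'x) set"
  where "ultra_action U X a g =
    (\<lambda>c \<in> ultra_set U (\<lambda>i. space (X i)).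
       \<Union>x\<in>c. ultra_rel U (\<lambda>i. space (X i)) `` {\<lambda>i. a i g (x i)})"


section \<open>Approximate treeability\<close>

definition orbit_rel ::
  "('g, 'b) monoid_scheme \<Rightarrow> 'x measure \<Rightarrow> ('g \<Rightarrow> 'x \<Rightarrow> 'x) \<Rightarrow> ('x \<times> 'x) set"
  where "orbit_rel G M a = {(x, y). x \<in> space M \<and> y \<in> orbit G a x}"

text \<open>Measurability refers to the \<open>\<sigma>\<close>-algebra that the orbit equivalence relation inherits as a
  subset of the product space.\<close>

definition directed_measurable_graph ::
  "('g, 'b) monoid_scheme \<Rightarrow> 'x measure \<Rightarrow> ('g \<Rightarrow> 'x \<Rightarrow> 'x) \<Rightarrow> ('x \<times> 'x) set \<Rightarrow> bool"
  where "directed_measurable_graph G M a \<G> \<longleftrightarrow>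
    \<G> \<subseteq> orbit_rel G M a \<and> \<G> \<in> sets (restrict_space (M \<Otimes>\<^sub>M M) (orbit_rel G M a)) \<and>
    antisym \<G> \<and> irrefl \<G>"

definition component_rel :: "'x set \<Rightarrow> ('x \<times> 'x) set \<Rightarrow> ('x \<times> 'x) set"
  where "component_rel V \<G> = Restr ((\<G> \<union> \<G>\<inverse>)\<^sup>*) V"

text \<open>Acyclicity concerns the underlying undirected graph, so it is not \<^const>\<open>acyclic\<close>. For
  antisymmetric irreflexive \<open>\<G>\<close> there are no cycles of length one or two.\<close>

definition acyclic_graph :: "('x \<times> 'x) set \<Rightarrow> bool"
  where "acyclic_graph \<G> \<longleftrightarrow>
    \<not> (\<exists>xs. 3 \<le> length xs \<and> distinct xs \<and>
          (\<forall>k<length xs. (xs ! k, xs ! (Suc k mod length xs)) \<in> \<G> \<union> \<G>\<inverse>))"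

definition approx_treeable_action ::
  "('g, 'b) monoid_scheme \<Rightarrow> 'x measure \<Rightarrow> ('g \<Rightarrow> 'x \<Rightarrow> 'x) \<Rightarrow> bool"
  where "approx_treeable_action G M a \<longleftrightarrow>
    pmp_action G M a \<and>
    (\<forall>H. finite H \<and> H \<subseteq> carrier G \<longrightarrow> (\<forall>\<epsilon>>0. \<exists>\<G>.
      directed_measurable_graph G M a \<G> \<and> acyclic_graph \<G> \<and>
      measure M {x \<in> space M. \<forall>h\<^sub>1\<in>H. \<forall>h\<^sub>2\<in>H. (a h\<^sub>1 x, a h\<^sub>2 x) \<in> component_rel (space M) \<G>}
        > 1 - \<epsilon>))"

text \<open>The type of the underlying set of the witnessing action is again a parameter; a theorem that
  assumes \<open>approx_treeable TYPE('w) G\<close> for a free type variable \<open>'w\<close> applies to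
  witnesses of every type.\<close>

definition approx_treeable :: "'w itself \<Rightarrow> ('g, 'b) monoid_scheme \<Rightarrow> bool"
  where "approx_treeable (_ :: 'w itself) G \<longleftrightarrow>
    (\<exists>(M :: 'w measure) a. free_pmp_action G M a \<and> approx_treeable_action G M a)"

end

theory Submission
  imports Defs "HOL-Library.Transitive_Closure_Table"
begin

text \<open>Let \<open>Y \<rightarrow> X\<close> be a factor map onto the ultraproduct of existentially closed actions \<open>X\<^sub>i\<close>, and let a
  finite colouring \<open>\<alpha>\<close> of \<open>Y\<close> and a finite window of group elements be given. It suffices to find, for
  almost every \<open>i\<close>, some extension of \<open>X\<^sub>i\<close> with a colouring whose joint statistics with the base
  approximate those of \<open>\<alpha>\<close>: existential closedness of \<open>X\<^sub>i\<close> then gives a colouring of \<open>X\<^sub>i\<close> itself, and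
  the ultraproduct of these colourings is as required.

  The extension lives on \<open>X\<^sub>i \<times> W \<times> A\<^sup>G\<close>, where \<open>W\<close> is a free action carrying an acyclic graph that
  connects the window with high probability. Replace \<open>\<alpha>\<close> by the colouring \<open>\<alpha>\<^sup>+\<close> with values in \<open>A\<close> that
  records \<open>\<alpha>\<close> on a large finite part of the orbit. Over a point of \<open>X\<^sub>i \<times> W\<close> the graph is a forest on \<open>G\<close>,
  and the fibre measure is the Markov random field on this forest whose edge marginals are the
  conditional joint laws of \<open>\<alpha>\<^sup>+(y)\<close> and \<open>\<alpha>\<^sup>+(g y)\<close> given a finite partition \<open>\<gamma>\<close> of \<open>X\<close>, transferred to \<open>X\<^sub>i\<close>. On a
  forest any such family of couplings with matching vertex marginals is consistent, and the field does
  not depend on a root, so the resulting measure is invariant. The overlapping information in \<open>\<alpha>\<^sup>+(y)\<close> and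
  \<open>\<alpha>\<^sup>+(g y)\<close> is consistent along edges with high probability, so along a path in the forest a label at one
  end determines the pattern seen from the other end. Only finitely many statistics of \<open>\<gamma>\<close> matter, and
  these are nearly the same in \<open>X\<close> and in \<open>X\<^sub>i\<close>.\<close>

section \<open>Random fields on finite forests\<close>

text \<open>\<open>Y\<close> lies over the ultraproduct and need not be an ultraproduct itself, so
  no part of it can be restricted to a coordinate. What reaches \<open>X i\<close> is a table of
  numbers: vertex laws and edge densities, computed once over the ultraproduct and then kept. Two
  defects must be repaired. Gluing needs exactly equal vertex laws, whereas the joint law of the
  labels at \<open>y\<close> and \<open>g y\<close>, given the colours of both, has marginals
  conditioned also on the colour of the neighbour. Therefore \<open>\<gamma>\<close> consists of
  level sets of rounded conditional densities: inside such a class any further conditioning moves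
  the law of the label by \<open>O(1/n)\<close> only, and a small correction of the coupling makes
  the marginals exact. This correction in turn creates labels that contradict each other across an
  edge, which never happens on \<open>Y\<close>. They cannot be excluded, only made improbable, so
  the number of edges in play must be bounded beforehand. This dictates the order of choices: the
  window \<open>F\<close> from the forest, then the labels, then \<open>n\<close>, then
  \<open>\<gamma>\<close> with its \<open>r\<close> colours, and the transfer tolerance
  \<open>\<delta>\<close> last.\<close>

definition linked :: "('v \<times> 'v) set \<Rightarrow> 'v \<Rightarrow> 'v \<Rightarrow> bool"
  where "linked E u v \<longleftrightarrow> (u, v) \<in> (E \<union> E\<inverse>)\<^sup>*"

text \<open>Every edge is a bridge. This also rules out loops and pairs of opposite edges, and it is
  the form of acyclicity that an induction removing edges can use.\<close>

definition forest :: "('v \<times> 'v) set \<Rightarrow> bool"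
  where "forest E \<longleftrightarrow> (\<forall>(u, v)\<in>E. \<not> linked (E - {(u, v)}) u v)"

lemma linked_refl [simp]: "linked E u u"
  by (simp add: linked_def)

lemma linked_sym: "linked E u v \<Longrightarrow> linked E v u"
  unfolding linked_def by (meson sym_Un_converse sym_rtrancl symD)

lemma linked_trans: "linked E u v \<Longrightarrow> linked E v x \<Longrightarrow> linked E u x"
  unfolding linked_def by (rule rtrancl_trans)

lemma linked_mono: "linked E u v \<Longrightarrow> E \<subseteq> F \<Longrightarrow> linked F u v"
  unfolding linked_def by (rule rtrancl_mono[THEN subsetD]) auto

lemma linked_edge: "(u, v) \<in> E \<Longrightarrow> linked E u v"
  unfolding linked_def by auto

lemma forest_subset: "forest F \<Longrightarrow> E \<subseteq> F \<Longrightarrow> forest E"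
  unfolding forest_def using linked_mono[of "E - {e}" _ _ "F - {e}" for e] by fast

lemma linked_image:
  assumes "linked E u v" "\<And>x y. (x, y) \<in> E \<Longrightarrow> (\<sigma> x, \<sigma> y) \<in> F"
  shows "linked F (\<sigma> u) (\<sigma> v)"
  using assms(1) unfolding linked_def
proof (induction rule: rtrancl_induct)
  case (step y z)
  then have "(\<sigma> y, \<sigma> z) \<in> F \<union> F\<inverse>" using assms(2) by auto
  with step.IH show ?case by (rule rtrancl_into_rtrancl)
qed simp

lemma linked_finite_subset:
  assumes "linked T u v"
  shows "\<exists>E\<subseteq>T. finite E \<and> linked E u v"
  using assms unfolding linked_def[of T]
proof (induction rule: rtrancl_induct)
  case base
  show ?case by (rule exI[of _ "{}"]) auto
next
  case (step y z)
  then obtain E where E: "E \<subseteq> T" "finite E" "linked E u y" by auto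
  obtain e where e: "e \<in> T" "e = (y, z) \<or> e = (z, y)" using step.hyps(2) by auto
  have "linked (insert e E) u y" using E(3) by (rule linked_mono) auto
  moreover have "linked (insert e E) y z"
    using e(2) linked_edge[of y z "insert e E"] linked_sym[OF linked_edge[of z y "insert e E"]] by auto
  ultimately have "linked (insert e E) u z" by (rule linked_trans)
  with E(1,2) e(1) show ?case by (intro exI[of _ "insert e E"]) auto
qed

text \<open>\<open>T\<close> may be infinite, while probabilities are computed on finite graphs. One
  path for each linked pair of points of \<open>D\<close> suffices; the field on such a finite piece
  will already have the right law on \<open>D\<close>.\<close>

lemma linked_finite_skeleton:
  assumes "finite D"
  shows "\<exists>E\<subseteq>T. finite E \<and> (\<forall>d\<in>D. \<forall>d'\<in>D. linked T d d' \<longrightarrow> linked E d d')"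
proof -
  have "\<forall>p. \<exists>E. E \<subseteq> T \<and> finite E \<and> (linked T (fst p) (snd p) \<longrightarrow> linked E (fst p) (snd p))"
  proof
    fix p
    show "\<exists>E. E \<subseteq> T \<and> finite E \<and> (linked T (fst p) (snd p) \<longrightarrow> linked E (fst p) (snd p))"
    proof (cases "linked T (fst p) (snd p)")
      case True
      then show ?thesis using linked_finite_subset[OF True] by auto
    next
      case False
      then show ?thesis by (intro exI[of _ "{}"]) auto
    qed
  qed
  from choice[OF this] obtain E where E: "\<And>p. E p \<subseteq> T" "\<And>p. finite (E p)"
    "\<And>p. linked T (fst p) (snd p) \<Longrightarrow> linked (E p) (fst p) (snd p)"
    by blast
  show ?thesis
  proof (intro exI conjI ballI impI)
    show "(\<Union>p\<in>D \<times> D. E p) \<subseteq> T" "finite (\<Union>p\<in>D \<times> D. E p)"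
      using E assms by auto
    fix d d' assume d: "d \<in> D" "d' \<in> D" "linked T d d'"
    then have "linked (E (d, d')) d d'" using E(3)[of "(d, d')"] by simp
    then show "linked (\<Union>p\<in>D \<times> D. E p) d d'" by (rule linked_mono) (use d in auto)
  qed
qed

section \<open>Expectations over finite forests and the removal of bridges\<close>

definition depends_on :: "'v set \<Rightarrow> (('v \<Rightarrow> 'l) \<Rightarrow> 'r) \<Rightarrow> bool"
  where "depends_on D f \<longleftrightarrow> (\<forall>l l'. (\<forall>v\<in>D. l v = l' v) \<longrightarrow> f l = f l')"

lemma depends_onD: "depends_on D f \<Longrightarrow> (\<And>v. v \<in> D \<Longrightarrow> l v = l' v) \<Longrightarrow> f l = f l'"
  unfolding depends_on_def by blast

lemma depends_on_mono: "depends_on D f \<Longrightarrow> D \<subseteq> D' \<Longrightarrow> depends_on D' f"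
  unfolding depends_on_def by blast

lemma sum_PiE_union:
  assumes "V1 \<inter> V2 = {}"
  shows "(\<Sum>l\<in>V1 \<union> V2 \<rightarrow>\<^sub>E A. h l) =
    (\<Sum>l1\<in>V1 \<rightarrow>\<^sub>E A. \<Sum>l2\<in>V2 \<rightarrow>\<^sub>E A. h (\<lambda>v. if v \<in> V1 then l1 v else l2 v))"
  unfolding sum.cartesian_product
proof (rule sum.reindex_bij_witness[of _ "\<lambda>(l1, l2) v. if v \<in> V1 then l1 v else l2 v"
        "\<lambda>l. (restrict l V1, restrict l V2)"])
  fix l assume "l \<in> V1 \<union> V2 \<rightarrow>\<^sub>E A"
  then have "(\<lambda>v. if v \<in> V1 then restrict l V1 v else restrict l V2 v) = l"
    by (auto simp: PiE_def extensional_def fun_eq_iff)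
  then show "(case (restrict l V1, restrict l V2) of (l1, l2) \<Rightarrow> \<lambda>v. if v \<in> V1 then l1 v else l2 v) = l"
    "(case (restrict l V1, restrict l V2) of (l1, l2) \<Rightarrow> h (\<lambda>v. if v \<in> V1 then l1 v else l2 v)) = h l"
    by auto
qed (use assms in \<open>auto simp: PiE_def extensional_def fun_eq_iff restrict_def split: if_splits\<close>)

text \<open>The expectation of \<open>f\<close> under the Markov random field on
  \<open>(V, E)\<close> with vertex laws \<open>m\<close> and edge densities \<open>w\<close>. There
  is no partition function: on a forest with coupling densities the total mass is one
  (\<open>field_sum_one\<close>).\<close>

definition field_sum ::
  "'l set \<Rightarrow> ('v \<Rightarrow> 'l \<Rightarrow> real) \<Rightarrow> ('v \<Rightarrow> 'v \<Rightarrow> 'l \<Rightarrow> 'l \<Rightarrow> real) \<Rightarrow>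
    'v set \<Rightarrow> ('v \<times> 'v) set \<Rightarrow> (('v \<Rightarrow> 'l) \<Rightarrow> real) \<Rightarrow> real"
  where "field_sum A m w V E f =
    (\<Sum>l\<in>V \<rightarrow>\<^sub>E A. f l * (\<Prod>v\<in>V. m v (l v)) * (\<Prod>(u, v)\<in>E. w u v (l u) (l v)))"

text \<open>\<open>w u v\<close> is the density of a coupling of \<open>m u\<close> and \<open>m v\<close> with respect to their product.\<close>

locale tree_weights =
  fixes A :: "'l set" and m :: "'v \<Rightarrow> 'l \<Rightarrow> real" and w :: "'v \<Rightarrow> 'v \<Rightarrow> 'l \<Rightarrow> 'l \<Rightarrow> real"
    and T :: "('v \<times> 'v) set"
  assumes finite_A: "finite A"
    and m_nonneg: "\<And>v a. 0 \<le> m v a"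
    and m_sum: "\<And>v. (\<Sum>a\<in>A. m v a) = 1"
    and w_nonneg: "\<And>u v a b. 0 \<le> w u v a b"
    and w_right: "\<And>u v a. (u, v) \<in> T \<Longrightarrow> a \<in> A \<Longrightarrow> m u a \<noteq> 0 \<Longrightarrow> (\<Sum>b\<in>A. m v b * w u v a b) = 1"
    and w_left: "\<And>u v b. (u, v) \<in> T \<Longrightarrow> b \<in> A \<Longrightarrow> m v b \<noteq> 0 \<Longrightarrow> (\<Sum>a\<in>A. m u a * w u v a b) = 1"
    and forest_T: "forest T"
begin

abbreviation "I \<equiv> field_sum A m w"

lemma field_sum_no_edges:
  assumes "finite V" "v \<in> V"
  shows "I V {} (\<lambda>l. h (l v)) = (\<Sum>b\<in>A. m v b * h b)"
proof -
  have "I V {} (\<lambda>l. h (l v)) = (\<Sum>l\<in>V \<rightarrow>\<^sub>E A. \<Prod>x\<in>V. m x (l x) * (if x = v then h (l x) else 1))"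
    unfolding field_sum_def
    by (intro sum.cong refl) (use assms in \<open>simp add: prod.distrib prod.delta mult.commute\<close>)
  also have "\<dots> = (\<Prod>x\<in>V. \<Sum>a\<in>A. m x a * (if x = v then h a else 1))"
    by (rule prod_sum_PiE[symmetric]) (use assms finite_A in auto)
  also have "\<dots> = (\<Prod>x\<in>V. if x = v then (\<Sum>a\<in>A. m v a * h a) else 1)"
    by (intro prod.cong refl) (simp add: m_sum)
  also have "\<dots> = (\<Sum>a\<in>A. m v a * h a)" using assms by (simp add: prod.delta)
  finally show ?thesis .
qed

text \<open>With no edge between \<open>V1\<close> and \<open>V2\<close> the weight factorises. The
  asymmetric form, with the labels on \<open>V1\<close> frozen, is the one in which a whole side of
  a bridge gets integrated out.\<close>

lemma field_sum_split:
  assumes "finite V" "V1 \<inter> V2 = {}" "V = V1 \<union> V2" "finite E1" "finite E2"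
    "E1 \<subseteq> V1 \<times> V1" "E2 \<subseteq> V2 \<times> V2"
  shows "I V (E1 \<union> E2) f = (\<Sum>l1\<in>V1 \<rightarrow>\<^sub>E A. (\<Prod>v\<in>V1. m v (l1 v)) * (\<Prod>(u, v)\<in>E1. w u v (l1 u) (l1 v)) *
    I V2 E2 (\<lambda>l2. f (\<lambda>v. if v \<in> V1 then l1 v else l2 v)))"
proof -
  have fin: "finite V1" "finite V2" and dE: "E1 \<inter> E2 = {}" using assms by auto
  let ?c = "\<lambda>l1 l2 v. if v \<in> V1 then l1 v else l2 v"
  have 1: "(\<Prod>v\<in>V. m v (?c l1 l2 v)) = (\<Prod>v\<in>V1. m v (l1 v)) * (\<Prod>v\<in>V2. m v (l2 v))" for l1 l2
    unfolding assms(3) prod.union_disjoint[OF fin assms(2)]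
    by (intro arg_cong2[where f=times] prod.cong) (use assms in auto)
  have not_V1: "u \<notin> V1" "v \<notin> V1" if "(u, v) \<in> E2" for u v using that assms by auto
  have 2: "(\<Prod>(u, v)\<in>E1 \<union> E2. w u v (?c l1 l2 u) (?c l1 l2 v)) =
      (\<Prod>(u, v)\<in>E1. w u v (l1 u) (l1 v)) * (\<Prod>(u, v)\<in>E2. w u v (l2 u) (l2 v))" for l1 l2
    unfolding prod.union_disjoint[OF assms(4,5) dE]
    by (intro arg_cong2[where f=times] prod.cong) (use assms(6) not_V1 in auto)
  have "I V (E1 \<union> E2) f = (\<Sum>l1\<in>V1 \<rightarrow>\<^sub>E A. \<Sum>l2\<in>V2 \<rightarrow>\<^sub>E A. f (?c l1 l2) * (\<Prod>v\<in>V. m v (?c l1 l2 v)) *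
      (\<Prod>(u, v)\<in>E1 \<union> E2. w u v (?c l1 l2 u) (?c l1 l2 v)))"
    unfolding field_sum_def sum_PiE_union[OF assms(2), folded assms(3)] ..
  then show ?thesis
    unfolding 1 2 by (simp add: field_sum_def sum_distrib_left mult_ac)
qed

text \<open>The two claims feed each other in an induction on the number of edges. To drop a bridge
  \<open>e\<close>, integrate out the component of \<open>y\<close>: given the label at
  \<open>x\<close>, only the law of the label at \<open>y\<close> in that smaller forest enters. It
  is \<open>m y\<close> by the first claim, and against it the edge density integrates to one. For
  the first claim, drop any edge, integrating out the side that misses \<open>v\<close>.\<close>

lemma field_sum_vertex_and_remove_edge:
  shows "\<lbrakk>card E = n; finite V; E \<subseteq> V \<times> V; E \<subseteq> T; v \<in> V\<rbrakk> \<Longrightarrow>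
      I V E (\<lambda>l. h (l v)) = (\<Sum>b\<in>A. m v b * h b)"
    and "\<lbrakk>card E = n; finite V; E \<subseteq> V \<times> V; E \<subseteq> T; e \<in> E; e = (x, y) \<or> e = (y, x); D \<subseteq> V; depends_on D f;
      \<And>d. d \<in> D \<Longrightarrow> \<not> linked (E - {e}) y d\<rbrakk> \<Longrightarrow> I V E f = I V (E - {e}) f"
proof (induction n arbitrary: V E v h e x y D f rule: less_induct)
  case (less n)
  have remove: "I V E f = I V (E - {e}) f"
    if "card E = n" "finite V" "E \<subseteq> V \<times> V" "E \<subseteq> T" "e \<in> E" "e = (x, y) \<or> e = (y, x)" "D \<subseteq> V" "depends_on D f"
      "\<And>d. d \<in> D \<Longrightarrow> \<not> linked (E - {e}) y d" for V E e x y D f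
  proof -
    note a = that
    \<comment> \<open>The side of \<open>y\<close> after cutting \<open>e\<close>. Since
      \<open>e\<close> is a bridge, \<open>x\<close> falls into \<open>V1\<close>; by assumption so
      does \<open>D\<close>.\<close>
    define V2 where "V2 = {v \<in> V. linked (E - {e}) y v}"
    define V1 where "V1 = V - V2"
    define E2 where "E2 = (E - {e}) \<inter> V2 \<times> V2"
    define E1 where "E1 = (E - {e}) - E2"
    have finE: "finite E" using a(2,3) finite_subset by blast
    have closed: "u \<in> V2 \<longleftrightarrow> v \<in> V2" if "(u, v) \<in> E - {e}" for u v
    proof -
      have "linked (E - {e}) u v" using that by (rule linked_edge)
      moreover have "u \<in> V" "v \<in> V" using that a(3) by auto
      ultimately show ?thesis unfolding V2_def by (blast intro: linked_trans linked_sym)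
    qed
    have xy: "x \<in> V" "y \<in> V" using a(3,5,6) by auto
    have y: "y \<in> V2" using xy by (simp add: V2_def)
    have "forest E" using forest_T a(4) by (rule forest_subset)
    then have "\<not> linked (E - {e}) y x" using a(5,6) unfolding forest_def by (blast dest: linked_sym)
    then have x: "x \<in> V1" using xy by (simp add: V1_def V2_def)
    have V: "V1 \<inter> V2 = {}" "V = V1 \<union> V2" by (auto simp: V1_def V2_def)
    have E: "E1 \<subseteq> V1 \<times> V1" "E2 \<subseteq> V2 \<times> V2" "E1 \<union> E2 = E - {e}"
      using closed a(3) by (auto simp: E1_def E2_def V1_def)
    have finE': "finite E1" "finite E2" using finE by (auto simp: E1_def E2_def)
    have finV2: "finite V2" using a(2) by (simp add: V2_def)
    have "card E2 \<le> card (E - {e})" by (rule card_mono) (use finE E in auto)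
    also have "\<dots> < n" using a(1,5) finE by (metis card_Diff1_less)
    finally have small: "card E2 < n" .
    have E2T: "E2 \<subseteq> T" using a(4) by (auto simp: E2_def)
    have IH: "I V2 E2 (\<lambda>l. h (l y)) = (\<Sum>b\<in>A. m y b * h b)" for h
      by (rule less.IH(1)[OF small refl finV2 E(2) E2T y])
    \<comment> \<open>The density on \<open>e\<close> read from \<open>x\<close> to
      \<open>y\<close>, whichever way the edge is directed.\<close>
    define g where "g a b = (if e = (x, y) then w x y a b else w y x b a)" for a b
    have g: "(\<Sum>b\<in>A. m y b * g a b) = 1" if "a \<in> A" "m x a \<noteq> 0" for a
      using w_right[of x y a] w_left[of y x a] a(4,5,6) that by (cases "e = (x, y)") (auto simp: g_def)
    let ?c = "\<lambda>l1 l2 v. if v \<in> V1 then l1 v else l2 v"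
    let ?G = "\<lambda>l. g (l x) (l y)"
    have "I V E f = I V (E1 \<union> E2) (\<lambda>l. f l * ?G l)"
    proof -
      have "(\<Prod>(u, v)\<in>E. w u v (l u) (l v)) = ?G l * (\<Prod>(u, v)\<in>E1 \<union> E2. w u v (l u) (l v))" for l
      proof -
        have "(\<Prod>(u, v)\<in>E. w u v (l u) (l v)) = (case e of (u, v) \<Rightarrow> w u v (l u) (l v)) * (\<Prod>(u, v)\<in>E - {e}. w u v (l u) (l v))"
          by (rule prod.remove[OF finE a(5)])
        also have "(case e of (u, v) \<Rightarrow> w u v (l u) (l v)) = ?G l" using a(6) by (auto simp: g_def)
        finally show ?thesis by (simp add: E(3))
      qed
      then show ?thesis unfolding field_sum_def by (intro sum.cong refl) (simp add: mult_ac)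
    qed
    also have "\<dots> = (\<Sum>l1\<in>V1 \<rightarrow>\<^sub>E A. (\<Prod>v\<in>V1. m v (l1 v)) * (\<Prod>(u, v)\<in>E1. w u v (l1 u) (l1 v)) *
        I V2 E2 (\<lambda>l2. f (?c l1 l2) * ?G (?c l1 l2)))"
      by (rule field_sum_split[OF a(2) V finE' E(1,2)])
    also have "\<dots> = (\<Sum>l1\<in>V1 \<rightarrow>\<^sub>E A. (\<Prod>v\<in>V1. m v (l1 v)) * (\<Prod>(u, v)\<in>E1. w u v (l1 u) (l1 v)) *
        I V2 E2 (\<lambda>l2. f (?c l1 l2)))"
    proof (intro sum.cong refl)
      fix l1 assume l1: "l1 \<in> V1 \<rightarrow>\<^sub>E A"
      have D: "D \<subseteq> V1" using a(7,9) by (auto simp: V1_def V2_def)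
      have f: "f (?c l1 l2) = f l1" for l2 by (rule depends_onD[OF a(8)]) (use D in auto)
      have pull: "I V2 E2 (\<lambda>l. k * h l) = k * I V2 E2 h" for k h
        unfolding field_sum_def sum_distrib_left by (simp add: mult.assoc)
      have Gc: "?G (?c l1 l2) = g (l1 x) (l2 y)" for l2 using x y V(1) by auto
      show "(\<Prod>v\<in>V1. m v (l1 v)) * (\<Prod>(u, v)\<in>E1. w u v (l1 u) (l1 v)) *
          I V2 E2 (\<lambda>l2. f (?c l1 l2) * ?G (?c l1 l2)) = (\<Prod>v\<in>V1. m v (l1 v)) * (\<Prod>(u, v)\<in>E1. w u v (l1 u) (l1 v)) *
          I V2 E2 (\<lambda>l2. f (?c l1 l2))"
      \<comment> \<open>Row sums of the density are controlled only at labels of positive weight; at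
        the others the factor \<open>m x (l1 x)\<close> kills both sides.\<close>
      proof (cases "m x (l1 x) = 0")
        case True
        moreover have "finite V1" using a(2) V by auto
        ultimately have "(\<Prod>v\<in>V1. m v (l1 v)) = 0" using x by (auto simp: prod_zero_iff)
        then show ?thesis by simp
      next
        case False
        have "l1 x \<in> A" using l1 x by auto
        with False have "(\<Sum>b\<in>A. m y b * g (l1 x) b) = 1" by (rule g[rotated])
        then have "I V2 E2 (\<lambda>l2. g (l1 x) (l2 y)) = 1" using IH by simp
        moreover have "I V2 E2 (\<lambda>l2. 1) = 1" using IH[of "\<lambda>_. 1"] m_sum by simp
        ultimately show ?thesis unfolding f Gc pull using pull[of "f l1" "\<lambda>_. 1"] by simp
      qed
    qed
    also have "\<dots> = I V (E1 \<union> E2) f"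
      by (rule field_sum_split[OF a(2) V finE' E(1,2), symmetric])
    finally show ?thesis by (simp add: E(3))
  qed
  {
    case 1
    note a = 1
    have finE: "finite E" using a(2,3) finite_subset by blast
    show ?case
    proof (cases "E = {}")
      case True
      then show ?thesis using field_sum_no_edges a by simp
    next
      case False
      then obtain x y where e: "(x, y) \<in> E" by auto
      let ?E = "E - {(x, y)}"
      have "forest E" using forest_T a(4) by (rule forest_subset)
      then have ns: "\<not> linked ?E x y" using e unfolding forest_def by blast
      have dep: "depends_on {v} (\<lambda>l. h (l v))" by (simp add: depends_on_def)
      have "I V E (\<lambda>l. h (l v)) = I V ?E (\<lambda>l. h (l v))"
      \<comment> \<open>The bridge separates \<open>x\<close> from \<open>y\<close>, so
        \<open>v\<close> is out of reach of at least one of them, and that side is cut off.\<close>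
      proof (cases "linked ?E y v")
        case True
        then have "\<not> linked ?E x v" using ns by (blast intro: linked_trans linked_sym)
        then show ?thesis
          by (intro remove[OF a(1-4) e _ _ dep, of y x]) (use a in auto)
      next
        case False
        then show ?thesis
          by (intro remove[OF a(1-4) e _ _ dep, of x y]) (use a in auto)
      qed
      also have "\<dots> = (\<Sum>b\<in>A. m v b * h b)"
        by (rule less.IH(1)[OF _ refl a(2) _ _ a(5)]) (use a e card_Diff1_less[OF finE e] in auto)
      finally show ?thesis .
    qed
  next
    case 2
    then show ?case by (rule remove)
  }
qed

lemmas field_sum_vertex = field_sum_vertex_and_remove_edge(1)[OF refl]
lemmas field_sum_remove_edge = field_sum_vertex_and_remove_edge(2)[OF refl]

lemma field_sum_one:
  assumes "finite V" "E \<subseteq> V \<times> V" "E \<subseteq> T"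
  shows "I V E (\<lambda>_. 1) = 1"
proof (cases "V = {}")
  case True
  then show ?thesis using assms by (simp add: field_sum_def)
next
  case False
  then obtain v where "v \<in> V" by auto
  then show ?thesis using field_sum_vertex[OF assms, of v "\<lambda>_. 1"] by (simp add: m_sum)
qed

lemma field_sum_enlarge:
  assumes "finite V'" "V \<subseteq> V'" "E \<subseteq> V \<times> V" "depends_on V f"
  shows "I V' E f = I V E f"
proof -
  have fin: "finite V" using assms(1,2) by (rule rev_finite_subset)
  then have finE: "finite E" using assms(3) by (auto intro: finite_subset)
  have "I V' (E \<union> {}) f = (\<Sum>l1\<in>V \<rightarrow>\<^sub>E A. (\<Prod>v\<in>V. m v (l1 v)) * (\<Prod>(u, v)\<in>E. w u v (l1 u) (l1 v)) *
      I (V' - V) {} (\<lambda>l2. f (\<lambda>v. if v \<in> V then l1 v else l2 v)))"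
    by (rule field_sum_split) (use assms fin finE in auto)
  also have "\<dots> = I V E f"
    unfolding field_sum_def[of _ _ _ V]
  proof (intro sum.cong refl)
    fix l1
    have "I (V' - V) {} (\<lambda>l2. f (\<lambda>v. if v \<in> V then l1 v else l2 v)) = I (V' - V) {} (\<lambda>l2. f l1 * 1)"
      by (intro arg_cong[where f="I (V' - V) {}"] ext) (auto intro: depends_onD[OF assms(4)])
    also have "\<dots> = f l1 * I (V' - V) {} (\<lambda>_. 1)"
      unfolding field_sum_def sum_distrib_left by simp
    also have "I (V' - V) {} (\<lambda>_. 1) = 1" by (rule field_sum_one) (use assms in auto)
    finally show "(\<Prod>v\<in>V. m v (l1 v)) * (\<Prod>(u, v)\<in>E. w u v (l1 u) (l1 v)) *
        I (V' - V) {} (\<lambda>l2. f (\<lambda>v. if v \<in> V then l1 v else l2 v)) =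
        f l1 * (\<Prod>v\<in>V. m v (l1 v)) * (\<Prod>(u, v)\<in>E. w u v (l1 u) (l1 v))"
      by (simp add: mult_ac)
  qed
  finally show ?thesis by simp
qed

text \<open>Extra edges are added one at a time. Each is a bridge, and one of its sides misses
  \<open>D\<close>: points of \<open>D\<close> on both sides would be linked in \<open>T\<close>,
  hence already in \<open>E0\<close>, and together with the new edge this closes a cycle. So
  \<open>field_sum_remove_edge\<close> applies.\<close>

lemma field_sum_stable:
  assumes V: "finite V" "D \<subseteq> V" and E: "E0 \<subseteq> E" "E \<subseteq> V \<times> V" "E \<subseteq> T"
    and link: "\<And>d d'. d \<in> D \<Longrightarrow> d' \<in> D \<Longrightarrow> linked T d d' \<Longrightarrow> linked E0 d d'"
    and f: "depends_on D f"
  shows "I V E f = I V E0 f"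
proof -
  have "finite (E - E0)" using V E finite_subset by blast
  moreover have "I V (E0 \<union> F) f = I V E0 f" if "finite F" "F \<subseteq> E - E0" for F
    using that
  proof (induction F rule: finite_induct)
    case (insert e F)
    obtain x y where e: "e = (x, y)" by (cases e)
    let ?E = "E0 \<union> insert e F"
    have sub: "?E \<subseteq> V \<times> V" "?E \<subseteq> T" using insert.prems E by auto
    have E': "?E - {e} = E0 \<union> F" using insert.hyps insert.prems by auto
    have "forest ?E" using forest_T sub(2) by (rule forest_subset)
    then have ns: "\<not> linked (?E - {e}) x y" unfolding e forest_def by blast
    have one_side: "(\<forall>d\<in>D. \<not> linked (?E - {e}) y d) \<or> (\<forall>d\<in>D. \<not> linked (?E - {e}) x d)"
    proof (rule ccontr)
      assume "\<not> ?thesis"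
      then obtain d d' where d: "d \<in> D" "linked (?E - {e}) y d" "d' \<in> D" "linked (?E - {e}) x d'" by auto
      have "?E - {e} \<subseteq> T" using sub(2) by blast
      then have "linked T y d" "linked T x d'" using d(2,4) by (blast intro: linked_mono)+
      moreover have "linked T x y" using sub(2) e by (intro linked_edge) auto
      ultimately have "linked T d d'" by (blast intro: linked_trans linked_sym)
      then have "linked E0 d d'" using link d by blast
      then have "linked (?E - {e}) d d'" by (rule linked_mono) (use E' in auto)
      then show False using d ns by (blast intro: linked_trans linked_sym)
    qed
    have ein: "e \<in> ?E" by simp
    have "I V ?E f = I V (?E - {e}) f"
      using one_side
    proof
      assume "\<forall>d\<in>D. \<not> linked (?E - {e}) y d"
      then show ?thesis
        using field_sum_remove_edge[OF V(1) sub ein _ V(2) f, of x y] e by blast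
    next
      assume "\<forall>d\<in>D. \<not> linked (?E - {e}) x d"
      then show ?thesis
        using field_sum_remove_edge[OF V(1) sub ein _ V(2) f, of y x] e by blast
    qed
    then show ?case unfolding E' using insert by auto
  qed simp
  ultimately have "I V (E0 \<union> (E - E0)) f = I V E0 f" by blast
  then show ?thesis using E(1) by (simp add: Un_absorb1)
qed

end

section \<open>Passage to infinite forests by Kolmogorov extension\<close>

locale tree_field = tree_weights A m w T
  for A :: "real set" and m w and T :: "('v \<times> 'v) set" +
  fixes K :: "'v set"
  assumes T_sub: "T \<subseteq> K \<times> K"
begin

text \<open>A finite piece of the graph that shows every \<open>T\<close>-connection between points
  of \<open>D\<close>; by \<open>field_sum_stable\<close> it determines the law on
  \<open>D\<close>.\<close>

definition spans :: "'v set \<Rightarrow> 'v set \<Rightarrow> ('v \<times> 'v) set \<Rightarrow> bool"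
  where "spans D V E \<longleftrightarrow> finite V \<and> D \<subseteq> V \<and> V \<subseteq> K \<and> E \<subseteq> V \<times> V \<and> E \<subseteq> T \<and>
    (\<forall>d\<in>D. \<forall>d'\<in>D. linked T d d' \<longrightarrow> linked E d d')"

lemma spans_exists:
  assumes "finite D" "D \<subseteq> K"
  shows "\<exists>V E. spans D V E"
proof -
  obtain E where E: "E \<subseteq> T" "finite E" "\<forall>d\<in>D. \<forall>d'\<in>D. linked T d d' \<longrightarrow> linked E d d'"
    using linked_finite_skeleton[OF assms(1)] by blast
  have "E \<subseteq> (fst ` E \<union> snd ` E) \<times> (fst ` E \<union> snd ` E)" by force
  then have "spans D (D \<union> (fst ` E \<union> snd ` E)) E"
    unfolding spans_def using E assms T_sub by auto
  then show ?thesis by blast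
qed

lemma spans_subset: "spans H V E \<Longrightarrow> J \<subseteq> H \<Longrightarrow> spans J V E"
  unfolding spans_def by blast

lemma field_sum_mono:
  assumes "spans D V E" "finite V'" "V \<subseteq> V'" "E \<subseteq> E'" "E' \<subseteq> V' \<times> V'" "E' \<subseteq> T" "depends_on D f"
  shows "I V' E' f = I V E f"
proof -
  have s: "D \<subseteq> V" "E \<subseteq> V \<times> V" "\<And>d d'. d \<in> D \<Longrightarrow> d' \<in> D \<Longrightarrow> linked T d d' \<Longrightarrow> linked E d d'"
    using assms(1) by (auto simp: spans_def)
  have "I V' E' f = I V' E f"
    by (rule field_sum_stable[OF assms(2) _ assms(4-6) s(3) assms(7)]) (use s assms(3) in auto)
  also have "\<dots> = I V E f"
    by (rule field_sum_enlarge[OF assms(2,3) s(2) depends_on_mono[OF assms(7) s(1)]])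
  finally show ?thesis .
qed

text \<open>Both pieces are compared with their union, which is again a finite subgraph of the
  forest \<open>T\<close>.\<close>

lemma field_sum_unique:
  assumes "spans D V E" "spans D V' E'" "depends_on D f"
  shows "I V E f = I V' E' f"
proof -
  have "I (V \<union> V') (E \<union> E') f = I V E f"
    by (rule field_sum_mono[OF assms(1) _ _ _ _ _ assms(3)]) (use assms in \<open>auto simp: spans_def\<close>)
  moreover have "I (V \<union> V') (E \<union> E') f = I V' E' f"
    by (rule field_sum_mono[OF assms(2) _ _ _ _ _ assms(3)]) (use assms in \<open>auto simp: spans_def\<close>)
  ultimately show ?thesis by simp
qed

definition finite_field :: "'v set \<Rightarrow> ('v \<times> 'v) set \<Rightarrow> ('v \<Rightarrow> real) pmf"
  where "finite_field V E = embed_pmf (\<lambda>l. if l \<in> V \<rightarrow>\<^sub>E A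
    then (\<Prod>v\<in>V. m v (l v)) * (\<Prod>(u, v)\<in>E. w u v (l u) (l v)) else 0)"

lemma pmf_finite_field:
  assumes "finite V" "E \<subseteq> V \<times> V" "E \<subseteq> T"
  shows "pmf (finite_field V E) l = (if l \<in> V \<rightarrow>\<^sub>E A
    then (\<Prod>v\<in>V. m v (l v)) * (\<Prod>(u, v)\<in>E. w u v (l u) (l v)) else 0)"
  unfolding finite_field_def
proof (rule pmf_embed_pmf)
  let ?g = "\<lambda>l. (\<Prod>v\<in>V. m v (l v)) * (\<Prod>(u, v)\<in>E. w u v (l u) (l v))"
  have pos: "0 \<le> ?g l" for l
    by (intro mult_nonneg_nonneg prod_nonneg) (auto simp: m_nonneg w_nonneg)
  then show "0 \<le> (if l \<in> V \<rightarrow>\<^sub>E A then ?g l else 0)" for l by simp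
  have fin: "finite (V \<rightarrow>\<^sub>E A)" using assms(1) finite_A by (simp add: finite_PiE)
  have "(\<integral>\<^sup>+ l. ennreal (if l \<in> V \<rightarrow>\<^sub>E A then ?g l else 0) \<partial>count_space UNIV) =
      (\<Sum>l\<in>V \<rightarrow>\<^sub>E A. ennreal (if l \<in> V \<rightarrow>\<^sub>E A then ?g l else 0))"
    by (rule nn_integral_count_space'[OF fin]) auto
  also have "\<dots> = (\<Sum>l\<in>V \<rightarrow>\<^sub>E A. ennreal (?g l))" by (intro sum.cong) auto
  also have "\<dots> = ennreal (\<Sum>l\<in>V \<rightarrow>\<^sub>E A. ?g l)" using pos by (intro sum_ennreal)
  also have "(\<Sum>l\<in>V \<rightarrow>\<^sub>E A. ?g l) = I V E (\<lambda>_. 1)" by (simp add: field_sum_def)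
  also have "\<dots> = 1" by (rule field_sum_one[OF assms])
  finally show "(\<integral>\<^sup>+ l. ennreal (if l \<in> V \<rightarrow>\<^sub>E A then ?g l else 0) \<partial>count_space UNIV) = 1" by simp
qed

lemma measure_finite_field:
  assumes "finite V" "E \<subseteq> V \<times> V" "E \<subseteq> T"
  shows "measure (finite_field V E) S = I V E (indicator S)"
proof -
  have fin: "finite (V \<rightarrow>\<^sub>E A)" using assms(1) finite_A by (simp add: finite_PiE)
  have sub: "set_pmf (finite_field V E) \<subseteq> V \<rightarrow>\<^sub>E A"
    by (auto simp: set_pmf_iff pmf_finite_field[OF assms] split: if_splits)
  have "measure (finite_field V E) S = measure (finite_field V E) (S \<inter> (V \<rightarrow>\<^sub>E A))"
    by (rule measure_eq_AE) (use sub in \<open>auto simp: AE_measure_pmf_iff\<close>)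
  also have "\<dots> = (\<Sum>l\<in>S \<inter> (V \<rightarrow>\<^sub>E A). pmf (finite_field V E) l)"
    using fin by (intro measure_measure_pmf_finite) auto
  also have "\<dots> = (\<Sum>l\<in>V \<rightarrow>\<^sub>E A. indicator S l * pmf (finite_field V E) l)"
    using fin by (intro sum.mono_neutral_cong_left) (auto simp: indicator_def)
  also have "\<dots> = I V E (indicator S)"
    unfolding field_sum_def by (intro sum.cong refl) (simp add: pmf_finite_field[OF assms])
  finally show ?thesis .
qed

text \<open>The choice of the spanning piece is arbitrary and harmless, see
  \<open>marginal_eq\<close>. Since no root enters, the field will be natural under
  relabelling.\<close>

definition marginal :: "'v set \<Rightarrow> ('v \<Rightarrow> real) measure"
  where "marginal J = (case SOME (V, E). spans J V E of (V, E) \<Rightarrow>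
    distr (finite_field V E) (PiM J (\<lambda>_. borel)) (\<lambda>l. restrict l J))"

lemma restrict_measurable_pmf [measurable]:
  "(\<lambda>l. restrict l J) \<in> measurable (measure_pmf p) (PiM J (\<lambda>_. borel :: real measure))"
  by (auto simp: space_PiM)

text \<open>The atoms of the restricted law are field sums of indicators that depend on
  \<open>J\<close> only, so \<open>field_sum_unique\<close> applies.\<close>

lemma marginal_eq:
  assumes "spans J V E"
  shows "marginal J = distr (finite_field V E) (PiM J (\<lambda>_. borel)) (\<lambda>l. restrict l J)"
proof -
  define p where "p = (SOME p. case p of (V, E) \<Rightarrow> spans J V E)"
  have p: "spans J (fst p) (snd p)"
    using someI[of "\<lambda>p. case p of (V, E) \<Rightarrow> spans J V E" "(V, E)"] assms
    by (simp add: p_def case_prod_beta)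
  have "map_pmf (\<lambda>l. restrict l J) (finite_field (fst p) (snd p)) =
      map_pmf (\<lambda>l. restrict l J) (finite_field V E)"
  proof (rule pmf_eqI)
    fix x
    let ?S = "(\<lambda>l. restrict l J) -` {x} :: ('v \<Rightarrow> real) set"
    have dep: "depends_on J (indicator ?S :: ('v \<Rightarrow> real) \<Rightarrow> real)"
      unfolding depends_on_def
    proof (intro allI impI)
      fix l l' :: "'v \<Rightarrow> real" assume "\<forall>v\<in>J. l v = l' v"
      then have "restrict l J = restrict l' J" by (auto simp: fun_eq_iff)
      then show "indicator ?S l = (indicator ?S l' :: real)" by (simp add: indicator_def)
    qed
    show "pmf (map_pmf (\<lambda>l. restrict l J) (finite_field (fst p) (snd p))) x =
        pmf (map_pmf (\<lambda>l. restrict l J) (finite_field V E)) x"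
      using measure_finite_field[of "fst p" "snd p"] measure_finite_field[of V E]
        field_sum_unique[OF p assms dep] p assms
      by (auto simp: pmf_map spans_def)
  qed
  moreover have "distr (measure_pmf q) (PiM J (\<lambda>_. borel)) (\<lambda>l. restrict l J) =
      distr (map_pmf (\<lambda>l. restrict l J) q) (PiM J (\<lambda>_. borel)) (\<lambda>l. restrict l J)" for q :: "('v \<Rightarrow> real) pmf"
    unfolding map_pmf_rep_eq by (subst distr_distr) (auto simp: comp_def space_PiM)
  ultimately show ?thesis unfolding marginal_def p_def[symmetric] by (simp add: case_prod_beta) metis
qed

text \<open>Consistency is free: a piece that spans \<open>H\<close> spans every subset
  \<open>J\<close>, so both marginals are images of the same finite field. Labels are reals because
  the extension theorem is applied with Polish coordinate spaces.\<close>

sublocale kolmogorov: polish_projective K marginal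
proof (intro polish_projective.intro projective_family.intro)
  fix J H assume JH: "J \<subseteq> H" "finite H" "H \<subseteq> K"
  have "\<exists>V E. spans H V E" by (rule spans_exists) (use JH in auto)
  then obtain V E where s: "spans H V E" by blast
  show "marginal J = distr (marginal H) (PiM J (\<lambda>_. borel)) (\<lambda>f. restrict f J)"
    unfolding marginal_eq[OF s] marginal_eq[OF spans_subset[OF s JH(1)]]
    using JH(1) by (simp add: distr_distr[OF measurable_restrict_subset[OF JH(1)] restrict_measurable_pmf]
      comp_def Int_absorb1 Int_absorb2)
next
  fix J assume "finite J" "J \<subseteq> K"
  then have "\<exists>V E. spans J V E" by (intro spans_exists)
  then obtain V E where s: "spans J V E" by blast
  show "prob_space (marginal J)"
    unfolding marginal_eq[OF s] by (rule measure_pmf.prob_space_distr[OF restrict_measurable_pmf])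
qed

definition field :: "('v \<Rightarrow> real) measure"
  where "field = kolmogorov.lim"

lemma sets_field [measurable_cong, simp]: "sets field = sets (PiM K (\<lambda>_. borel))"
  unfolding field_def by simp

lemma space_field [simp]: "space field = K \<rightarrow>\<^sub>E UNIV"
  using sets_eq_imp_space_eq[OF sets_field] by (simp add: space_PiM)

lemma prob_space_field: "prob_space field"
  unfolding field_def by (rule kolmogorov.P.prob_space_axioms)

lemma measure_field:
  assumes J: "J \<subseteq> K" "spans J V E" and X: "X \<in> sets (PiM J (\<lambda>_. borel))"
  shows "measure field (prod_emb K (\<lambda>_. borel) J X) = I V E (\<lambda>l. indicator X (restrict l J))"
proof -
  have V: "finite V" "E \<subseteq> V \<times> V" "E \<subseteq> T" and finJ: "finite J"
    using J(2) by (auto simp: spans_def intro: finite_subset)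
  have "measure field (prod_emb K (\<lambda>_. borel) J X) = measure (marginal J) X"
    unfolding field_def by (rule kolmogorov.measure_lim_emb[OF J(1) finJ X])
  also have "\<dots> = measure (finite_field V E) ((\<lambda>l. restrict l J) -` X)"
    unfolding marginal_eq[OF J(2)] by (subst measure_distr) (use X in \<open>auto simp: space_PiM\<close>)
  also have "\<dots> = I V E (\<lambda>l. indicator X (restrict l J))"
    unfolding measure_finite_field[OF V] by (intro arg_cong[where f="I V E"]) (auto simp: indicator_def)
  finally show ?thesis .
qed

lemma measure_field_vertex:
  assumes v: "v \<in> K" and B: "B \<in> sets borel"
  shows "measure field {l \<in> space field. l v \<in> B} = (\<Sum>a\<in>A. m v a * indicator B a)"
proof -
  have s: "spans {v} {v} {}" using v by (simp add: spans_def)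
  have X: "(\<Pi>\<^sub>E i\<in>{v}. B) \<in> sets (PiM {v} (\<lambda>_. borel))" using B by (intro sets_PiM_I_finite) auto
  have "{l \<in> space field. l v \<in> B} = prod_emb K (\<lambda>_. borel) {v} (\<Pi>\<^sub>E i\<in>{v}. B)"
    using v by (auto simp: prod_emb_def PiE_def)
  also have "measure field \<dots> = I {v} {} (\<lambda>l. indicator (\<Pi>\<^sub>E i\<in>{v}. B) (restrict l {v}))"
    by (rule measure_field[OF _ s X]) (use v in auto)
  also have "\<dots> = I {v} {} (\<lambda>l. indicator B (l v))"
    by (intro arg_cong[where f="I {v} {}"]) (auto simp: indicator_def PiE_def fun_eq_iff)
  also have "\<dots> = (\<Sum>a\<in>A. m v a * indicator B a)" by (rule field_sum_vertex) auto
  finally show ?thesis .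
qed

text \<open>A single edge spans its two endpoints, so the pair of labels has exactly the coupling
  density prescribed on it, whatever the rest of the forest is.\<close>

lemma measure_field_edge:
  assumes uv: "(u, v) \<in> T" and "P \<subseteq> A \<times> A"
  shows "measure field {l \<in> space field. (l u, l v) \<in> P} = (\<Sum>(a, b)\<in>P. m u a * m v b * w u v a b)"
proof -
  have ne: "u \<noteq> v" using forest_T uv unfolding forest_def by auto
  have K: "u \<in> K" "v \<in> K" using uv T_sub by auto
  have finP: "finite P" using assms(2) finite_A finite_subset by blast
  have s: "spans {u, v} {u, v} {(u, v)}"
    using uv K by (auto simp: spans_def intro: linked_edge linked_sym)
  let ?X = "{l \<in> space (PiM {u, v} (\<lambda>_. borel :: real measure)). (l u, l v) \<in> P}"
  have "(\<lambda>l. (l u, l v)) \<in> PiM {u, v} (\<lambda>_. borel) \<rightarrow>\<^sub>M (borel :: (real \<times> real) measure)"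
    by (subst borel_prod[symmetric]) simp
  moreover have "P \<in> sets borel" using finP by (simp add: borel_closed finite_imp_closed)
  ultimately have "(\<lambda>l. (l u, l v)) -` P \<inter> space (PiM {u, v} (\<lambda>_. borel)) \<in> sets (PiM {u, v} (\<lambda>_. borel))"
    by (rule measurable_sets)
  also have "(\<lambda>l. (l u, l v)) -` P \<inter> space (PiM {u, v} (\<lambda>_. borel)) = ?X" by auto
  finally have X: "?X \<in> sets (PiM {u, v} (\<lambda>_. borel))" .
  have "{l \<in> space field. (l u, l v) \<in> P} = prod_emb K (\<lambda>_. borel) {u, v} ?X"
    using K by (auto simp: prod_emb_def space_PiM PiE_def extensional_def)
  also have "measure field \<dots> = I {u, v} {(u, v)} (\<lambda>l. indicator ?X (restrict l {u, v}))"
    by (rule measure_field[OF _ s X]) (use K in auto)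
  also have "\<dots> = I {u, v} {(u, v)} (\<lambda>l. indicator P (l u, l v))"
    by (intro arg_cong[where f="I {u, v} {(u, v)}"]) (auto simp: indicator_def fun_eq_iff space_PiM)
  also have "\<dots> = (\<Sum>l\<in>{u, v} \<rightarrow>\<^sub>E A. indicator P (l u, l v) * (m u (l u) * m v (l v) * w u v (l u) (l v)))"
    unfolding field_sum_def using ne by (simp add: mult_ac)
  also have "\<dots> = (\<Sum>(a, b)\<in>A \<times> A. indicator P (a, b) * (m u a * m v b * w u v a b))"
    by (rule sum.reindex_bij_witness[of _ "\<lambda>(a, b) x. if x = u then a else if x = v then b else undefined"
          "\<lambda>l. (l u, l v)"])
       (use ne in \<open>auto simp: PiE_def extensional_def fun_eq_iff\<close>)
  also have "\<dots> = (\<Sum>(a, b)\<in>P. m u a * m v b * w u v a b)"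
    by (rule sum.mono_neutral_cong_right) (use assms(2) finite_A in \<open>auto simp: indicator_def\<close>)
  finally show ?thesis .
qed

end

section \<open>Dependence of the field on its data: symmetry and measurability\<close>

lemma field_sum_reindex:
  assumes \<sigma>: "inj_on \<sigma> V" and E: "E \<subseteq> V \<times> V"
    and m: "\<And>v. v \<in> V \<Longrightarrow> m' v = m (\<sigma> v)"
    and w: "\<And>u v. (u, v) \<in> E \<Longrightarrow> w' u v = w (\<sigma> u) (\<sigma> v)"
    and f: "\<And>l. l \<in> \<sigma> ` V \<rightarrow>\<^sub>E A \<Longrightarrow> f l = f' (\<lambda>v\<in>V. l (\<sigma> v))"
  shows "field_sum A m w (\<sigma> ` V) (map_prod \<sigma> \<sigma> ` E) f = field_sum A m' w' V E f'"
  unfolding field_sum_def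
proof (rule sum.reindex_bij_witness[of _ "\<lambda>k. \<lambda>y\<in>\<sigma> ` V. k (the_inv_into V \<sigma> y)" "\<lambda>l. \<lambda>v\<in>V. l (\<sigma> v)"])
  fix l assume l: "l \<in> \<sigma> ` V \<rightarrow>\<^sub>E A"
  have "(\<lambda>y\<in>\<sigma> ` V. (\<lambda>v\<in>V. l (\<sigma> v)) (the_inv_into V \<sigma> y)) y = l y" for y
    using l by (cases "y \<in> \<sigma> ` V") (auto simp: PiE_def extensional_def the_inv_into_f_f[OF \<sigma>])
  then show "(\<lambda>y\<in>\<sigma> ` V. (\<lambda>v\<in>V. l (\<sigma> v)) (the_inv_into V \<sigma> y)) = l" by blast
  show "(\<lambda>v\<in>V. l (\<sigma> v)) \<in> V \<rightarrow>\<^sub>E A" using l by auto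
  have inj: "inj_on (map_prod \<sigma> \<sigma>) E" using inj_on_subset[OF map_prod_inj_on[OF \<sigma> \<sigma>] E] .
  have "(\<Prod>v\<in>\<sigma> ` V. m v (l v)) = (\<Prod>v\<in>V. m' v ((\<lambda>v\<in>V. l (\<sigma> v)) v))"
    by (subst prod.reindex[OF \<sigma>]) (auto intro!: prod.cong simp: m)
  moreover have "(\<Prod>(u, v)\<in>map_prod \<sigma> \<sigma> ` E. w u v (l u) (l v)) =
      (\<Prod>(u, v)\<in>E. w' u v ((\<lambda>v\<in>V. l (\<sigma> v)) u) ((\<lambda>v\<in>V. l (\<sigma> v)) v))"
  proof (subst prod.reindex[OF inj], intro prod.cong refl)
    fix e assume "e \<in> E"
    then show "((\<lambda>(u, v). w u v (l u) (l v)) \<circ> map_prod \<sigma> \<sigma>) e =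
        (case e of (u, v) \<Rightarrow> w' u v ((\<lambda>v\<in>V. l (\<sigma> v)) u) ((\<lambda>v\<in>V. l (\<sigma> v)) v))"
      using E w by (cases e) auto
  qed
  ultimately show "f' (\<lambda>v\<in>V. l (\<sigma> v)) * (\<Prod>v\<in>V. m' v ((\<lambda>v\<in>V. l (\<sigma> v)) v)) *
      (\<Prod>(u, v)\<in>E. w' u v ((\<lambda>v\<in>V. l (\<sigma> v)) u) ((\<lambda>v\<in>V. l (\<sigma> v)) v)) =
      f l * (\<Prod>v\<in>\<sigma> ` V. m v (l v)) * (\<Prod>(u, v)\<in>map_prod \<sigma> \<sigma> ` E. w u v (l u) (l v))"
    using f[OF l] by simp
next
  fix k assume k: "k \<in> V \<rightarrow>\<^sub>E A"
  have "(\<lambda>v\<in>V. (\<lambda>y\<in>\<sigma> ` V. k (the_inv_into V \<sigma> y)) (\<sigma> v)) v = k v" for v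
    using k by (cases "v \<in> V") (auto simp: PiE_def extensional_def the_inv_into_f_f[OF \<sigma>])
  then show "(\<lambda>v\<in>V. (\<lambda>y\<in>\<sigma> ` V. k (the_inv_into V \<sigma> y)) (\<sigma> v)) = k" by blast
  show "(\<lambda>y\<in>\<sigma> ` V. k (the_inv_into V \<sigma> y)) \<in> \<sigma> ` V \<rightarrow>\<^sub>E A"
    using k by (auto simp: the_inv_into_f_f[OF \<sigma>])
qed

text \<open>Cylinder probabilities may be computed from any spanning piece, and
  \<open>\<sigma>\<close> carries a spanning piece for the primed data to one for the other data.
  This naturality becomes invariance of the measure on the extension.\<close>

lemma field_equivariant:
  assumes F: "tree_field A m w T K" and F': "tree_field A m' w' T' K"
    and \<sigma>: "bij_betw \<sigma> K K"
    and m: "\<And>v. v \<in> K \<Longrightarrow> m' v = m (\<sigma> v)"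
    and w: "\<And>u v. u \<in> K \<Longrightarrow> v \<in> K \<Longrightarrow> w' u v = w (\<sigma> u) (\<sigma> v)"
    and T: "\<And>u v. u \<in> K \<Longrightarrow> v \<in> K \<Longrightarrow> (u, v) \<in> T' \<longleftrightarrow> (\<sigma> u, \<sigma> v) \<in> T"
  shows "tree_field.field A m' w' T' K =
    distr (tree_field.field A m w T K) (PiM K (\<lambda>_. borel)) (\<lambda>l. \<lambda>v\<in>K. l (\<sigma> v))" (is "?L = ?R")
proof -
  interpret F: tree_field A m w T K by fact
  interpret F': tree_field A m' w' T' K by fact
  interpret F'p: prob_space F'.field by (rule F'.prob_space_field)
  interpret Fp: prob_space F.field by (rule F.prob_space_field)
  have inj: "inj_on \<sigma> K" and \<sigma>K: "\<And>v. v \<in> K \<Longrightarrow> \<sigma> v \<in> K" using \<sigma> by (auto simp: bij_betw_def)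
  have shift [measurable]: "(\<lambda>l. \<lambda>v\<in>K. l (\<sigma> v)) \<in> F.field \<rightarrow>\<^sub>M PiM K (\<lambda>_. borel)"
    by (intro measurable_restrict) (simp add: \<sigma>K measurable_cong_sets[OF F.sets_field refl])
  have box: "emeasure ?L (prod_emb K (\<lambda>_. borel) J (Pi\<^sub>E J X)) = emeasure ?R (prod_emb K (\<lambda>_. borel) J (Pi\<^sub>E J X))"
    if J: "finite J" "J \<subseteq> K" and X: "\<And>i. i \<in> J \<Longrightarrow> X i \<in> sets borel" for J and X :: "'a \<Rightarrow> real set"
  proof -
    obtain V E where s: "F'.spans J V E" using F'.spans_exists J by blast
    then have V: "finite V" "J \<subseteq> V" "V \<subseteq> K" "E \<subseteq> V \<times> V" "E \<subseteq> T'" by (auto simp: F'.spans_def)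
    let ?\<tau> = "the_inv_into K \<sigma>"
    have "F.spans (\<sigma> ` J) (\<sigma> ` V) (map_prod \<sigma> \<sigma> ` E)"
      unfolding F.spans_def
    proof (intro conjI ballI impI)
      show "map_prod \<sigma> \<sigma> ` E \<subseteq> T"
      proof
        fix e assume "e \<in> map_prod \<sigma> \<sigma> ` E"
        then obtain u v where uv: "(u, v) \<in> E" "e = (\<sigma> u, \<sigma> v)" by auto
        then have "u \<in> K" "v \<in> K" "(u, v) \<in> T'" using V by auto
        then show "e \<in> T" using T uv by simp
      qed
    next
      fix d d' assume "d \<in> \<sigma> ` J" "d' \<in> \<sigma> ` J" and l: "linked T d d'"
      then obtain x x' where x: "x \<in> J" "x' \<in> J" "d = \<sigma> x" "d' = \<sigma> x'" by auto
      have "linked T' (?\<tau> (\<sigma> x)) (?\<tau> (\<sigma> x'))"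
      proof (rule linked_image[where E=T and \<sigma>="?\<tau>" and u="\<sigma> x" and v="\<sigma> x'"])
        show "linked T (\<sigma> x) (\<sigma> x')" using l x by simp
        fix y z assume yz: "(y, z) \<in> T"
        then have "y \<in> \<sigma> ` K" "z \<in> \<sigma> ` K"
          using F.T_sub by (auto simp: bij_betw_imp_surj_on[OF \<sigma>])
        then obtain y' z' where "y' \<in> K" "z' \<in> K" "y = \<sigma> y'" "z = \<sigma> z'" by (elim imageE)
        then show "(?\<tau> y, ?\<tau> z) \<in> T'" using yz T by (simp add: the_inv_into_f_f[OF inj])
      qed
      then have "linked T' x x'" using x J by (simp add: the_inv_into_f_f[OF inj] subset_eq)
      then have "linked E x x'" using s x by (simp add: F'.spans_def)
      then show "linked (map_prod \<sigma> \<sigma> ` E) d d'" unfolding x(3,4) by (rule linked_image) auto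
    qed (use V \<sigma>K in auto)
    note s\<sigma> = this
    define X' where "X' = {l \<in> space (PiM (\<sigma> ` J) (\<lambda>_. borel :: real measure)). (\<lambda>v\<in>J. l (\<sigma> v)) \<in> Pi\<^sub>E J X}"
    have meas: "(\<lambda>l. \<lambda>v\<in>J. l (\<sigma> v)) \<in> PiM (\<sigma> ` J) (\<lambda>_. borel) \<rightarrow>\<^sub>M PiM J (\<lambda>_. borel :: real measure)"
      by (intro measurable_restrict) simp
    have XJ: "Pi\<^sub>E J X \<in> sets (PiM J (\<lambda>_. borel))" using J X by (intro sets_PiM_I_finite) auto
    have "X' = (\<lambda>l. \<lambda>v\<in>J. l (\<sigma> v)) -` Pi\<^sub>E J X \<inter> space (PiM (\<sigma> ` J) (\<lambda>_. borel))"
      by (auto simp: X'_def)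
    then have X': "X' \<in> sets (PiM (\<sigma> ` J) (\<lambda>_. borel))" using measurable_sets[OF meas XJ] by simp
    have embJ: "prod_emb K (\<lambda>_. borel) J (Pi\<^sub>E J X) \<in> sets (PiM K (\<lambda>_. borel))"
      using J X by (intro sets_PiM_I) auto
    have "measure ?R (prod_emb K (\<lambda>_. borel) J (Pi\<^sub>E J X)) =
        measure F.field ((\<lambda>l. \<lambda>v\<in>K. l (\<sigma> v)) -` prod_emb K (\<lambda>_. borel) J (Pi\<^sub>E J X) \<inter> space F.field)"
      by (rule measure_distr[OF shift embJ])
    also have "(\<lambda>l. \<lambda>v\<in>K. l (\<sigma> v)) -` prod_emb K (\<lambda>_. borel) J (Pi\<^sub>E J X) \<inter> space F.field =
        prod_emb K (\<lambda>_. borel) (\<sigma> ` J) X'"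
      using J \<sigma>K unfolding prod_emb_def X'_def
      by (auto simp: space_PiM PiE_iff extensional_def subset_eq Ball_def)
    also have "measure F.field \<dots> =
        field_sum A m w (\<sigma> ` V) (map_prod \<sigma> \<sigma> ` E) (\<lambda>l. indicator X' (restrict l (\<sigma> ` J)))"
      by (rule F.measure_field[OF _ s\<sigma> X']) (use J \<sigma>K in auto)
    also have "\<dots> = field_sum A m' w' V E (\<lambda>l. indicator (Pi\<^sub>E J X) (restrict l J))"
    proof (rule field_sum_reindex)
      show "inj_on \<sigma> V" using inj V(3) by (rule inj_on_subset)
      show "\<And>v. v \<in> V \<Longrightarrow> m' v = m (\<sigma> v)" using m V by auto
      fix u v assume "(u, v) \<in> E"
      then show "w' u v = w (\<sigma> u) (\<sigma> v)" using V by (intro w) auto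
    next
      fix l assume "l \<in> \<sigma> ` V \<rightarrow>\<^sub>E A"
      have "(\<lambda>v\<in>J. restrict l (\<sigma> ` J) (\<sigma> v)) = restrict (\<lambda>v\<in>V. l (\<sigma> v)) J"
        using V by (auto simp: fun_eq_iff)
      moreover have "restrict l (\<sigma> ` J) \<in> X' \<longleftrightarrow> (\<lambda>v\<in>J. restrict l (\<sigma> ` J) (\<sigma> v)) \<in> Pi\<^sub>E J X"
        unfolding X'_def by (auto simp: space_PiM)
      ultimately show "(indicator X' (restrict l (\<sigma> ` J)) :: real) =
          indicator (Pi\<^sub>E J X) (restrict (\<lambda>v\<in>V. l (\<sigma> v)) J)"
        unfolding indicator_def by presburger
    qed (rule V)
    also have "\<dots> = measure ?L (prod_emb K (\<lambda>_. borel) J (Pi\<^sub>E J X))"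
      by (rule F'.measure_field[OF J(2) s XJ, symmetric])
    finally have eq: "measure ?R (prod_emb K (\<lambda>_. borel) J (Pi\<^sub>E J X)) =
        measure ?L (prod_emb K (\<lambda>_. borel) J (Pi\<^sub>E J X))" .
    show ?thesis
      by (simp only: F'p.emeasure_eq_measure eq
        finite_measure.emeasure_eq_measure[OF prob_space.finite_measure[OF Fp.prob_space_distr[OF shift]]])
  qed
  show ?thesis
    by (rule measure_eqI_PiM_infinite[where I=K and M="\<lambda>_. borel"])
       (auto intro: box F'p.finite_measure_axioms)
qed

text \<open>A spanning piece depends on \<open>z\<close>, so no single one can be used. Instead
  \<open>K\<close> is exhausted by fixed finite sets \<open>V n\<close>: for each \<open>z\<close>
  the field sums over \<open>T z\<close> restricted to \<open>V n\<close> are eventually equal to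
  the cylinder probability, and each of them is a finite expression in the data.\<close>

lemma field_kernel:
  assumes K: "countable K"
    and F: "\<And>z. z \<in> space N \<Longrightarrow> tree_field A (m z) (w z) (T z) K"
    and m [measurable]: "\<And>v a. v \<in> K \<Longrightarrow> (\<lambda>z. m z v a) \<in> borel_measurable N"
    and w [measurable]: "\<And>u v a b. u \<in> K \<Longrightarrow> v \<in> K \<Longrightarrow> (\<lambda>z. w z u v a b) \<in> borel_measurable N"
    and T [measurable]: "\<And>u v. u \<in> K \<Longrightarrow> v \<in> K \<Longrightarrow> Measurable.pred N (\<lambda>z. (u, v) \<in> T z)"
  shows "(\<lambda>z. tree_field.field A (m z) (w z) (T z) K) \<in> N \<rightarrow>\<^sub>M prob_algebra (PiM K (\<lambda>_. borel))"
proof (rule measurable_prob_algebra_generated[OF sets_PiM Int_stable_prod_algebra prod_algebra_sets_into_space])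
  fix z assume z: "z \<in> space N"
  interpret tree_field A "m z" "w z" "T z" K using F[OF z] .
  show "prob_space field" by (rule prob_space_field)
  show "sets field = sets (PiM K (\<lambda>_. borel))" by simp
next
  fix Y :: "('a \<Rightarrow> real) set" assume "Y \<in> prod_algebra K (\<lambda>_. borel)"
  then obtain J X where Y: "Y = prod_emb K (\<lambda>_. borel) J (Pi\<^sub>E J X)" and J: "finite J" "J \<subseteq> K"
    and X: "\<And>i. i \<in> J \<Longrightarrow> X i \<in> sets borel"
    by (elim prod_algebraE) auto
  have XJ: "Pi\<^sub>E J X \<in> sets (PiM J (\<lambda>_. borel))" using J X by (intro sets_PiM_I_finite) auto
  define V where "V n = J \<union> {k \<in> K. to_nat_on K k \<le> n}" for n
  have "finite {k \<in> K. to_nat_on K k \<le> n}" for n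
    by (rule inj_on_finite[of "to_nat_on K" _ "{..n}"])
       (use inj_on_to_nat_on[OF K] in \<open>auto intro: inj_on_subset\<close>)
  then have V: "finite (V n)" "V n \<subseteq> K" for n using J by (auto simp: V_def)
  define f :: "('a \<Rightarrow> real) \<Rightarrow> real" where "f l = indicator (Pi\<^sub>E J X) (restrict l J)" for l
  have f: "depends_on J f"
    unfolding depends_on_def
  proof (intro allI impI)
    fix l l' :: "'a \<Rightarrow> real" assume "\<forall>v\<in>J. l v = l' v"
    then have "restrict l J = restrict l' J" by (auto simp: fun_eq_iff)
    then show "f l = f l'" by (simp add: f_def)
  qed
  have lim: "(\<lambda>n. field_sum A (m z) (w z) (V n) (T z \<inter> V n \<times> V n) f) \<longlonglongrightarrow>
      measure (tree_field.field A (m z) (w z) (T z) K) Y" if z: "z \<in> space N" for z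
  proof -
    interpret tree_field A "m z" "w z" "T z" K using F[OF z] .
    obtain V0 E0 where s: "spans J V0 E0" using spans_exists J by blast
    then have V0: "finite V0" "V0 \<subseteq> K" "E0 \<subseteq> V0 \<times> V0" "E0 \<subseteq> T z" by (auto simp: spans_def)
    have "eventually (\<lambda>n. \<forall>v\<in>V0. to_nat_on K v \<le> n) sequentially"
      using V0(1) by (simp add: eventually_ball_finite_distrib eventually_ge_at_top)
    then have "eventually (\<lambda>n. I (V n) (T z \<inter> V n \<times> V n) f = measure field Y) sequentially"
    proof eventually_elim
      case (elim n)
      then have "V0 \<subseteq> V n" using V0 by (auto simp: V_def)
      then have "I (V n) (T z \<inter> V n \<times> V n) f = I V0 E0 f"
        by (intro field_sum_mono[OF s _ _ _ _ _ f]) (use V V0 in auto)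
      also have "\<dots> = measure field Y" unfolding Y f_def by (rule measure_field[OF J(2) s XJ, symmetric])
      finally show ?case .
    qed
    then show ?thesis by (rule tendsto_eventually)
  qed
  have [measurable]: "(\<lambda>z. field_sum A (m z) (w z) (V n) (T z \<inter> V n \<times> V n) f) \<in> borel_measurable N" for n
  proof -
    \<comment> \<open>The range of the product varies with \<open>z\<close>; inserting factors one
      makes it a product over a fixed finite set.\<close>
    have "(\<Prod>(u, v)\<in>T z \<inter> V n \<times> V n. w z u v (l u) (l v)) =
        (\<Prod>e\<in>V n \<times> V n. if e \<in> T z then w z (fst e) (snd e) (l (fst e)) (l (snd e)) else 1)" for z l
      using V(1)[of n] by (subst prod.inter_restrict[symmetric]) (auto simp: Int_commute intro!: prod.cong)
    then have eq: "field_sum A (m z) (w z) (V n) (T z \<inter> V n \<times> V n) f =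
        (\<Sum>l\<in>V n \<rightarrow>\<^sub>E A. f l * (\<Prod>v\<in>V n. m z v (l v)) *
          (\<Prod>e\<in>V n \<times> V n. if e \<in> T z then w z (fst e) (snd e) (l (fst e)) (l (snd e)) else 1))" for z
      by (simp add: field_sum_def)
    have "(\<lambda>z. if e \<in> T z then w z (fst e) (snd e) (l (fst e)) (l (snd e)) else 1) \<in> borel_measurable N"
      if "e \<in> V n \<times> V n" for e and l :: "'a \<Rightarrow> real"
    proof -
      have "fst e \<in> K" "snd e \<in> K" using that V(2)[of n] by auto
      then show ?thesis using T[of "fst e" "snd e"] by (intro measurable_If w) auto
    qed
    moreover have "(\<lambda>z. m z v (l v)) \<in> borel_measurable N" if "v \<in> V n" for v and l :: "'a \<Rightarrow> real"
      by (rule m) (use that V in auto)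
    ultimately show ?thesis
      unfolding eq by (intro borel_measurable_sum borel_measurable_times borel_measurable_prod) auto
  qed
  have "(\<lambda>z. measure (tree_field.field A (m z) (w z) (T z) K) Y) \<in> borel_measurable N"
    by (rule borel_measurable_LIMSEQ_real[OF lim]) measurable
  then have "(\<lambda>z. ennreal (measure (tree_field.field A (m z) (w z) (T z) K) Y)) \<in> borel_measurable N"
    by measurable
  then show "(\<lambda>z. emeasure (tree_field.field A (m z) (w z) (T z) K) Y) \<in> borel_measurable N"
  proof (rule measurable_cong[THEN iffD1, rotated])
    fix z assume z: "z \<in> space N"
    interpret tree_field A "m z" "w z" "T z" K using F[OF z] .
    interpret prob_space field by (rule prob_space_field)
    show "ennreal (measure field Y) = emeasure field Y" by (simp add: emeasure_eq_measure)
  qed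
qed

section \<open>Couplings with prescribed marginals\<close>

text \<open>\<open>w\<close> is a density of a coupling of \<open>\<mu>\<close> and
  \<open>\<nu>\<close>, in the sense used by \<open>tree_weights\<close>. Closeness to
  \<open>\<kappa>\<close> is one-sided, as improbable events merely have to stay improbable. It is
  conditional on \<open>\<kappa>\<close> having mass one, so that some \<open>w\<close> exists for
  every nonnegative \<open>\<kappa>\<close>, the zero table included, and can be selected for all
  parameters at once.\<close>

definition close_coupling ::
  "'a set \<Rightarrow> ('a \<Rightarrow> real) \<Rightarrow> ('a \<Rightarrow> real) \<Rightarrow> ('a \<Rightarrow> 'a \<Rightarrow> real) \<Rightarrow> ('a \<Rightarrow> 'a \<Rightarrow> real) \<Rightarrow> bool"
  where "close_coupling A \<mu> \<nu> \<kappa> w \<longleftrightarrow> (\<forall>a b. 0 \<le> w a b) \<and>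
    (\<forall>a\<in>A. \<mu> a \<noteq> 0 \<longrightarrow> (\<Sum>b\<in>A. \<nu> b * w a b) = 1) \<and>
    (\<forall>b\<in>A. \<nu> b \<noteq> 0 \<longrightarrow> (\<Sum>a\<in>A. \<mu> a * w a b) = 1) \<and>
    ((\<Sum>a\<in>A. \<Sum>b\<in>A. \<kappa> a b) = 1 \<longrightarrow> (\<forall>\<eta>::real. (\<forall>a\<in>A. (\<Sum>b\<in>A. \<kappa> a b) \<le> \<mu> a + \<eta>) \<longrightarrow>
      (\<forall>b\<in>A. (\<Sum>a\<in>A. \<kappa> a b) \<le> \<nu> b + \<eta>) \<longrightarrow> 0 \<le> \<eta> \<longrightarrow>
      (\<forall>P\<subseteq>A \<times> A. (\<Sum>(a, b)\<in>P. \<mu> a * \<nu> b * w a b) \<le> (\<Sum>(a, b)\<in>P. \<kappa> a b) + 2 * card A * \<eta>)))"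

text \<open>Scaling rows and columns of \<open>\<kappa>\<close> down so that neither marginal exceeds its target, and
  distributing the missing mass as a product, gives a coupling of \<open>\<mu>\<close> and \<open>\<nu>\<close> close to \<open>\<kappa>\<close>.\<close>

lemma close_coupling_exists:
  fixes \<kappa> :: "'a \<Rightarrow> 'a \<Rightarrow> real" and \<mu> \<nu> :: "'a \<Rightarrow> real"
  assumes A: "finite A" and \<kappa>: "\<And>a b. 0 \<le> \<kappa> a b"
    and \<mu>: "\<And>a. 0 \<le> \<mu> a" "(\<Sum>a\<in>A. \<mu> a) = 1" and \<nu>: "\<And>a. 0 \<le> \<nu> a" "(\<Sum>a\<in>A. \<nu> a) = 1"
  shows "\<exists>w. close_coupling A \<mu> \<nu> \<kappa> w"
proof -
  define k1 where "k1 a = (\<Sum>b\<in>A. \<kappa> a b)" for a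
  define k2 where "k2 b = (\<Sum>a\<in>A. \<kappa> a b)" for b
  \<comment> \<open>If a row of \<open>\<kappa>\<close> has sum zero, the quotient is
    \<open>0\<close> and so is \<open>r a\<close>; the row vanishes anyway.\<close>
  define r where "r a = min 1 (\<mu> a / k1 a)" for a
  define c where "c b = min 1 (\<nu> b / k2 b)" for b
  define s where "s a b = \<kappa> a b * r a * c b" for a b
  define d where "d a = \<mu> a - (\<Sum>b\<in>A. s a b)" for a
  define e where "e b = \<nu> b - (\<Sum>a\<in>A. s a b)" for b
  \<comment> \<open>The mass lost by scaling, which is also the sum of \<open>d\<close> and the sum
    of \<open>e\<close>. If \<open>t = 0\<close> then \<open>d\<close> and \<open>e\<close> vanish
    on \<open>A\<close>, and the product term is \<open>0 / 0 = 0\<close>.\<close>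
  define t where "t = 1 - (\<Sum>a\<in>A. \<Sum>b\<in>A. s a b)"
  define k where "k a b = s a b + d a * e b / t" for a b
  define w where "w a b = (if a \<in> A \<and> b \<in> A then k a b / (\<mu> a * \<nu> b) else 0)" for a b
  have k1: "0 \<le> k1 a" and k2: "0 \<le> k2 a" for a
    unfolding k1_def k2_def using \<kappa> by (auto intro: sum_nonneg)
  have r: "0 \<le> r a" "r a \<le> 1" and c: "0 \<le> c a" "c a \<le> 1" for a
    using k1 k2 \<mu>(1) \<nu>(1) by (auto simp: r_def c_def)
  have s0: "0 \<le> s a b" for a b using \<kappa> r c by (simp add: s_def)
  have rk': "k1 a * r a = min (k1 a) (\<mu> a)" for a
    using k1[of a] \<mu>(1)[of a] by (cases "k1 a = 0") (auto simp: r_def min_mult_distrib_left)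
  have ck': "k2 a * c a = min (k2 a) (\<nu> a)" for a
    using k2[of a] \<nu>(1)[of a] by (cases "k2 a = 0") (auto simp: c_def min_mult_distrib_left)
  have rk: "k1 a * r a \<le> \<mu> a" and ck: "k2 a * c a \<le> \<nu> a" for a by (simp_all add: rk' ck')
  have d: "0 \<le> d a" for a
  proof -
    have "(\<Sum>b\<in>A. s a b) \<le> (\<Sum>b\<in>A. \<kappa> a b * r a)"
      unfolding s_def using c r \<kappa> by (intro sum_mono mult_left_le) auto
    also have "\<dots> = k1 a * r a" by (simp add: k1_def sum_distrib_right)
    finally show ?thesis using rk[of a] by (simp add: d_def)
  qed
  have e: "0 \<le> e b" for b
  proof -
    have "(\<Sum>a\<in>A. s a b) \<le> (\<Sum>a\<in>A. \<kappa> a b * c b)"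
      unfolding s_def using c r \<kappa> by (intro sum_mono mult_right_mono mult_left_le) auto
    also have "\<dots> = k2 b * c b" by (simp add: k2_def sum_distrib_right)
    finally show ?thesis using ck[of b] by (simp add: e_def)
  qed
  have sd: "sum d A = t" by (simp add: d_def t_def sum_subtractf \<mu>)
  have se: "sum e A = t" by (simp add: e_def t_def sum_subtractf \<nu> sum.swap[of s A A])
  have t: "0 \<le> t" using sd sum_nonneg[of A d] d by simp
  have d0: "d a = 0" if "a \<in> A" "t = 0" for a
    using that sd d sum_nonneg_eq_0_iff[OF A, of d] by auto
  have e0: "e a = 0" if "a \<in> A" "t = 0" for a
    using that se e sum_nonneg_eq_0_iff[OF A, of e] by auto
  have k0: "0 \<le> k a b" for a b using s0 d e t by (simp add: k_def)
  have row: "(\<Sum>b\<in>A. k a b) = \<mu> a" if "a \<in> A" for a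
  proof -
    have "(\<Sum>b\<in>A. k a b) = (\<Sum>b\<in>A. s a b) + d a * sum e A / t"
      by (simp add: k_def sum.distrib sum_distrib_left sum_divide_distrib)
    also have "\<dots> = \<mu> a" using d0[OF that] by (cases "t = 0") (auto simp: se d_def)
    finally show ?thesis .
  qed
  have col: "(\<Sum>a\<in>A. k a b) = \<nu> b" if "b \<in> A" for b
  proof -
    have "(\<Sum>a\<in>A. k a b) = (\<Sum>a\<in>A. s a b) + sum d A * e b / t"
      by (simp add: k_def sum.distrib sum_distrib_right sum_divide_distrib)
    also have "\<dots> = \<nu> b" using e0[OF that] by (cases "t = 0") (auto simp: sd e_def)
    finally show ?thesis .
  qed
  \<comment> \<open>Hence \<open>k\<close> vanishes wherever \<open>\<mu> a\<close> or
    \<open>\<nu> b\<close> does, and dividing by their product in \<open>w\<close> loses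
    nothing.\<close>
  have k_le: "k a b \<le> \<mu> a" "k a b \<le> \<nu> b" if "a \<in> A" "b \<in> A" for a b
    using member_le_sum[of b A "k a"] member_le_sum[of a A "\<lambda>a. k a b"] row col k0 A that by auto
  have wk: "\<mu> a * \<nu> b * w a b = k a b" if "a \<in> A" "b \<in> A" for a b
    using k_le[OF that] k0[of a b] that by (auto simp: w_def)
  have w1: "(\<Sum>b\<in>A. \<nu> b * w a b) = 1" if a: "a \<in> A" "\<mu> a \<noteq> 0" for a
  proof -
    have "\<mu> a * (\<Sum>b\<in>A. \<nu> b * w a b) = (\<Sum>b\<in>A. k a b)"
      unfolding sum_distrib_left by (intro sum.cong) (auto simp: wk[OF a(1), symmetric])
    then show ?thesis using row[OF a(1)] a(2) by simp
  qed
  have w2: "(\<Sum>a\<in>A. \<mu> a * w a b) = 1" if b: "b \<in> A" "\<nu> b \<noteq> 0" for b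
  proof -
    have "\<nu> b * (\<Sum>a\<in>A. \<mu> a * w a b) = (\<Sum>a\<in>A. k a b)"
      unfolding sum_distrib_left by (intro sum.cong) (auto simp: wk[OF _ b(1), symmetric])
    then show ?thesis using col[OF b(1)] b(2) by simp
  qed
  have bound: "(\<Sum>(a, b)\<in>P. \<mu> a * \<nu> b * w a b) \<le> (\<Sum>(a, b)\<in>P. \<kappa> a b) + 2 * card A * \<eta>"
    if total: "(\<Sum>a\<in>A. \<Sum>b\<in>A. \<kappa> a b) = 1" and \<eta>: "0 \<le> \<eta>" "\<forall>a\<in>A. k1 a \<le> \<mu> a + \<eta>" "\<forall>b\<in>A. k2 b \<le> \<nu> b + \<eta>"
      and P: "P \<subseteq> A \<times> A" for \<eta> :: real and P
  proof -
    have rdef: "k1 a * (1 - r a) \<le> \<eta>" if "a \<in> A" for a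
      using \<eta> that rk'[of a] by (auto simp: right_diff_distrib min_def)
    have cdef: "k2 a * (1 - c a) \<le> \<eta>" if "a \<in> A" for a
      using \<eta> that ck'[of a] by (auto simp: right_diff_distrib min_def)
    \<comment> \<open>Summed over rows and columns, this shows that the scaling loses at most
      \<open>\<eta>\<close> for each row and each column, whence
      \<open>t \<le> 2 * card A * \<eta>\<close>; and \<open>t\<close> is the total mass of the
      product term.\<close>
    have le: "\<kappa> a b - s a b \<le> \<kappa> a b * (1 - r a) + \<kappa> a b * (1 - c b)" for a b
    proof -
      have "0 \<le> (1 - r a) * (1 - c b)" using r c by simp
      then have "1 - r a * c b \<le> (1 - r a) + (1 - c b)" by (simp add: algebra_simps)
      then have "\<kappa> a b * (1 - r a * c b) \<le> \<kappa> a b * ((1 - r a) + (1 - c b))"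
        using \<kappa> by (rule mult_left_mono)
      then show ?thesis by (simp add: s_def algebra_simps)
    qed
    have "t = (\<Sum>a\<in>A. \<Sum>b\<in>A. \<kappa> a b - s a b)" using total by (simp add: t_def sum_subtractf)
    also have "\<dots> \<le> (\<Sum>a\<in>A. \<Sum>b\<in>A. \<kappa> a b * (1 - r a) + \<kappa> a b * (1 - c b))"
      using le by (intro sum_mono)
    also have "\<dots> = (\<Sum>a\<in>A. k1 a * (1 - r a)) + (\<Sum>b\<in>A. k2 b * (1 - c b))"
      unfolding sum.distrib k1_def k2_def sum_distrib_right
      by (intro arg_cong2[where f=plus] refl sum.swap)
    also have "\<dots> \<le> (\<Sum>a\<in>A. \<eta>) + (\<Sum>b\<in>A. \<eta>)"
      using rdef cdef by (intro add_mono sum_mono) auto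
    finally have t_le: "t \<le> 2 * card A * \<eta>" by (simp add: mult.commute)
    have finP: "finite P" using P A finite_subset by blast
    have "(\<Sum>(a, b)\<in>P. \<mu> a * \<nu> b * w a b) = (\<Sum>(a, b)\<in>P. k a b)"
      using P by (intro sum.cong) (auto simp: wk)
    also have "\<dots> \<le> (\<Sum>(a, b)\<in>P. \<kappa> a b + d a * e b / t)"
    proof (rule sum_mono)
      fix p assume "p \<in> P"
      have "s a b \<le> \<kappa> a b" for a b
        using mult_le_one[of "r a" "c b"] r c \<kappa>[of a b] mult_left_le[of "r a * c b" "\<kappa> a b"]
        by (simp add: s_def mult.assoc)
      then show "(case p of (a, b) \<Rightarrow> k a b) \<le> (case p of (a, b) \<Rightarrow> \<kappa> a b + d a * e b / t)"
        by (auto simp: k_def split: prod.split)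
    qed
    also have "\<dots> = (\<Sum>(a, b)\<in>P. \<kappa> a b) + (\<Sum>(a, b)\<in>P. d a * e b / t)"
      by (simp add: sum.distrib case_prod_beta)
    also have "(\<Sum>(a, b)\<in>P. d a * e b / t) \<le> (\<Sum>(a, b)\<in>A \<times> A. d a * e b / t)"
      using P A d e t by (intro sum_mono2) auto
    also have "(\<Sum>(a, b)\<in>A \<times> A. d a * e b / t) = sum d A * sum e A / t"
      unfolding sum_product sum_divide_distrib sum.cartesian_product by (simp add: case_prod_beta)
    also have "\<dots> = t" using sd se by simp
    finally show ?thesis using t_le by simp
  qed
  have "0 \<le> w a b" for a b using k0 \<mu>(1) \<nu>(1) by (simp add: w_def)
  then show ?thesis
    using w1 w2 bound unfolding close_coupling_def k1_def k2_def by (intro exI[of _ w]) blast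
qed

section \<open>Ultraproducts of probability spaces\<close>

lemma ultrafilter_not_eventually:
  assumes "ultrafilter U"
  shows "\<not> eventually P U \<longleftrightarrow> eventually (\<lambda>i. \<not> P i) U"
proof -
  have "U \<noteq> bot" using assms by (simp add: ultrafilter_def)
  have "False" if "eventually P U" "eventually (\<lambda>i. \<not> P i) U"
  proof -
    have "eventually (\<lambda>i. False) U" using eventually_conj[OF that] by simp
    then show False using \<open>U \<noteq> bot\<close> by (simp add: trivial_limit_def)
  qed
  then show ?thesis using assms unfolding ultrafilter_def by blast
qed

lemma ultrafilter_eventually_disj:
  assumes "ultrafilter U"
  shows "eventually (\<lambda>i. P i \<or> Q i) U \<longleftrightarrow> eventually P U \<or> eventually Q U"
proof -
  have "eventually (\<lambda>i. \<not> (P i \<or> Q i)) U \<longleftrightarrow> eventually (\<lambda>i. \<not> P i) U \<and> eventually (\<lambda>i. \<not> Q i) U"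
    by (simp add: eventually_conj_iff)
  then show ?thesis
    unfolding ultrafilter_not_eventually[OF assms, symmetric] by blast
qed

lemma ultrafilter_eventually_bex:
  assumes "ultrafilter U" "finite K"
  shows "eventually (\<lambda>i. \<exists>k\<in>K. P k i) U \<longleftrightarrow> (\<exists>k\<in>K. eventually (P k) U)"
  using assms(2)
proof (induction K rule: finite_induct)
  case empty
  have "U \<noteq> bot" using assms(1) by (simp add: ultrafilter_def)
  then show ?case by (simp add: trivial_limit_def)
next
  case (insert k K)
  then show ?case by (simp add: ultrafilter_eventually_disj[OF assms(1)])
qed

text \<open>Compactness provides a cluster point of the image filter; for an ultrafilter every
  cluster point is a limit.\<close>

lemma ultrafilter_compact_limit:
  fixes f :: "'i \<Rightarrow> 'a :: topological_space"
  assumes U: "ultrafilter U" and S: "compact S" "\<And>i. f i \<in> S"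
  shows "\<exists>l\<in>S. (f \<longlongrightarrow> l) U"
proof (rule ccontr)
  assume none: "\<not> ?thesis"
  have "U \<noteq> bot" using U by (simp add: ultrafilter_def)
  then have "filtermap f U \<noteq> bot" by (simp add: filtermap_bot_iff)
  moreover have "eventually (\<lambda>x. x \<in> S) (filtermap f U)" by (simp add: eventually_filtermap S(2))
  ultimately obtain x where x: "x \<in> S" "inf (nhds x) (filtermap f U) \<noteq> bot"
    using S(1) unfolding compact_filter by blast
  from none x have "\<not> (f \<longlongrightarrow> x) U" by blast
  then obtain O' where O': "open O'" "x \<in> O'" "\<not> eventually (\<lambda>i. f i \<in> O') U"
    unfolding tendsto_def by blast
  have "eventually (\<lambda>y. y \<in> O') (nhds x)" using O' by (intro eventually_nhds_in_open)
  moreover have "eventually (\<lambda>y. y \<notin> O') (filtermap f U)"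
    using O'(3) ultrafilter_not_eventually[OF U, of "\<lambda>i. f i \<in> O'"] by (simp add: eventually_filtermap)
  ultimately have "eventually (\<lambda>y. False) (inf (nhds x) (filtermap f U))"
    unfolding eventually_inf by blast
  then show False using x by (simp add: trivial_limit_def)
qed

section \<open>Internal sets and the Loeb measure\<close>

definition ultra_point :: "'i filter \<Rightarrow> ('i \<Rightarrow> 'x set) \<Rightarrow> ('i \<Rightarrow> 'x) \<Rightarrow> ('i \<Rightarrow> 'x) set"
  where "ultra_point U E x = ultra_rel U E `` {x}"

lemma equiv_ultra_rel: "equiv (Pi UNIV E) (ultra_rel U E)"
proof (rule equivI)
  show "refl_on (Pi UNIV E) (ultra_rel U E)" by (auto simp: refl_on_def ultra_rel_def)
  show "ultra_rel U E \<subseteq> Pi UNIV E \<times> Pi UNIV E" by (auto simp: ultra_rel_def)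
  show "sym (ultra_rel U E)" by (auto simp: sym_def ultra_rel_def eq_commute)
  show "trans (ultra_rel U E)"
    unfolding trans_def ultra_rel_def by (auto elim: eventually_elim2)
qed

lemma ultra_point_in: "x \<in> Pi UNIV E \<Longrightarrow> ultra_point U E x \<in> ultra_set U E"
  unfolding ultra_point_def ultra_set_def by (rule quotientI)

lemma ultra_setE:
  assumes "c \<in> ultra_set U E"
  obtains x where "x \<in> Pi UNIV E" "c = ultra_point U E x"
  using assms unfolding ultra_set_def ultra_point_def by (elim quotientE) blast

lemma mem_ultra_point: "y \<in> ultra_point U E x \<longleftrightarrow> x \<in> Pi UNIV E \<and> y \<in> Pi UNIV E \<and> eventually (\<lambda>i. x i = y i) U"
  by (simp add: ultra_point_def ultra_rel_def)

lemma ultra_point_eq_iff: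
  assumes "x \<in> Pi UNIV E" "y \<in> Pi UNIV E"
  shows "ultra_point U E x = ultra_point U E y \<longleftrightarrow> eventually (\<lambda>i. x i = y i) U"
  unfolding ultra_point_def using eq_equiv_class_iff[OF equiv_ultra_rel assms]
  by (simp add: ultra_rel_def assms)

lemma internal_set_subset: "internal_set U E A \<subseteq> ultra_set U E"
  by (auto simp: internal_set_def)

lemma ultra_point_internal:
  assumes "x \<in> Pi UNIV E"
  shows "ultra_point U E x \<in> internal_set U E A \<longleftrightarrow> eventually (\<lambda>i. x i \<in> A i) U"
proof
  assume "ultra_point U E x \<in> internal_set U E A"
  then obtain y where "y \<in> ultra_point U E x" "eventually (\<lambda>i. y i \<in> A i) U"
    by (auto simp: internal_set_def)
  then have "eventually (\<lambda>i. x i = y i) U" "eventually (\<lambda>i. y i \<in> A i) U" by (auto simp: mem_ultra_point)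
  then show "eventually (\<lambda>i. x i \<in> A i) U" by eventually_elim simp
next
  assume "eventually (\<lambda>i. x i \<in> A i) U"
  then show "ultra_point U E x \<in> internal_set U E A"
    using assms ultra_point_in[OF assms, of U]
    by (auto simp: internal_set_def mem_ultra_point intro!: bexI[of _ x])
qed

text \<open>The membership test on representatives reduces identities between sets to the
  ultrafilter calculus of their coordinates.\<close>

lemma internal_setI:
  assumes S: "S \<subseteq> ultra_set U E"
    and "\<And>x. x \<in> Pi UNIV E \<Longrightarrow> ultra_point U E x \<in> S \<longleftrightarrow> eventually (\<lambda>i. x i \<in> A i) U"
  shows "S = internal_set U E A"
proof (rule Set.set_eqI)
  fix c
  show "c \<in> S \<longleftrightarrow> c \<in> internal_set U E A"
  proof (cases "c \<in> ultra_set U E")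
    case True
    then obtain x where "x \<in> Pi UNIV E" "c = ultra_point U E x" by (rule ultra_setE)
    then show ?thesis using assms(2) by (simp add: ultra_point_internal)
  next
    case False
    then show ?thesis using S internal_set_subset by blast
  qed
qed

locale ultra_prob =
  fixes U :: "'i filter" and X :: "'i \<Rightarrow> 'x measure"
  assumes ultra: "ultrafilter U" and prob: "\<And>i. prob_space (X i)"
begin

abbreviation "E \<equiv> \<lambda>i. space (X i)"
abbreviation "\<Omega> \<equiv> ultra_set U E"
abbreviation "pt \<equiv> ultra_point U E"
abbreviation "intl \<equiv> internal_set U E"
abbreviation "UX \<equiv> ultraproduct U X"
abbreviation "IS \<equiv> Pi UNIV (\<lambda>i. sets (X i))"

lemma U_ne: "U \<noteq> bot" using ultra by (simp add: ultrafilter_def)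

lemma E_ne: "E i \<noteq> {}" using prob by (rule prob_space.not_empty)

lemma intl_Un: "intl A \<union> intl B = intl (\<lambda>i. A i \<union> B i)"
  by (rule internal_setI)
    (use internal_set_subset[of U E A] internal_set_subset[of U E B] in
      \<open>auto simp: ultra_point_internal ultrafilter_eventually_disj[OF ultra]\<close>)

lemma intl_Diff: "intl A - intl B = intl (\<lambda>i. A i - B i)"
proof (rule internal_setI)
  fix x assume x: "x \<in> Pi UNIV E"
  show "pt x \<in> intl A - intl B \<longleftrightarrow> eventually (\<lambda>i. x i \<in> A i - B i) U"
    using x by (simp add: ultra_point_internal eventually_conj_iff ultrafilter_not_eventually[OF ultra])
qed (use internal_set_subset in auto)

lemma intl_space: "intl E = \<Omega>"
proof (rule internal_setI[symmetric])
  fix x assume x: "x \<in> Pi UNIV E"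
  then have "eventually (\<lambda>i. x i \<in> E i) U" by (intro always_eventually) auto
  then show "pt x \<in> \<Omega> \<longleftrightarrow> eventually (\<lambda>i. x i \<in> E i) U" using ultra_point_in[OF x] by simp
qed simp

text \<open>If \<open>A i\<close> is nonempty for almost every \<open>i\<close>, choosing a point in
  each gives a point of \<open>intl A\<close>. The comparison of internal sets with their
  coordinates rests on this.\<close>

lemma intl_empty_iff:
  assumes A: "A \<in> IS"
  shows "intl A = {} \<longleftrightarrow> eventually (\<lambda>i. A i = {}) U"
proof
  assume e: "intl A = {}"
  show "eventually (\<lambda>i. A i = {}) U"
  proof (rule ccontr)
    assume "\<not> ?thesis"
    then have ev: "eventually (\<lambda>i. A i \<noteq> {}) U" by (simp add: ultrafilter_not_eventually[OF ultra])
    define x where "x i = (SOME y. y \<in> (if A i \<noteq> {} then A i else E i))" for i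
    have x: "x i \<in> (if A i \<noteq> {} then A i else E i)" for i
      unfolding x_def by (rule someI_ex) (use E_ne in auto)
    have "A i \<subseteq> E i" for i using A by (auto dest: sets.sets_into_space)
    then have "x i \<in> E i" for i using x[of i] by (auto split: if_splits)
    then have "x \<in> Pi UNIV E" by auto
    moreover have "eventually (\<lambda>i. x i \<in> A i) U" using ev by eventually_elim (use x in metis)
    ultimately have "pt x \<in> intl A" by (simp add: ultra_point_internal)
    then show False using e by simp
  qed
next
  assume e: "eventually (\<lambda>i. A i = {}) U"
  show "intl A = {}"
  proof (rule ccontr)
    assume "intl A \<noteq> {}"
    then obtain c where c: "c \<in> intl A" by auto
    then have "c \<in> \<Omega>" using internal_set_subset by auto
    then obtain x where "x \<in> Pi UNIV E" "c = pt x" by (rule ultra_setE)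
    then have "eventually (\<lambda>i. x i \<in> A i) U" using c by (simp add: ultra_point_internal)
    with e have "eventually (\<lambda>i. False) U" by eventually_elim auto
    then show False using U_ne by (simp add: trivial_limit_def)
  qed
qed

lemma intl_mono_iff:
  assumes "A \<in> IS" "B \<in> IS"
  shows "intl A \<subseteq> intl B \<longleftrightarrow> eventually (\<lambda>i. A i \<subseteq> B i) U"
proof -
  have "intl A \<subseteq> intl B \<longleftrightarrow> intl (\<lambda>i. A i - B i) = {}" by (simp add: intl_Diff[symmetric])
  also have "\<dots> \<longleftrightarrow> eventually (\<lambda>i. A i - B i = {}) U"
    by (rule intl_empty_iff) (use assms in auto)
  finally show ?thesis by simp
qed

text \<open>Saturation for an arbitrary, possibly countably complete, ultrafilter: where all the sets
  \<open>A n i\<close> have measure above \<open>c\<close>, continuity of the \<open>i\<close>-th measure replaces the choice of the last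
  such \<open>n\<close>.\<close>

lemma intl_saturated:
  assumes A: "\<And>n::nat. A n \<in> IS" and dec: "\<And>n i. A (Suc n) i \<subseteq> A n i"
    and c: "0 < c" "\<And>n. eventually (\<lambda>i. c < emeasure (X i) (A n i)) U"
  shows "(\<Inter>n. intl (A n)) \<noteq> {}"
proof -
  let ?P = "\<lambda>n i. c < emeasure (X i) (A n i)"
  have dec': "m \<le> n \<Longrightarrow> A n i \<subseteq> A m i" for m n i
    by (rule lift_Suc_antimono_le[of "\<lambda>n. A n i"]) (use dec in auto)
  have sub: "A n i \<subseteq> E i" for n i using A[of n] by (auto dest: sets.sets_into_space)
  have "\<exists>y\<in>E i. \<forall>n. ?P n i \<longrightarrow> y \<in> A n i" for i
  proof -
    interpret prob_space "X i" by (rule prob)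
    show ?thesis
    proof (cases "\<forall>n. ?P n i")
      case True
      have "c \<le> (INF n. emeasure (X i) (A n i))" using True by (intro INF_greatest) (auto intro: less_imp_le)
      also have "\<dots> = emeasure (X i) (\<Inter>n. A n i)"
        by (rule INF_emeasure_decseq) (use A dec in \<open>auto simp: decseq_Suc_iff\<close>)
      finally have "emeasure (X i) (\<Inter>n. A n i) \<noteq> 0" using c(1) by auto
      then have "(\<Inter>n. A n i) \<noteq> {}" by (metis emeasure_empty)
      then obtain y where y: "\<And>n. y \<in> A n i" by auto
      then have "y \<in> E i" using sub[of 0 i] by auto
      then show ?thesis using y by auto
    next
      case False
      define N where "N = (LEAST n. \<not> ?P n i)"
      have N: "\<not> ?P N i" unfolding N_def using False by (metis (mono_tags) LeastI)
      have lt: "n < N" if "?P n i" for n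
      proof (rule ccontr)
        assume "\<not> n < N"
        then have "emeasure (X i) (A n i) \<le> emeasure (X i) (A N i)"
          using A dec' by (intro emeasure_mono) auto
        then show False using that N by auto
      qed
      show ?thesis
      proof (cases "N = 0")
        case True
        then have "\<not> ?P n i" for n using lt by auto
        then show ?thesis using E_ne[of i] by blast
      next
        case False
        then have "?P (N - 1) i" unfolding N_def by (metis diff_Suc_1 not_less_Least lessI not0_implies_Suc)
        then have "A (N - 1) i \<noteq> {}" by auto
        then obtain y where y: "y \<in> A (N - 1) i" by blast
        have "y \<in> A n i" if "?P n i" for n
          using dec'[of n "N - 1" i] lt[OF that] y by (simp add: subset_eq)
        then show ?thesis using y sub by blast
      qed
    qed
  qed
  then obtain x where x: "\<And>i. x i \<in> E i" "\<And>i n. ?P n i \<Longrightarrow> x i \<in> A n i" by metis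
  have "pt x \<in> intl (A n)" for n
  proof -
    have "eventually (\<lambda>i. x i \<in> A n i) U" using c(2)[of n] by eventually_elim (rule x(2))
    then show ?thesis using x(1) by (simp add: ultra_point_internal)
  qed
  then show ?thesis by blast
qed

definition lim_measure :: "('i \<Rightarrow> 'x set) \<Rightarrow> real"
  where "lim_measure A = Lim U (\<lambda>i. measure (X i) (A i))"

lemma tendsto_lim_measure: "((\<lambda>i. measure (X i) (A i)) \<longlongrightarrow> lim_measure A) U"
proof -
  have "\<exists>l\<in>{0..1}. ((\<lambda>i. measure (X i) (A i)) \<longlongrightarrow> l) U"
    by (rule ultrafilter_compact_limit[OF ultra]) (auto simp: prob_space.prob_le_1[OF prob])
  then show ?thesis unfolding lim_measure_def using tendsto_Lim[OF U_ne] by blast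
qed

lemma lim_measure_eqI: "((\<lambda>i. measure (X i) (A i)) \<longlongrightarrow> l) U \<Longrightarrow> lim_measure A = l"
  using tendsto_unique[OF U_ne tendsto_lim_measure] by blast

lemma lim_measure_nonneg: "0 \<le> lim_measure A"
  by (rule tendsto_lowerbound[OF tendsto_lim_measure _ U_ne]) simp

lemma Lim_emeasure: "Lim U (\<lambda>i. emeasure (X i) (A i)) = ennreal (lim_measure A)"
proof (rule tendsto_Lim[OF U_ne])
  have "((\<lambda>i. ennreal (measure (X i) (A i))) \<longlongrightarrow> ennreal (lim_measure A)) U"
    using tendsto_lim_measure by (rule tendsto_ennrealI)
  then show "((\<lambda>i. emeasure (X i) (A i)) \<longlongrightarrow> ennreal (lim_measure A)) U"
    by (simp add: finite_measure.emeasure_eq_measure[OF prob_space.finite_measure[OF prob]])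
qed

lemma lim_measure_add:
  assumes "A \<in> IS" "B \<in> IS" "eventually (\<lambda>i. A i \<inter> B i = {}) U"
  shows "lim_measure (\<lambda>i. A i \<union> B i) = lim_measure A + lim_measure B"
proof (rule lim_measure_eqI)
  have "((\<lambda>i. measure (X i) (A i) + measure (X i) (B i)) \<longlongrightarrow> lim_measure A + lim_measure B) U"
    by (intro tendsto_add tendsto_lim_measure)
  moreover have "eventually (\<lambda>i. measure (X i) (A i) + measure (X i) (B i) = measure (X i) (A i \<union> B i)) U"
    using assms(3)
  proof eventually_elim
    case (elim i)
    interpret prob_space "X i" by (rule prob)
    have "A i \<in> events" "B i \<in> events" using assms by auto
    then show ?case using finite_measure_Union[of "A i" "B i"] elim by auto
  qed
  ultimately show "((\<lambda>i. measure (X i) (A i \<union> B i)) \<longlongrightarrow> lim_measure A + lim_measure B) U"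
    by (rule tendsto_cong[THEN iffD1, rotated])
qed

lemma lim_measure_cong:
  assumes "eventually (\<lambda>i. A i = B i) U"
  shows "lim_measure A = lim_measure B"
proof (rule lim_measure_eqI)
  have "eventually (\<lambda>i. measure (X i) (B i) = measure (X i) (A i)) U"
    using assms by eventually_elim simp
  then show "((\<lambda>i. measure (X i) (A i)) \<longlongrightarrow> lim_measure B) U"
    using tendsto_lim_measure by (rule tendsto_cong[THEN iffD1])
qed

lemma algebra_internal: "algebra \<Omega> (intl ` IS)"
  unfolding algebra_iff_Un
proof (intro conjI ballI)
  show "intl ` IS \<subseteq> Pow \<Omega>" using internal_set_subset by blast
  have "intl (\<lambda>_. {}) = {}" using intl_empty_iff[of "\<lambda>_. {}"] by simp
  then show "{} \<in> intl ` IS" by (intro image_eqI[where x="\<lambda>_. {}"]) auto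
  show "\<Omega> - S \<in> intl ` IS" if S: "S \<in> intl ` IS" for S
  proof -
    obtain A where A: "A \<in> IS" "S = intl A" using S by auto
    have "\<Omega> - S = intl (\<lambda>i. E i - A i)" by (simp add: A intl_Diff[symmetric] intl_space)
    then show ?thesis using A by auto
  qed
  show "S \<union> R \<in> intl ` IS" if S: "S \<in> intl ` IS" "R \<in> intl ` IS" for S R
  proof -
    obtain A B where A: "A \<in> IS" "S = intl A" "B \<in> IS" "R = intl B" using S by auto
    then have "S \<union> R = intl (\<lambda>i. A i \<union> B i)" by (simp add: intl_Un)
    moreover have "(\<lambda>i. A i \<union> B i) \<in> IS" using A by (auto simp: Pi_iff)
    ultimately show ?thesis by (auto intro: imageI)
  qed
qed

text \<open>Loeb's argument. The remainders \<open>C n\<close> of \<open>B\<close> decrease; if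
  their limit measures stayed at or above some \<open>e > 0\<close>, saturation would give a point
  of \<open>intl B\<close> outside all \<open>intl (A n)\<close>, against the covering.\<close>

lemma lim_measure_countably_additive:
  assumes A: "\<And>n::nat. A n \<in> IS" and B: "B \<in> IS" and disj: "disjoint_family (\<lambda>n. intl (A n))"
    and UN: "(\<Union>n. intl (A n)) = intl B"
  shows "(\<lambda>n. lim_measure (A n)) sums lim_measure B"
proof -
  define C where "C n i = B i - (\<Union>k<n. A k i)" for n i
  have A': "A n i \<in> sets (X i)" for n i using A[of n] by auto
  have C: "C n \<in> IS" for n using A' B by (auto simp: C_def Pi_iff)
  have C_Suc: "C (Suc n) i = C n i - A n i" for n i by (auto simp: C_def lessThan_Suc)
  have intl_C: "intl (C n) = intl B - (\<Union>k<n. intl (A k))" for n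
  proof (induction n)
    case 0
    then show ?case by (simp add: C_def)
  next
    case (Suc n)
    have "intl (C (Suc n)) = intl (C n) - intl (A n)" unfolding intl_Diff by (simp add: C_Suc[abs_def])
    then show ?case using Suc by (auto simp: lessThan_Suc)
  qed
  have step: "lim_measure (C n) = lim_measure (A n) + lim_measure (C (Suc n))" for n
  proof -
    have "intl (A k) \<inter> intl (A n) = {}" if "k < n" for k
      using disj that by (simp add: disjoint_family_on_def)
    then have "(\<Union>k<n. intl (A k)) \<inter> intl (A n) = {}" by auto
    moreover have "intl (A n) \<subseteq> intl B" using UN by (metis UNIV_I UN_upper)
    ultimately have "intl (A n) \<subseteq> intl (C n)" unfolding intl_C by auto
    then have sub: "eventually (\<lambda>i. A n i \<subseteq> C n i) U" using A C by (simp add: intl_mono_iff)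
    have "lim_measure (C n) = lim_measure (\<lambda>i. A n i \<union> C (Suc n) i)"
      by (rule lim_measure_cong) (use sub in eventually_elim, auto simp: C_Suc)
    also have "\<dots> = lim_measure (A n) + lim_measure (C (Suc n))"
      by (rule lim_measure_add) (use A C in \<open>auto simp: C_Suc Pi_iff\<close>)
    finally show ?thesis .
  qed
  have partial: "(\<Sum>k<n. lim_measure (A k)) = lim_measure B - lim_measure (C n)" for n
  proof (induction n)
    case 0
    then show ?case by (simp add: C_def)
  next
    case (Suc n)
    then show ?case using step[of n] by simp
  qed
  have dec: "decseq (\<lambda>n. lim_measure (C n))"
    unfolding decseq_Suc_iff using step lim_measure_nonneg by (metis add_increasing order_refl)
  have "(\<lambda>n. lim_measure (C n)) \<longlonglongrightarrow> 0"
  proof (rule LIMSEQ_I)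
    fix e :: real assume e: "0 < e"
    have "\<exists>n. lim_measure (C n) < e"
    proof (rule ccontr)
      assume "\<not> ?thesis"
      then have "e \<le> lim_measure (C n)" for n by (simp add: not_less)
      \<comment> \<open>Passing to half of \<open>e\<close> turns a bound on the limit into a strict
        bound that holds for almost every \<open>i\<close>.\<close>
      then have big: "e / 2 < lim_measure (C n)" for n
      proof -
        have "e / 2 < e" using e by simp
        also have "e \<le> lim_measure (C n)" by fact
        finally show ?thesis .
      qed
      have "(\<Inter>n. intl (C n)) \<noteq> {}"
      proof (rule intl_saturated[where c="ennreal (e / 2)"])
        show "C n \<in> IS" for n by (rule C)
        show "C (Suc n) i \<subseteq> C n i" for n i by (auto simp: C_Suc)
        show "0 < ennreal (e / 2)" using e by simp
        fix n
        have "eventually (\<lambda>i. e / 2 < measure (X i) (C n i)) U"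
          using tendsto_lim_measure big by (rule order_tendstoD)
        then show "eventually (\<lambda>i. ennreal (e / 2) < emeasure (X i) (C n i)) U"
          by eventually_elim
            (use e in \<open>simp add: finite_measure.emeasure_eq_measure[OF prob_space.finite_measure[OF prob]] ennreal_lessI\<close>)
      qed
      then show False using UN by (auto simp: intl_C)
    qed
    then obtain n where "lim_measure (C n) < e" by blast
    then have "\<forall>m\<ge>n. norm (lim_measure (C m) - 0) < e"
      using dec lim_measure_nonneg unfolding decseq_def by (metis abs_of_nonneg diff_zero le_less_trans real_norm_def)
    then show "\<exists>n. \<forall>m\<ge>n. norm (lim_measure (C m) - 0) < e" by blast
  qed
  then have "(\<lambda>n. lim_measure B - lim_measure (C n)) \<longlonglongrightarrow> lim_measure B - 0" by (intro tendsto_diff) auto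
  then show ?thesis unfolding sums_def partial by simp
qed

text \<open>Caratheodory extension. The content is well defined because internal sets that coincide
  have equal coordinates for almost every \<open>i\<close>.\<close>

lemma emeasure_ultraproduct:
  assumes "A \<in> IS"
  shows "emeasure UX (intl A) = ennreal (lim_measure A)"
proof -
  interpret algebra \<Omega> "intl ` IS" by (rule algebra_internal)
  have "emeasure UX (intl A) = Lim U (\<lambda>i. emeasure (X i) (A i))"
  proof (rule extend_measure_caratheodory[OF ultraproduct_def assms])
    show "semiring_of_sets \<Omega> (intl ` IS)" ..
    fix A assume A: "A \<in> IS"
    show "0 \<le> Lim U (\<lambda>i. emeasure (X i) (A i))" by simp
    assume "intl A = {}"
    then have "eventually (\<lambda>i. A i = {}) U" using A by (simp add: intl_empty_iff)
    then have "lim_measure A = lim_measure (\<lambda>_. {})" by (rule lim_measure_cong)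
    also have "\<dots> = 0" by (rule lim_measure_eqI) simp
    finally show "Lim U (\<lambda>i. emeasure (X i) (A i)) = 0" by (simp add: Lim_emeasure)
  next
    fix A B assume AB: "A \<in> IS" "B \<in> IS" "intl A = intl B"
    then have "eventually (\<lambda>i. A i \<subseteq> B i) U" "eventually (\<lambda>i. B i \<subseteq> A i) U"
      by (simp_all add: intl_mono_iff[symmetric])
    then have "eventually (\<lambda>i. A i = B i) U" by eventually_elim auto
    then show "Lim U (\<lambda>i. emeasure (X i) (A i)) = Lim U (\<lambda>i. emeasure (X i) (B i))"
      unfolding Lim_emeasure by (simp add: lim_measure_cong)
  next
    fix A :: "nat \<Rightarrow> 'i \<Rightarrow> 'x set" and B
    assume "A \<in> UNIV \<rightarrow> IS" "B \<in> IS" "disjoint_family (intl \<circ> A)" "(\<Union>n. intl (A n)) = intl B"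
    then have "(\<lambda>n. lim_measure (A n)) sums lim_measure B"
      by (intro lim_measure_countably_additive) (auto simp: comp_def)
    then show "(\<Sum>n. Lim U (\<lambda>i. emeasure (X i) (A n i))) = Lim U (\<lambda>i. emeasure (X i) (B i))"
      unfolding Lim_emeasure by (intro suminf_ennreal_eq lim_measure_nonneg)
  qed
  then show ?thesis by (simp add: Lim_emeasure)
qed

lemma space_ultraproduct [simp]: "space UX = \<Omega>"
  unfolding ultraproduct_def using internal_set_subset by (intro space_extend_measure) blast

lemma sets_ultraproduct: "sets UX = sigma_sets \<Omega> (intl ` IS)"
  unfolding ultraproduct_def using internal_set_subset by (intro sets_extend_measure) blast

lemma intl_in_sets: "A \<in> IS \<Longrightarrow> intl A \<in> sets UX"
  unfolding sets_ultraproduct by (intro sigma_sets.Basic imageI)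

lemma prob_space_ultraproduct: "prob_space UX"
proof
  have "E \<in> IS" by auto
  then have "emeasure UX (intl E) = ennreal (lim_measure E)" by (rule emeasure_ultraproduct)
  also have "lim_measure E = 1" by (rule lim_measure_eqI) (simp add: prob_space.prob_space[OF prob])
  finally show "emeasure UX (space UX) = 1" by (simp add: intl_space)
qed

lemma measure_ultraproduct: "A \<in> IS \<Longrightarrow> measure UX (intl A) = lim_measure A"
  unfolding measure_def by (simp add: emeasure_ultraproduct lim_measure_nonneg)

end

section \<open>Approximation by generators, and statistics of actions\<close>

lemma (in prob_space) algebra_approximates:
  assumes \<A>: "algebra (space M) \<A>" and gen: "sets M = sigma_sets (space M) \<A>"
    and S: "S \<in> sets M" and e: "0 < e"
  shows "\<exists>A\<in>\<A>. measure M ((S - A) \<union> (A - S)) < e"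
proof -
  interpret \<A>: algebra "space M" \<A> by fact
  have sub: "A \<in> sets M" if "A \<in> \<A>" for A unfolding gen using that by (rule sigma_sets.Basic)
  have "S \<in> sigma_sets (space M) \<A>" using S gen by simp
  \<comment> \<open>All tolerances are treated at once, since the step for countable unions
    approximates each of finitely many sets within a smaller one.\<close>
  then have "\<forall>e>0. \<exists>A\<in>\<A>. measure M ((S - A) \<union> (A - S)) < e"
  proof (induction S rule: sigma_sets.induct)
    case (Basic A)
    then show ?case by (intro allI impI bexI[of _ A]) auto
  next
    case Empty
    show ?case by (intro allI impI bexI[of _ "{}"]) auto
  next
    case (Compl S)
    have "S \<subseteq> space M" using Compl.hyps gen sets.sets_into_space by blast
    show ?case
    proof (intro allI impI)
      fix e :: real assume "0 < e"
      then obtain A where A: "A \<in> \<A>" "measure M ((S - A) \<union> (A - S)) < e" using Compl.IH by blast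
      have "(space M - S - (space M - A)) \<union> (space M - A - (space M - S)) = (S - A) \<union> (A - S)"
        using \<open>S \<subseteq> space M\<close> \<A>.sets_into_space[OF A(1)] by blast
      then show "\<exists>A\<in>\<A>. measure M ((space M - S - A) \<union> (A - (space M - S))) < e"
        using A by (intro bexI[of _ "space M - A"]) auto
    qed
  next
    case (Union S)
    have S: "S n \<in> sets M" for n using Union.hyps gen by auto
    show ?case
    proof (intro allI impI)
      fix e :: real assume e: "0 < e"
      have "incseq (\<lambda>n. \<Union>k<n. S k)" by (intro monoI UN_mono) auto
      then have "(\<lambda>n. measure M (\<Union>k<n. S k)) \<longlonglongrightarrow> measure M (\<Union>n. \<Union>k<n. S k)"
        using S by (intro finite_Lim_measure_incseq) auto
      moreover have "(\<Union>n. \<Union>k<n. S k) = (\<Union>n. S n)" by auto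
      ultimately have "eventually (\<lambda>n. measure M (\<Union>n. S n) - e / 2 < measure M (\<Union>k<n. S k)) sequentially"
        using e by (intro order_tendstoD(1)) auto
      then obtain n where n: "measure M (\<Union>n. S n) - e / 2 < measure M (\<Union>k<n. S k)"
        unfolding eventually_sequentially by blast
      have "measure M ((\<Union>n. S n) - (\<Union>k<n. S k)) = measure M (\<Union>n. S n) - measure M (\<Union>k<n. S k)"
        using S by (intro finite_measure_Diff) auto
      with n have n: "measure M ((\<Union>n. S n) - (\<Union>k<n. S k)) < e / 2" by simp
      \<comment> \<open>The denominator has \<open>n + 1\<close> in place of \<open>n\<close> so
        that \<open>d\<close> is positive also for the empty union.\<close>
      define d where "d = e / (2 * (real n + 1))"
      have "0 < d" using e by (simp add: d_def)
      then have "\<exists>A\<in>\<A>. measure M ((S k - A) \<union> (A - S k)) < d" for k using Union.IH by blast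
      then obtain A where A: "\<And>k. A k \<in> \<A>" "\<And>k. measure M ((S k - A k) \<union> (A k - S k)) < d" by metis
      let ?D = "\<lambda>k. (S k - A k) \<union> (A k - S k)"
      have AM: "A k \<in> sets M" for k using A sub by blast
      have UA: "(\<Union>k<n. A k) \<in> \<A>" using A by (intro \<A>.finite_UN) auto
      have "measure M (((\<Union>n. S n) - (\<Union>k<n. A k)) \<union> ((\<Union>k<n. A k) - (\<Union>n. S n))) \<le>
          measure M (((\<Union>n. S n) - (\<Union>k<n. S k)) \<union> (\<Union>k<n. ?D k))"
        using S AM by (intro finite_measure_mono) auto
      also have "\<dots> \<le> measure M ((\<Union>n. S n) - (\<Union>k<n. S k)) + measure M (\<Union>k<n. ?D k)"
        using S AM by (intro measure_subadditive) auto
      also have "measure M (\<Union>k<n. ?D k) \<le> (\<Sum>k<n. measure M (?D k))"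
        using S AM by (intro finite_measure_subadditive_finite) auto
      also have "(\<Sum>k<n. measure M (?D k)) \<le> (\<Sum>k<n. d)" using A(2) by (intro sum_mono less_imp_le)
      also have "(\<Sum>k<n. d) \<le> e / 2" using e by (simp add: d_def field_simps)
      finally show "\<exists>A\<in>\<A>. measure M (((\<Union>n. S n) - A) \<union> (A - (\<Union>n. S n))) < e"
        using n UA by (intro bexI[of _ "\<Union>k<n. A k"]) auto
    qed
  qed
  then show ?thesis using e by blast
qed

lemma pmp_actionD:
  assumes "pmp_action G M a"
  shows "prob_space M" "group_action G (space M) a" "group G"
    "\<And>g. g \<in> carrier G \<Longrightarrow> a g \<in> measurable M M"
    "\<And>g. g \<in> carrier G \<Longrightarrow> distr M M (a g) = M"
    "\<And>g x. g \<in> carrier G \<Longrightarrow> x \<in> space M \<Longrightarrow> a g x \<in> space M"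
    "\<And>x. x \<in> space M \<Longrightarrow> a \<one>\<^bsub>G\<^esub> x = x"
    "\<And>g h x. g \<in> carrier G \<Longrightarrow> h \<in> carrier G \<Longrightarrow> x \<in> space M \<Longrightarrow> a (g \<otimes>\<^bsub>G\<^esub> h) x = a g (a h x)"
proof -
  show ga: "group_action G (space M) a" using assms by (simp add: pmp_action_def)
  then show "group G" by (simp add: group_action_def group_hom_def)
  show "\<And>g x. g \<in> carrier G \<Longrightarrow> x \<in> space M \<Longrightarrow> a g x \<in> space M"
    "\<And>x. x \<in> space M \<Longrightarrow> a \<one>\<^bsub>G\<^esub> x = x"
    "\<And>g h x. g \<in> carrier G \<Longrightarrow> h \<in> carrier G \<Longrightarrow> x \<in> space M \<Longrightarrow> a (g \<otimes>\<^bsub>G\<^esub> h) x = a g (a h x)"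
    using group_action_simps[OF ga] by auto
qed (use assms in \<open>auto simp: pmp_action_def\<close>)

lemma pmp_measure_vimage:
  assumes "pmp_action G M a" "g \<in> carrier G" "S \<in> sets M"
  shows "measure M {x \<in> space M. a g x \<in> S} = measure M S"
proof -
  have "measure M S = measure (distr M M (a g)) S" using pmp_actionD(5)[OF assms(1,2)] by simp
  also have "\<dots> = measure M (a g -` S \<inter> space M)"
    by (rule measure_distr[OF pmp_actionD(4)[OF assms(1,2)] assms(3)])
  also have "a g -` S \<inter> space M = {x \<in> space M. a g x \<in> S}" by auto
  finally show ?thesis ..
qed

lemma pattern_map_eq_iff:
  assumes "\<pi> \<in> S \<rightarrow>\<^sub>E B"
  shows "pattern_map G b S \<alpha> y = \<pi> \<longleftrightarrow> (\<forall>s\<in>S. \<alpha> (b (inv\<^bsub>G\<^esub> s) y) = \<pi> s)"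
  using assms by (auto simp: pattern_map_def fun_eq_iff PiE_iff extensional_def)

lemma pattern_sets:
  assumes M: "pmp_action G M a" and S: "finite S" "S \<subseteq> carrier G"
    and \<alpha>: "\<alpha> \<in> measurable M (count_space {..<p})" and \<beta>: "\<beta> \<in> measurable M (count_space Q)"
    and \<pi>: "\<pi> \<in> S \<rightarrow>\<^sub>E B"
  shows "{x \<in> space M. pattern_map G a S \<alpha> x = \<pi> \<and> \<beta> x = j} \<in> sets M"
proof -
  interpret group G by (rule pmp_actionD(3)[OF M])
  have "{x \<in> space M. \<alpha> (a (inv\<^bsub>G\<^esub> s) x) = \<pi> s} \<in> sets M" if "s \<in> S" for s
    by (rule count_space_vimage_sets[OF measurable_compose[OF pmp_actionD(4)[OF M] \<alpha>]]) (use that S in auto)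
  then have "{x \<in> space M. \<forall>s\<in>S. \<alpha> (a (inv\<^bsub>G\<^esub> s) x) = \<pi> s} \<inter> {x \<in> space M. \<beta> x = j} \<in> sets M"
    using S(1) by (intro sets.Int sets.sets_Collect_finite_All count_space_vimage_sets[OF \<beta>])
  also have "{x \<in> space M. \<forall>s\<in>S. \<alpha> (a (inv\<^bsub>G\<^esub> s) x) = \<pi> s} \<inter> {x \<in> space M. \<beta> x = j} =
      {x \<in> space M. pattern_map G a S \<alpha> x = \<pi> \<and> \<beta> x = j}"
    unfolding pattern_map_eq_iff[OF \<pi>] by blast
  finally show ?thesis .
qed

lemma colour_pair_sets:
  assumes M: "pmp_action G M act" and f: "f \<in> measurable M (count_space C)" and g: "g \<in> carrier G"
  shows "{x \<in> space M. f x = j \<and> f (act g x) = k} \<in> sets M"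
proof -
  have "{x \<in> space M. f x = j} \<inter> {x \<in> space M. f (act g x) = k} \<in> sets M"
    by (intro sets.Int count_space_vimage_sets[OF f]
      count_space_vimage_sets[OF measurable_compose[OF pmp_actionD(4)[OF M g] f]])
  also have "{x \<in> space M. f x = j} \<inter> {x \<in> space M. f (act g x) = k} =
      {x \<in> space M. f x = j \<and> f (act g x) = k}" by auto
  finally show ?thesis .
qed

section \<open>Internal colourings of the ultraproduct\<close>

definition ultra_fun :: "'i filter \<Rightarrow> ('i \<Rightarrow> 'x \<Rightarrow> nat) \<Rightarrow> ('i \<Rightarrow> 'x) set \<Rightarrow> nat"
  where "ultra_fun U f c = (THE j. \<exists>x\<in>c. eventually (\<lambda>i. f i (x i) = j) U)"

context ultra_prob
begin

text \<open>Among finitely many colours the ultrafilter selects exactly one, the same for all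
  representatives; this makes the definite description meaningful.\<close>

lemma ultra_fun_eq_iff:
  fixes p :: nat
  assumes f: "\<And>i x. x \<in> E i \<Longrightarrow> f i x < p" and x: "x \<in> Pi UNIV E"
  shows "ultra_fun U f (pt x) = j \<longleftrightarrow> eventually (\<lambda>i. f i (x i) = j) U"
proof -
  have "eventually (\<lambda>i. \<exists>k\<in>{..<p}. f i (x i) = k) U"
    using f x by (intro always_eventually) auto
  then obtain k where k: "eventually (\<lambda>i. f i (x i) = k) U"
    unfolding ultrafilter_eventually_bex[OF ultra finite_lessThan] by auto
  have unique: "j' = k" if y: "y \<in> pt x" "eventually (\<lambda>i. f i (y i) = j') U" for y j'
  proof -
    have "eventually (\<lambda>i. x i = y i) U" using y(1) by (simp add: mem_ultra_point)
    with y(2) k have "eventually (\<lambda>i. j' = k) U" by eventually_elim auto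
    then show ?thesis using U_ne eventually_happens[of "\<lambda>_. j' = k" U] by blast
  qed
  have "ultra_fun U f (pt x) = k"
    unfolding ultra_fun_def
  proof (rule the_equality)
    show "\<exists>y\<in>pt x. eventually (\<lambda>i. f i (y i) = k) U"
      using k x by (intro bexI[of _ x]) (auto simp: mem_ultra_point)
  qed (use unique in blast)
  moreover have "eventually (\<lambda>i. f i (x i) = j) U \<Longrightarrow> j = k"
    using unique[of x j] x by (simp add: mem_ultra_point)
  ultimately show ?thesis using k by auto
qed

lemma count_space_less:
  assumes "\<And>i. f i \<in> measurable (X i) (count_space {..<p})" "x \<in> E i"
  shows "f i x < (p::nat)"
  using measurable_space[OF assms(1) assms(2)] by simp

lemma ultra_fun_point:
  assumes f: "\<And>i. f i \<in> measurable (X i) (count_space {..<p})" and x: "x \<in> Pi UNIV E"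
  shows "ultra_fun U f (pt x) = j \<longleftrightarrow> eventually (\<lambda>i. f i (x i) = j) U"
  using count_space_less[OF f] x by (rule ultra_fun_eq_iff)

lemma ultra_fun_level:
  assumes f: "\<And>i. f i \<in> measurable (X i) (count_space {..<p})"
  shows "{c \<in> \<Omega>. ultra_fun U f c = j} = intl (\<lambda>i. {x \<in> E i. f i x = j})"
proof (rule internal_setI)
  fix x assume x: "x \<in> Pi UNIV E"
  have 1: "eventually (\<lambda>i. x i \<in> E i) U" using x by (intro always_eventually) auto
  have "pt x \<in> {c \<in> \<Omega>. ultra_fun U f c = j} \<longleftrightarrow> eventually (\<lambda>i. f i (x i) = j) U"
    using ultra_point_in[OF x] ultra_fun_point[OF f x] by simp
  also have "\<dots> \<longleftrightarrow> eventually (\<lambda>i. x i \<in> {x \<in> E i. f i x = j}) U"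
    using 1 by (simp add: eventually_conj_iff)
  finally show "pt x \<in> {c \<in> \<Omega>. ultra_fun U f c = j} \<longleftrightarrow> eventually (\<lambda>i. x i \<in> {x \<in> E i. f i x = j}) U" .
qed blast

lemma ultra_fun_measurable:
  assumes f: "\<And>i. f i \<in> measurable (X i) (count_space {..<p})"
  shows "ultra_fun U f \<in> measurable UX (count_space {..<p})"
proof (rule measurable_count_space_eq2[THEN iffD2], simp, intro conjI ballI)
  have less: "f i x < p" if "x \<in> E i" for i x using f that by (rule count_space_less)
  show "ultra_fun U f \<in> space UX \<rightarrow> {..<p}"
  proof
    fix c assume "c \<in> space UX"
    then obtain x where x: "x \<in> Pi UNIV E" "c = pt x" by (auto elim: ultra_setE)
    define j where "j = ultra_fun U f c"
    have "eventually (\<lambda>i. f i (x i) = j) U"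
      using ultra_fun_point[OF f x(1), of j] by (simp add: j_def x(2))
    then obtain i where "f i (x i) = j" using U_ne eventually_happens by blast
    then show "ultra_fun U f c \<in> {..<p}" using less[of "x i" i] x(1) by (auto simp: j_def Pi_iff)
  qed
  fix j assume "j \<in> {..<p}"
  have "(\<lambda>i. {x \<in> E i. f i x = j}) \<in> IS"
    using count_space_vimage_sets[OF f] by auto
  then have "{c \<in> \<Omega>. ultra_fun U f c = j} \<in> sets UX" unfolding ultra_fun_level[OF f] by (rule intl_in_sets)
  then show "ultra_fun U f -` {j} \<inter> space UX \<in> sets UX" by (simp add: vimage_def Int_def conj_commute)
qed

text \<open>Each level set is approximated by an internal set within \<open>e / r\<close>. These
  internal sets need not form a partition; taking the least index whose set contains the point
  repairs this, and outside the union of the symmetric differences the resulting colour is the given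
  one.\<close>

lemma ultra_fun_approximates:
  assumes \<gamma>: "\<gamma> \<in> measurable UX (count_space {..<r})" and e: "0 < e"
  shows "\<exists>f. (\<forall>i. f i \<in> measurable (X i) (count_space {..<r})) \<and>
    measure UX {c \<in> \<Omega>. ultra_fun U f c \<noteq> \<gamma> c} < e"
proof -
  interpret UX: prob_space UX by (rule prob_space_ultraproduct)
  obtain c0 where "c0 \<in> \<Omega>" using UX.not_empty by auto
  then have r: "0 < r" using measurable_space[OF \<gamma>, of c0] by auto
  have lev: "{c \<in> \<Omega>. \<gamma> c = j} \<in> sets UX" for j using count_space_vimage_sets[OF \<gamma>] by simp
  have approx: "\<exists>S\<in>intl ` IS. measure UX (({c \<in> \<Omega>. \<gamma> c = j} - S) \<union> (S - {c \<in> \<Omega>. \<gamma> c = j})) < e / r" for j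
    by (rule UX.algebra_approximates[OF _ _ lev]) (use algebra_internal sets_ultraproduct e r in auto)
  have "\<exists>B\<in>IS. measure UX (({c \<in> \<Omega>. \<gamma> c = j} - intl B) \<union> (intl B - {c \<in> \<Omega>. \<gamma> c = j})) < e / r" for j
    using approx[of j] by (simp only: Set.bex_simps(7))
  then have "\<forall>j. \<exists>B. B \<in> IS \<and> measure UX (({c \<in> \<Omega>. \<gamma> c = j} - intl B) \<union> (intl B - {c \<in> \<Omega>. \<gamma> c = j})) < e / r"
    unfolding Bex_def by blast
  from choice[OF this] obtain B where B: "\<And>j. B j \<in> IS"
    "\<And>j. measure UX (({c \<in> \<Omega>. \<gamma> c = j} - intl (B j)) \<union> (intl (B j) - {c \<in> \<Omega>. \<gamma> c = j})) < e / r"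
    by blast
  have B': "B j i \<in> sets (X i)" for i j using B(1)[of j] by auto
  \<comment> \<open>Points in none of the sets get colour \<open>0\<close>, a legal colour since
    \<open>0 < r\<close>.\<close>
  define f where "f i x = (if \<exists>j<r. x \<in> B j i then (LEAST j. x \<in> B j i) else 0)" for i x
  have f: "f i \<in> measurable (X i) (count_space {..<r})" for i
  proof (rule measurable_count_space_eq2[THEN iffD2], simp, intro conjI ballI)
    show "f i \<in> space (X i) \<rightarrow> {..<r}" using r by (auto simp: f_def intro: le_less_trans[OF Least_le])
    fix j assume "j \<in> {..<r}"
    have "Measurable.pred (X i) (\<lambda>x. x \<in> B j i)" for j using B' by simp
    then have "f i \<in> measurable (X i) (count_space UNIV)" unfolding f_def by measurable
    then show "f i -` {j} \<inter> space (X i) \<in> sets (X i)" by (rule measurable_sets) simp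
  qed
  let ?D = "\<lambda>j. ({c \<in> \<Omega>. \<gamma> c = j} - intl (B j)) \<union> (intl (B j) - {c \<in> \<Omega>. \<gamma> c = j})"
  have D: "?D j \<in> sets UX" for j by (intro sets.Un sets.Diff lev intl_in_sets B(1))
  have sub: "{c \<in> \<Omega>. ultra_fun U f c \<noteq> \<gamma> c} \<subseteq> (\<Union>j<r. ?D j)"
  proof (rule subsetI, rule ccontr)
    fix c assume c: "c \<in> {c \<in> \<Omega>. ultra_fun U f c \<noteq> \<gamma> c}" and nD: "c \<notin> (\<Union>j<r. ?D j)"
    then obtain x where x: "x \<in> Pi UNIV E" "c = pt x" by (auto elim: ultra_setE)
    define k where "k = \<gamma> c"
    have k: "k < r" using measurable_space[OF \<gamma>, of c] c by (auto simp: k_def)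
    have mem: "c \<in> intl (B j) \<longleftrightarrow> j = k" if "j < r" for j
    proof -
      have "c \<notin> ?D j" using nD that by blast
      moreover have "c \<in> \<Omega>" using c by simp
      ultimately show ?thesis unfolding k_def by blast
    qed
    have "pt x \<in> intl (B j) \<longleftrightarrow> j = k" if "j < r" for j
      using mem[OF that] unfolding x(2) .
    then have "eventually (\<lambda>i. x i \<in> B k i) U" "\<And>j. j < k \<Longrightarrow> eventually (\<lambda>i. x i \<notin> B j i) U"
      using k by (simp_all add: ultra_point_internal[OF x(1)] ultrafilter_not_eventually[OF ultra, symmetric])
    then have "eventually (\<lambda>i. x i \<in> B k i \<and> (\<forall>j\<in>{..<k}. x i \<notin> B j i)) U"
      by (intro eventually_conj eventually_ball_finite) auto
    then have "eventually (\<lambda>i. f i (x i) = k) U"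
    proof eventually_elim
      case (elim i)
      have "(LEAST j. x i \<in> B j i) = k"
        using elim by (intro Least_equality) (auto simp: not_less[symmetric])
      then show ?case using elim k by (auto simp: f_def)
    qed
    then have "ultra_fun U f c = k" using ultra_fun_point[OF f x(1)] x(2) by simp
    then show False using c by (simp add: k_def)
  qed
  have "measure UX {c \<in> \<Omega>. ultra_fun U f c \<noteq> \<gamma> c} \<le> measure UX (\<Union>j<r. ?D j)"
    using D by (intro UX.finite_measure_mono sub) auto
  also have "\<dots> \<le> (\<Sum>j<r. measure UX (?D j))"
    using D by (intro UX.finite_measure_subadditive_finite) auto
  also have "\<dots> < (\<Sum>j<r. e / r)" using B(2) r by (intro sum_strict_mono) auto
  also have "\<dots> = e" using r by simp
  finally show ?thesis using f by blast
qed

end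

section \<open>The diagonal action on the ultraproduct\<close>

locale ultra_pmp = ultra_prob U X
  for U :: "'i filter" and X :: "'i \<Rightarrow> 'x measure" +
  fixes G :: "('g, 'b) monoid_scheme" and a :: "'i \<Rightarrow> 'g \<Rightarrow> 'x \<Rightarrow> 'x"
  assumes pmp: "\<And>i. pmp_action G (X i) (a i)"
begin

abbreviation "ua \<equiv> ultra_action U X a"

lemma action_closed: "g \<in> carrier G \<Longrightarrow> x \<in> Pi UNIV E \<Longrightarrow> (\<lambda>i. a i g (x i)) \<in> Pi UNIV E"
  using pmp_actionD(6)[OF pmp] by auto

lemma ultra_action_point:
  assumes g: "g \<in> carrier G" and x: "x \<in> Pi UNIV E"
  shows "ua g (pt x) = pt (\<lambda>i. a i g (x i))"
proof -
  have "ultra_rel U E `` {\<lambda>i. a i g (y i)} = pt (\<lambda>i. a i g (x i))" if "y \<in> pt x" for y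
  proof -
    have y: "y \<in> Pi UNIV E" and "eventually (\<lambda>i. x i = y i) U" using that by (auto simp: mem_ultra_point)
    then have "eventually (\<lambda>i. a i g (y i) = a i g (x i)) U" by (auto elim: eventually_mono)
    then have "pt (\<lambda>i. a i g (y i)) = pt (\<lambda>i. a i g (x i))"
      using action_closed[OF g] x y by (subst ultra_point_eq_iff) auto
    then show ?thesis by (simp add: ultra_point_def)
  qed
  moreover have "x \<in> pt x" using x by (simp add: mem_ultra_point)
  ultimately have "(\<Union>y\<in>pt x. ultra_rel U E `` {\<lambda>i. a i g (y i)}) = pt (\<lambda>i. a i g (x i))" by blast
  then show ?thesis unfolding ultra_action_def using ultra_point_in[OF x] by simp
qed

lemma ultra_action_vimage:
  assumes g: "g \<in> carrier G" and A: "A \<in> IS"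
  shows "{c \<in> \<Omega>. ua g c \<in> intl A} = intl (\<lambda>i. {x \<in> E i. a i g x \<in> A i})"
proof (rule internal_setI)
  fix x assume x: "x \<in> Pi UNIV E"
  have 1: "eventually (\<lambda>i. x i \<in> E i) U" using x by (intro always_eventually) auto
  have "pt x \<in> {c \<in> \<Omega>. ua g c \<in> intl A} \<longleftrightarrow> eventually (\<lambda>i. a i g (x i) \<in> A i) U"
    using ultra_point_in[OF x] ultra_point_internal[OF action_closed[OF g x], of U A]
    by (simp add: ultra_action_point[OF g x])
  then show "pt x \<in> {c \<in> \<Omega>. ua g c \<in> intl A} \<longleftrightarrow> eventually (\<lambda>i. x i \<in> {x \<in> E i. a i g x \<in> A i}) U"
    using 1 by (simp add: eventually_conj_iff)
qed blast

text \<open>Invariance is checked on internal sets, which generate and are stable under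
  intersection; there it holds coordinatewise.\<close>

lemma pmp_ultra_action:
  shows "pmp_action G UX ua"
  unfolding pmp_action_def space_ultraproduct
proof (intro conjI ballI)
  show "prob_space UX" by (rule prob_space_ultraproduct)
  have grp: "group G" by (rule pmp_actionD(3)[OF pmp])
  interpret group G by fact
  show ga: "group_action G \<Omega> ua"
  proof (rule group_actionI[OF grp])
    show "ua g \<in> extensional \<Omega>" for g by (simp add: ultra_action_def)
    fix c assume "c \<in> \<Omega>"
    then obtain x where x: "x \<in> Pi UNIV E" "c = pt x" by (rule ultra_setE)
    show "ua g c \<in> \<Omega>" if "g \<in> carrier G" for g
      unfolding x(2) ultra_action_point[OF that x(1)] by (rule ultra_point_in[OF action_closed[OF that x(1)]])
    have "(\<lambda>i. a i \<one>\<^bsub>G\<^esub> (x i)) = x" using x(1) pmp_actionD(7)[OF pmp] by (auto simp: fun_eq_iff)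
    then show "ua \<one>\<^bsub>G\<^esub> c = c" by (simp add: x(2) ultra_action_point x(1))
    fix g h assume gh: "g \<in> carrier G" "h \<in> carrier G"
    have "(\<lambda>i. a i (g \<otimes>\<^bsub>G\<^esub> h) (x i)) = (\<lambda>i. a i g (a i h (x i)))"
      using x(1) pmp_actionD(8)[OF pmp gh] by (auto simp: fun_eq_iff)
    then show "ua (g \<otimes>\<^bsub>G\<^esub> h) c = ua g (ua h c)"
      using gh action_closed x(1) by (simp add: x(2) ultra_action_point)
  qed
  fix g assume g: "g \<in> carrier G"
  have vim: "(\<lambda>i. {x \<in> E i. a i g x \<in> A i}) \<in> IS" if A: "A \<in> IS" for A
  proof -
    have "a i g -` A i \<inter> E i \<in> sets (X i)" for i
      using A by (intro measurable_sets[OF pmp_actionD(4)[OF pmp g]]) auto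
    then show ?thesis by (simp add: vimage_def Int_def conj_commute)
  qed
  have cl: "ua g \<in> \<Omega> \<rightarrow> \<Omega>" using group_action_simps(1)[OF ga g] by auto
  show meas: "ua g \<in> measurable UX UX"
  proof (rule measurable_sigma_sets[OF sets_ultraproduct])
    show "intl ` IS \<subseteq> Pow \<Omega>" using internal_set_subset by blast
    show "ua g \<in> space UX \<rightarrow> \<Omega>" using cl by simp
    fix S assume "S \<in> intl ` IS"
    then obtain A where A: "A \<in> IS" "S = intl A" by auto
    have "ua g -` S \<inter> space UX = {c \<in> \<Omega>. ua g c \<in> intl A}" by (auto simp: A)
    then show "ua g -` S \<inter> space UX \<in> sets UX"
      unfolding ultra_action_vimage[OF g A(1)] using intl_in_sets[OF vim[OF A(1)]] by simp
  qed
  interpret algebra \<Omega> "intl ` IS" by (rule algebra_internal)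
  interpret D: prob_space "distr UX UX (ua g)" by (rule prob_space.prob_space_distr[OF prob_space_ultraproduct meas])
  show "distr UX UX (ua g) = UX"
  proof (rule measure_eqI_generator_eq[where E="intl ` IS" and \<Omega>=\<Omega> and A="\<lambda>_. \<Omega>"])
    show "Int_stable (intl ` IS)" unfolding Int_stable_def using Int by blast
    show "intl ` IS \<subseteq> Pow \<Omega>" using internal_set_subset by blast
    show "sets (distr UX UX (ua g)) = sigma_sets \<Omega> (intl ` IS)" "sets UX = sigma_sets \<Omega> (intl ` IS)"
      by (simp_all add: sets_ultraproduct)
    show "range (\<lambda>_. \<Omega>) \<subseteq> intl ` IS" using top by auto
    show "(\<Union>i. \<Omega>) = \<Omega>" by simp
    show "emeasure (distr UX UX (ua g)) \<Omega> \<noteq> \<infinity>" for i :: nat by simp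
    fix S assume "S \<in> intl ` IS"
    then obtain A where A: "A \<in> IS" "S = intl A" by auto
    have "emeasure (distr UX UX (ua g)) S = emeasure UX (ua g -` S \<inter> space UX)"
      by (rule emeasure_distr[OF meas]) (simp add: A intl_in_sets)
    also have "ua g -` S \<inter> space UX = intl (\<lambda>i. {x \<in> E i. a i g x \<in> A i})"
      unfolding ultra_action_vimage[OF g A(1), symmetric] by (auto simp: A)
    also have "emeasure UX \<dots> = ennreal (lim_measure (\<lambda>i. {x \<in> E i. a i g x \<in> A i}))"
      by (rule emeasure_ultraproduct[OF vim[OF A(1)]])
    also have "(\<lambda>i. measure (X i) {x \<in> E i. a i g x \<in> A i}) = (\<lambda>i. measure (X i) (A i))"
      using A(1) by (intro ext pmp_measure_vimage[OF pmp g]) auto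
    then have "lim_measure (\<lambda>i. {x \<in> E i. a i g x \<in> A i}) = lim_measure A"
      by (simp add: lim_measure_def)
    also have "ennreal (lim_measure A) = emeasure UX S" by (simp add: A emeasure_ultraproduct)
    finally show "emeasure (distr UX UX (ua g)) S = emeasure UX S" .
  qed
qed

text \<open>An instance of Los's theorem: \<open>S\<close> is finite, so the conditions for all
  \<open>s \<in> S\<close> hold together for almost every \<open>i\<close> if and only if each
  single one does.\<close>

lemma ultra_fun_pattern:
  assumes f: "\<And>i. f i \<in> measurable (X i) (count_space {..<p})" and h: "\<And>i. h i \<in> measurable (X i) (count_space {..<r})"
    and S: "finite S" "S \<subseteq> carrier G" and \<pi>: "\<pi> \<in> S \<rightarrow>\<^sub>E B"
  shows "{c \<in> \<Omega>. pattern_map G ua S (ultra_fun U f) c = \<pi> \<and> ultra_fun U h c = j} =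
    intl (\<lambda>i. {x \<in> E i. pattern_map G (a i) S (f i) x = \<pi> \<and> h i x = j})"
proof (rule internal_setI)
  interpret group G by (rule pmp_actionD(3)[OF pmp])
  fix x assume x: "x \<in> Pi UNIV E"
  have 1: "eventually (\<lambda>i. x i \<in> E i) U" using x by (intro always_eventually) auto
  have "ultra_fun U f (ua (inv\<^bsub>G\<^esub> s) (pt x)) = k \<longleftrightarrow> eventually (\<lambda>i. f i (a i (inv\<^bsub>G\<^esub> s) (x i)) = k) U"
    if "s \<in> S" for s k
  proof -
    have s: "inv\<^bsub>G\<^esub> s \<in> carrier G" using that S by auto
    show ?thesis
      unfolding ultra_action_point[OF s x] using action_closed[OF s x]
      by (rule ultra_fun_point[OF f])
  qed
  then have "pt x \<in> {c \<in> \<Omega>. pattern_map G ua S (ultra_fun U f) c = \<pi> \<and> ultra_fun U h c = j} \<longleftrightarrow>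
      eventually (\<lambda>i. \<forall>s\<in>S. f i (a i (inv\<^bsub>G\<^esub> s) (x i)) = \<pi> s) U \<and> eventually (\<lambda>i. h i (x i) = j) U"
    using ultra_point_in[OF x] S(1) ultra_fun_point[OF h x]
    by (simp add: pattern_map_eq_iff[OF \<pi>] eventually_ball_finite_distrib)
  then show "pt x \<in> {c \<in> \<Omega>. pattern_map G ua S (ultra_fun U f) c = \<pi> \<and> ultra_fun U h c = j} \<longleftrightarrow>
      eventually (\<lambda>i. x i \<in> {x \<in> E i. pattern_map G (a i) S (f i) x = \<pi> \<and> h i x = j}) U"
    using 1 by (simp add: pattern_map_eq_iff[OF \<pi>] eventually_conj_iff)
qed blast

lemma ultra_fun_pair:
  assumes f: "\<And>i. f i \<in> measurable (X i) (count_space {..<p})" and g: "g \<in> carrier G"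
  shows "{c \<in> \<Omega>. ultra_fun U f c = j \<and> ultra_fun U f (ua g c) = k} =
    intl (\<lambda>i. {x \<in> E i. f i x = j \<and> f i (a i g x) = k})"
proof (rule internal_setI)
  fix x assume x: "x \<in> Pi UNIV E"
  have 1: "eventually (\<lambda>i. x i \<in> E i) U" using x by (intro always_eventually) auto
  show "pt x \<in> {c \<in> \<Omega>. ultra_fun U f c = j \<and> ultra_fun U f (ua g c) = k} \<longleftrightarrow>
      eventually (\<lambda>i. x i \<in> {x \<in> E i. f i x = j \<and> f i (a i g x) = k}) U"
    using 1 ultra_point_in[OF x] ultra_fun_point[OF f x]
      ultra_fun_point[OF f action_closed[OF g x]]
    by (simp add: ultra_action_point[OF g x] eventually_conj_iff)
qed blast

end

section \<open>Markov extensions of an action along an equivariant forest\<close>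

text \<open>\<open>T x\<close> is the forest seen from \<open>x\<close>: the edge \<open>(u, v)\<close> stands for the pair \<open>(u x, v x)\<close>.\<close>

locale markov_extension =
  fixes G :: "('g, 'b) monoid_scheme" and N :: "'z measure" and act :: "'g \<Rightarrow> 'z \<Rightarrow> 'z"
    and A :: "real set" and law :: "nat \<Rightarrow> real \<Rightarrow> real"
    and dens :: "'g \<Rightarrow> nat \<Rightarrow> nat \<Rightarrow> real \<Rightarrow> real \<Rightarrow> real"
    and col :: "'z \<Rightarrow> nat" and r :: nat and T :: "'z \<Rightarrow> ('g \<times> 'g) set"
  assumes pmp: "pmp_action G N act" and countable_G: "countable (carrier G)"
    and finite_A: "finite A"
    and law_nonneg: "\<And>j a. 0 \<le> law j a" and law_sum: "\<And>j. (\<Sum>a\<in>A. law j a) = 1"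
    and dens_nonneg: "\<And>g j k a b. 0 \<le> dens g j k a b"
    and dens_right: "\<And>g j k a. a \<in> A \<Longrightarrow> law j a \<noteq> 0 \<Longrightarrow> (\<Sum>b\<in>A. law k b * dens g j k a b) = 1"
    and dens_left: "\<And>g j k b. b \<in> A \<Longrightarrow> law k b \<noteq> 0 \<Longrightarrow> (\<Sum>a\<in>A. law j a * dens g j k a b) = 1"
    and col: "col \<in> measurable N (count_space {..<r})"
    and T_sub: "\<And>x. T x \<subseteq> carrier G \<times> carrier G"
    and T_forest: "\<And>x. x \<in> space N \<Longrightarrow> forest (T x)"
    and T_sets: "\<And>u v. u \<in> carrier G \<Longrightarrow> v \<in> carrier G \<Longrightarrow> {x \<in> space N. (u, v) \<in> T x} \<in> sets N"
    and T_equiv: "\<And>g u v x. g \<in> carrier G \<Longrightarrow> u \<in> carrier G \<Longrightarrow> v \<in> carrier G \<Longrightarrow> x \<in> space N \<Longrightarrow>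
      (u, v) \<in> T (act g x) \<longleftrightarrow> (u \<otimes>\<^bsub>G\<^esub> g, v \<otimes>\<^bsub>G\<^esub> g) \<in> T x"
begin

sublocale group G by (rule pmp_actionD(3)[OF pmp])

abbreviation "K \<equiv> carrier G"
abbreviation "L \<equiv> PiM K (\<lambda>_. borel :: real measure)"

definition vlaw :: "'z \<Rightarrow> 'g \<Rightarrow> real \<Rightarrow> real"
  where "vlaw x v = law (col (act v x))"

text \<open>\<open>v \<otimes> inv u\<close> carries \<open>act u x\<close> to
  \<open>act v x\<close>. It does not change if \<open>u\<close> and \<open>v\<close> are multiplied
  on the right by the same element, which is the source of equivariance.\<close>

definition edens :: "'z \<Rightarrow> 'g \<Rightarrow> 'g \<Rightarrow> real \<Rightarrow> real \<Rightarrow> real"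
  where "edens x u v = dens (v \<otimes>\<^bsub>G\<^esub> inv\<^bsub>G\<^esub> u) (col (act u x)) (col (act v x))"

lemma tree_field: "x \<in> space N \<Longrightarrow> tree_field A (vlaw x) (edens x) (T x) K"
  by unfold_locales
    (auto simp: vlaw_def edens_def finite_A law_nonneg law_sum dens_nonneg T_forest
      intro: dens_right dens_left dest: subsetD[OF T_sub])

definition kernel :: "'z \<Rightarrow> ('g \<Rightarrow> real) measure"
  where "kernel x = tree_field.field A (vlaw x) (edens x) (T x) K"

lemma col_act: "v \<in> K \<Longrightarrow> (\<lambda>x. col (act v x)) \<in> measurable N (count_space {..<r})"
  by (rule measurable_compose[OF pmp_actionD(4)[OF pmp] col])

lemma col_act_UNIV: "v \<in> K \<Longrightarrow> (\<lambda>x. col (act v x)) \<in> measurable N (count_space UNIV)"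
  by (rule measurable_compose[OF col_act]) auto

lemma kernel_measurable: "kernel \<in> N \<rightarrow>\<^sub>M prob_algebra L"
  unfolding kernel_def
proof (rule field_kernel[OF countable_G tree_field])
  show "(\<lambda>x. vlaw x v a) \<in> borel_measurable N" if "v \<in> K" for v a
    unfolding vlaw_def by (rule measurable_compose[OF col_act_UNIV[OF that]]) simp
  show "(\<lambda>x. edens x u v a b) \<in> borel_measurable N" if "u \<in> K" "v \<in> K" for u v a b
  proof -
    have "(\<lambda>x. (col (act u x), col (act v x))) \<in> measurable N (count_space UNIV)"
      using measurable_Pair[OF col_act_UNIV[OF that(1)] col_act_UNIV[OF that(2)]]
      by (simp add: pair_measure_countable)
    then have "(\<lambda>x. case (col (act u x), col (act v x)) of (j, k) \<Rightarrow> dens (v \<otimes>\<^bsub>G\<^esub> inv\<^bsub>G\<^esub> u) j k a b)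
        \<in> borel_measurable N"
      by (rule measurable_compose) simp
    then show ?thesis by (simp add: edens_def)
  qed
  show "Measurable.pred N (\<lambda>x. (u, v) \<in> T x)" if "u \<in> K" "v \<in> K" for u v
    using T_sets[OF that] by (simp add: pred_def)
qed

definition ext :: "('z \<times> ('g \<Rightarrow> real)) measure"
  where "ext = N \<bind> (\<lambda>x. distr (kernel x) (N \<Otimes>\<^sub>M L) (\<lambda>l. (x, l)))"

lemma N_prob_algebra: "N \<in> space (prob_algebra N)"
  using pmp_actionD(1)[OF pmp] by (simp add: space_prob_algebra)

lemma pair_kernel_measurable: "(\<lambda>x. distr (kernel x) (N \<Otimes>\<^sub>M L) (\<lambda>l. (x, l))) \<in> N \<rightarrow>\<^sub>M prob_algebra (N \<Otimes>\<^sub>M L)"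
  by (rule measurable_distr_prob_space2[OF kernel_measurable]) simp

lemma sets_ext: "sets ext = sets (N \<Otimes>\<^sub>M L)"
  unfolding ext_def by (rule sets_bind'[OF N_prob_algebra pair_kernel_measurable])

lemma space_ext: "space ext = space N \<times> space L"
  using sets_eq_imp_space_eq[OF sets_ext] by (simp add: space_pair_measure)

lemma prob_space_ext: "prob_space ext"
  unfolding ext_def by (rule prob_space_bind'[OF N_prob_algebra pair_kernel_measurable])

lemma kernel_prob: "x \<in> space N \<Longrightarrow> prob_space (kernel x)"
  using measurable_space[OF kernel_measurable] by (auto simp: space_prob_algebra)

lemma sets_kernel: "x \<in> space N \<Longrightarrow> sets (kernel x) = sets L"
  using measurable_space[OF kernel_measurable] by (auto simp: space_prob_algebra)

lemma space_kernel: "x \<in> space N \<Longrightarrow> space (kernel x) = space L"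
  using sets_eq_imp_space_eq[OF sets_kernel] .

lemma emeasure_ext:
  assumes S: "S \<in> sets (N \<Otimes>\<^sub>M L)"
  shows "emeasure ext S = (\<integral>\<^sup>+x. emeasure (kernel x) {l \<in> space L. (x, l) \<in> S} \<partial>N)"
proof -
  have "emeasure ext S = (\<integral>\<^sup>+x. emeasure (distr (kernel x) (N \<Otimes>\<^sub>M L) (\<lambda>l. (x, l))) S \<partial>N)"
    unfolding ext_def by (rule emeasure_bind_prob_algebra[OF N_prob_algebra pair_kernel_measurable S])
  also have "\<dots> = (\<integral>\<^sup>+x. emeasure (kernel x) {l \<in> space L. (x, l) \<in> S} \<partial>N)"
  proof (rule nn_integral_cong)
    fix x assume x: "x \<in> space N"
    have "emeasure (distr (kernel x) (N \<Otimes>\<^sub>M L) (\<lambda>l. (x, l))) S = emeasure (kernel x) ((\<lambda>l. (x, l)) -` S \<inter> space (kernel x))"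
      using x S measurable_Pair1'[OF x, of L]
      by (intro emeasure_distr) (simp_all add: measurable_cong_sets[OF sets_kernel[OF x] refl])
    also have "(\<lambda>l. (x, l)) -` S \<inter> space (kernel x) = {l \<in> space L. (x, l) \<in> S}"
      using x by (auto simp: space_kernel)
    finally show "emeasure (distr (kernel x) (N \<Otimes>\<^sub>M L) (\<lambda>l. (x, l))) S = emeasure (kernel x) {l \<in> space L. (x, l) \<in> S}" .
  qed
  finally show ?thesis .
qed

lemma section_measurable:
  assumes S: "S \<in> sets (N \<Otimes>\<^sub>M L)"
  shows "(\<lambda>x. emeasure (kernel x) {l \<in> space L. (x, l) \<in> S}) \<in> borel_measurable N"
proof (rule emeasure_measurable_subprob_algebra2[OF _ measurable_prob_algebraD[OF kernel_measurable]])
  have "S \<subseteq> space N \<times> space L" using sets.sets_into_space[OF S] by (simp add: space_pair_measure)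
  then have "Sigma (space N) (\<lambda>x. {l \<in> space L. (x, l) \<in> S}) = S" by auto
  then show "Sigma (space N) (\<lambda>x. {l \<in> space L. (x, l) \<in> S}) \<in> sets (N \<Otimes>\<^sub>M L)" using S by simp
qed

text \<open>Vertex \<open>v\<close> over \<open>act g x\<close> is the point
  \<open>act (v \<otimes> g) x\<close>, which is vertex \<open>v \<otimes> g\<close> over
  \<open>x\<close>. Hence right translation, and it gives a left action.\<close>

definition shift :: "'g \<Rightarrow> ('g \<Rightarrow> real) \<Rightarrow> 'g \<Rightarrow> real"
  where "shift g l = (\<lambda>v\<in>K. l (v \<otimes>\<^bsub>G\<^esub> g))"

definition eact :: "'g \<Rightarrow> 'z \<times> ('g \<Rightarrow> real) \<Rightarrow> 'z \<times> ('g \<Rightarrow> real)"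
  where "eact g = (\<lambda>y\<in>space ext. (act g (fst y), shift g (snd y)))"

lemma shift_measurable: "g \<in> K \<Longrightarrow> shift g \<in> L \<rightarrow>\<^sub>M L"
  unfolding shift_def by (intro measurable_restrict) simp

lemma kernel_equivariant:
  assumes g: "g \<in> K" and x: "x \<in> space N"
  shows "kernel (act g x) = distr (kernel x) L (shift g)"
  unfolding kernel_def shift_def[abs_def]
proof (rule field_equivariant)
  show "tree_field A (vlaw x) (edens x) (T x) K" using x by (rule tree_field)
  show "tree_field A (vlaw (act g x)) (edens (act g x)) (T (act g x)) K"
    using pmp_actionD(6)[OF pmp g x] by (rule tree_field)
  show "bij_betw (\<lambda>v. v \<otimes>\<^bsub>G\<^esub> g) K K"
    by (rule bij_betwI[where g="\<lambda>v. v \<otimes>\<^bsub>G\<^esub> inv\<^bsub>G\<^esub> g"]) (use g in \<open>auto simp: m_assoc\<close>)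
  fix u v assume uv: "u \<in> K" "v \<in> K"
  have "act v (act g x) = act (v \<otimes>\<^bsub>G\<^esub> g) x" "act u (act g x) = act (u \<otimes>\<^bsub>G\<^esub> g) x"
    using uv g x pmp_actionD(8)[OF pmp] by auto
  moreover have "v \<otimes>\<^bsub>G\<^esub> g \<otimes>\<^bsub>G\<^esub> inv\<^bsub>G\<^esub> (u \<otimes>\<^bsub>G\<^esub> g) = v \<otimes>\<^bsub>G\<^esub> inv\<^bsub>G\<^esub> u"
    using uv g by (simp add: inv_mult_group m_assoc[symmetric]) (simp add: m_assoc)
  ultimately show "edens (act g x) u v = edens x (u \<otimes>\<^bsub>G\<^esub> g) (v \<otimes>\<^bsub>G\<^esub> g)"
    by (simp add: edens_def)
  show "(u, v) \<in> T (act g x) \<longleftrightarrow> (u \<otimes>\<^bsub>G\<^esub> g, v \<otimes>\<^bsub>G\<^esub> g) \<in> T x" using T_equiv g uv x by blast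
next
  fix v assume "v \<in> K"
  then show "vlaw (act g x) v = vlaw x (v \<otimes>\<^bsub>G\<^esub> g)"
    using g x pmp_actionD(8)[OF pmp] by (simp add: vlaw_def)
qed

lemma eact_measurable:
  assumes g: "g \<in> K"
  shows "eact g \<in> ext \<rightarrow>\<^sub>M ext"
proof -
  have "(\<lambda>y. (act g (fst y), shift g (snd y))) \<in> N \<Otimes>\<^sub>M L \<rightarrow>\<^sub>M N \<Otimes>\<^sub>M L"
    by (intro measurable_Pair measurable_compose[OF measurable_fst pmp_actionD(4)[OF pmp g]]
      measurable_compose[OF measurable_snd shift_measurable[OF g]])
  then have "(\<lambda>y. (act g (fst y), shift g (snd y))) \<in> ext \<rightarrow>\<^sub>M ext"
    by (simp only: measurable_cong_sets[OF sets_ext sets_ext])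
  then show ?thesis by (rule measurable_cong[THEN iffD1, rotated]) (simp add: eact_def)
qed

text \<open>By \<open>kernel_equivariant\<close> the fibre measure at \<open>x\<close> of the
  preimage of \<open>S\<close> is that of \<open>S\<close> at \<open>act g x\<close>; the invariance
  of \<open>N\<close> does the rest.\<close>

lemma pmp_ext: "pmp_action G ext eact"
  unfolding pmp_action_def
proof (intro conjI ballI)
  show "prob_space ext" by (rule prob_space_ext)
  show "group_action G (space ext) eact"
  proof (rule group_actionI[OF is_group])
    show "eact g \<in> extensional (space ext)" for g by (simp add: eact_def)
    show cl: "eact g y \<in> space ext" if "g \<in> K" "y \<in> space ext" for g y
      using measurable_space[OF eact_measurable] that by blast
    show "eact \<one>\<^bsub>G\<^esub> y = y" if y: "y \<in> space ext" for y
    proof -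
      have "snd y \<in> extensional K" using y by (auto simp: space_ext space_PiM PiE_iff)
      then have "shift \<one>\<^bsub>G\<^esub> (snd y) = snd y"
        unfolding shift_def by (intro extensionalityI[of _ K]) auto
      moreover have "act \<one>\<^bsub>G\<^esub> (fst y) = fst y"
        using y by (intro pmp_actionD(7)[OF pmp]) (auto simp: space_ext)
      ultimately show ?thesis using y by (simp add: eact_def)
    qed
    show "eact (g \<otimes>\<^bsub>G\<^esub> h) y = eact g (eact h y)" if "g \<in> K" "h \<in> K" and y: "y \<in> space ext" for g h y
    proof -
      have "fst y \<in> space N" using y by (auto simp: space_ext)
      moreover have "shift (g \<otimes>\<^bsub>G\<^esub> h) (snd y) = shift g (shift h (snd y))"
        unfolding shift_def using that by (auto simp: m_assoc intro!: restrict_ext)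
      moreover have "eact g (eact h y) = (act g (fst (eact h y)), shift g (snd (eact h y)))"
        using cl[OF that(2) y] by (simp add: eact_def[of g])
      ultimately show ?thesis using that pmp_actionD(8)[OF pmp] by (simp add: eact_def)
    qed
  qed
  fix g assume g: "g \<in> K"
  show "eact g \<in> ext \<rightarrow>\<^sub>M ext" using g by (rule eact_measurable)
  show "distr ext ext (eact g) = ext"
  proof (rule measure_eqI)
    fix S assume "S \<in> sets (distr ext ext (eact g))"
    then have S: "S \<in> sets (N \<Otimes>\<^sub>M L)" "S \<in> sets ext" by (simp_all add: sets_ext)
    let ?F = "\<lambda>x. emeasure (kernel x) {l \<in> space L. (x, l) \<in> S}"
    have pre: "eact g -` S \<inter> space ext \<in> sets (N \<Otimes>\<^sub>M L)"
      using measurable_sets[OF eact_measurable[OF g] S(2)] by (simp add: sets_ext)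
    have "emeasure (distr ext ext (eact g)) S = emeasure ext (eact g -` S \<inter> space ext)"
      by (rule emeasure_distr[OF eact_measurable[OF g] S(2)])
    also have "\<dots> = (\<integral>\<^sup>+x. emeasure (kernel x) {l \<in> space L. (x, l) \<in> eact g -` S \<inter> space ext} \<partial>N)"
      by (rule emeasure_ext[OF pre])
    also have "\<dots> = (\<integral>\<^sup>+x. ?F (act g x) \<partial>N)"
    proof (rule nn_integral_cong)
      fix x assume x: "x \<in> space N"
      have gx: "act g x \<in> space N" using pmp_actionD(6)[OF pmp g x] .
      have sec: "{l \<in> space L. (act g x, l) \<in> S} \<in> sets L"
      proof -
        have "Pair (act g x) -` S \<inter> space L \<in> sets L"
          by (rule measurable_sets[OF measurable_Pair1'[OF gx] S(1)])
        also have "Pair (act g x) -` S \<inter> space L = {l \<in> space L. (act g x, l) \<in> S}" by auto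
        finally show ?thesis .
      qed
      have "?F (act g x) = emeasure (kernel x) (shift g -` {l \<in> space L. (act g x, l) \<in> S} \<inter> space (kernel x))"
        unfolding kernel_equivariant[OF g x]
        using shift_measurable[OF g] sec
        by (intro emeasure_distr) (simp_all add: measurable_cong_sets[OF sets_kernel[OF x] refl])
      also have "shift g -` {l \<in> space L. (act g x, l) \<in> S} \<inter> space (kernel x) =
          {l \<in> space L. (x, l) \<in> eact g -` S \<inter> space ext}"
        using x measurable_space[OF shift_measurable[OF g]] by (auto simp: space_kernel eact_def space_ext)
      finally show "emeasure (kernel x) {l \<in> space L. (x, l) \<in> eact g -` S \<inter> space ext} = ?F (act g x)" ..
    qed
    also have "\<dots> = (\<integral>\<^sup>+x. ?F x \<partial>distr N N (act g))"
      by (rule nn_integral_distr[OF pmp_actionD(4)[OF pmp g], symmetric]) (simp add: section_measurable[OF S(1)])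
    also have "\<dots> = emeasure ext S" by (simp add: pmp_actionD(5)[OF pmp g] emeasure_ext[OF S(1)])
    finally show "emeasure (distr ext ext (eact g)) S = emeasure ext S" .
  qed simp
qed

lemma fst_measurable: "fst \<in> ext \<rightarrow>\<^sub>M N"
  using measurable_fst by (simp add: measurable_cong_sets[OF sets_ext refl])

lemma label_measurable: "v \<in> K \<Longrightarrow> (\<lambda>y. snd y v) \<in> borel_measurable ext"
  unfolding measurable_cong_sets[OF sets_ext refl] by simp

lemma factor_ext: "factor_map G ext eact N act fst"
  unfolding factor_map_def
proof (intro conjI ballI)
  show "fst \<in> ext \<rightarrow>\<^sub>M N" by (rule fst_measurable)
  show "distr ext N fst = N"
  proof (rule measure_eqI)
    fix B assume "B \<in> sets (distr ext N fst)"
    then have B: "B \<in> sets N" by simp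
    have "emeasure (distr ext N fst) B = emeasure ext (fst -` B \<inter> space ext)"
      by (rule emeasure_distr[OF fst_measurable B])
    also have "fst -` B \<inter> space ext = B \<times> space L"
      using sets.sets_into_space[OF B] by (auto simp: space_ext)
    also have "emeasure ext \<dots> = (\<integral>\<^sup>+x. emeasure (kernel x) {l \<in> space L. (x, l) \<in> B \<times> space L} \<partial>N)"
      using B by (intro emeasure_ext) auto
    also have "\<dots> = (\<integral>\<^sup>+x. indicator B x \<partial>N)"
    proof (rule nn_integral_cong)
      fix x assume x: "x \<in> space N"
      have "{l \<in> space L. (x, l) \<in> B \<times> space L} = (if x \<in> B then space (kernel x) else {})"
        using x by (auto simp: space_kernel)
      then show "emeasure (kernel x) {l \<in> space L. (x, l) \<in> B \<times> space L} = indicator B x"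
        using prob_space.emeasure_space_1[OF kernel_prob[OF x]] by (simp split: if_splits)
    qed
    also have "\<dots> = emeasure N B" using B by simp
    finally show "emeasure (distr ext N fst) B = emeasure N B" .
  qed simp
qed (auto simp: eact_def)

lemma eact_label:
  assumes "g \<in> K" "v \<in> K" "y \<in> space ext"
  shows "snd (eact g y) v = snd y (v \<otimes>\<^bsub>G\<^esub> g)"
  using assms by (simp add: eact_def shift_def)

text \<open>The law of the label at \<open>v\<close> depends on \<open>x\<close> only through the
  colour of \<open>act v x\<close>, so the fibre integral is constant on each colour class.\<close>

lemma measure_label:
  assumes v: "v \<in> K" and B: "B \<in> sets borel"
  shows "measure ext {y \<in> space ext. col (act v (fst y)) = j \<and> snd y v \<in> B} =
    measure N {x \<in> space N. col (act v x) = j} * (\<Sum>a\<in>A. law j a * indicator B a)"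
proof -
  interpret N: prob_space N by (rule pmp_actionD(1)[OF pmp])
  let ?S = "{y \<in> space ext. col (act v (fst y)) = j \<and> snd y v \<in> B}"
  let ?C = "{x \<in> space N. col (act v x) = j}" and ?p = "\<Sum>a\<in>A. law j a * indicator B a"
  have C: "?C \<in> sets N" by (rule count_space_vimage_sets[OF col_act[OF v]])
  have p: "0 \<le> ?p" by (intro sum_nonneg mult_nonneg_nonneg) (auto simp: law_nonneg)
  have "(fst -` ?C \<inter> space ext) \<inter> ((\<lambda>y. snd y v) -` B \<inter> space ext) \<in> sets ext"
    using measurable_sets[OF fst_measurable C] measurable_sets[OF label_measurable[OF v] B] by blast
  also have "(fst -` ?C \<inter> space ext) \<inter> ((\<lambda>y. snd y v) -` B \<inter> space ext) = ?S" by (auto simp: space_ext)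
  finally have S: "?S \<in> sets (N \<Otimes>\<^sub>M L)" by (simp add: sets_ext)
  have "emeasure ext ?S = (\<integral>\<^sup>+x. emeasure (kernel x) {l \<in> space L. (x, l) \<in> ?S} \<partial>N)"
    by (rule emeasure_ext[OF S])
  also have "\<dots> = (\<integral>\<^sup>+x. ennreal ?p * indicator ?C x \<partial>N)"
  proof (rule nn_integral_cong)
    fix x assume x: "x \<in> space N"
    interpret tree_field A "vlaw x" "edens x" "T x" K using x by (rule tree_field)
    interpret k: prob_space "kernel x" using x by (rule kernel_prob)
    have "measure (kernel x) {l \<in> space (kernel x). l v \<in> B} = (\<Sum>a\<in>A. vlaw x v a * indicator B a)"
      unfolding kernel_def by (rule measure_field_vertex[OF v B])
    then have "emeasure (kernel x) {l \<in> space L. l v \<in> B} = ennreal (\<Sum>a\<in>A. law (col (act v x)) a * indicator B a)"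
      using x by (simp add: k.emeasure_eq_measure space_kernel vlaw_def)
    then show "emeasure (kernel x) {l \<in> space L. (x, l) \<in> ?S} = ennreal ?p * indicator ?C x"
      using x by (auto simp: space_ext indicator_def)
  qed
  also have "\<dots> = ennreal ?p * emeasure N ?C" using C by (rule nn_integral_cmult_indicator)
  also have "\<dots> = ennreal (measure N ?C * ?p)"
    using p by (simp add: N.emeasure_eq_measure ennreal_mult'[symmetric] mult.commute)
  finally have "emeasure ext ?S = ennreal (measure N ?C * ?p)" .
  then show ?thesis unfolding measure_def[of ext] by (simp add: p)
qed

text \<open>Only a bound: base points where \<open>(u, v)\<close> is not an edge are dropped on the
  left but still counted on the right. In return the right side sees the base through statistics of
  colour pairs alone, and these can be transferred.\<close>

lemma measure_edge:
  assumes u: "u \<in> K" and v: "v \<in> K" and P: "P \<subseteq> A \<times> A"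
  shows "measure ext {y \<in> space ext. (u, v) \<in> T (fst y) \<and> (snd y u, snd y v) \<in> P} \<le>
    (\<Sum>j<r. \<Sum>k<r. measure N {x \<in> space N. col (act u x) = j \<and> col (act v x) = k} *
      (\<Sum>(a, b)\<in>P. law j a * law k b * dens (v \<otimes>\<^bsub>G\<^esub> inv\<^bsub>G\<^esub> u) j k a b))"
proof -
  interpret N: prob_space N by (rule pmp_actionD(1)[OF pmp])
  let ?S = "{y \<in> space ext. (u, v) \<in> T (fst y) \<and> (snd y u, snd y v) \<in> P}"
  let ?C = "\<lambda>j k. {x \<in> space N. col (act u x) = j \<and> col (act v x) = k}"
  let ?q = "\<lambda>j k. \<Sum>(a, b)\<in>P. law j a * law k b * dens (v \<otimes>\<^bsub>G\<^esub> inv\<^bsub>G\<^esub> u) j k a b"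
  have C: "?C j k \<in> sets N" for j k
  proof -
    have "{x \<in> space N. col (act u x) = j} \<inter> {x \<in> space N. col (act v x) = k} \<in> sets N"
      by (intro sets.Int count_space_vimage_sets[OF col_act] u v)
    also have "{x \<in> space N. col (act u x) = j} \<inter> {x \<in> space N. col (act v x) = k} = ?C j k" by auto
    finally show ?thesis .
  qed
  have q: "0 \<le> ?q j k" for j k
    by (intro sum_nonneg) (auto simp: law_nonneg dens_nonneg)
  have finP: "finite P" using P finite_A finite_subset by blast
  have "(\<lambda>y. (snd y u, snd y v)) \<in> ext \<rightarrow>\<^sub>M (borel :: (real \<times> real) measure)"
    unfolding borel_prod[symmetric] by (intro measurable_Pair label_measurable u v)
  moreover have "P \<in> sets borel" using finP by (simp add: borel_closed finite_imp_closed)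
  ultimately have "(\<lambda>y. (snd y u, snd y v)) -` P \<inter> space ext \<in> sets ext" by (rule measurable_sets)
  then have "(fst -` {x \<in> space N. (u, v) \<in> T x} \<inter> space ext) \<inter> ((\<lambda>y. (snd y u, snd y v)) -` P \<inter> space ext) \<in> sets ext"
    by (rule sets.Int[OF measurable_sets[OF fst_measurable T_sets[OF u v]]])
  also have "(fst -` {x \<in> space N. (u, v) \<in> T x} \<inter> space ext) \<inter> ((\<lambda>y. (snd y u, snd y v)) -` P \<inter> space ext) = ?S"
    by (auto simp: space_ext)
  finally have S: "?S \<in> sets (N \<Otimes>\<^sub>M L)" by (simp add: sets_ext)
  have "emeasure ext ?S = (\<integral>\<^sup>+x. emeasure (kernel x) {l \<in> space L. (x, l) \<in> ?S} \<partial>N)"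
    by (rule emeasure_ext[OF S])
  also have "\<dots> \<le> (\<integral>\<^sup>+x. (\<Sum>j<r. \<Sum>k<r. ennreal (?q j k) * indicator (?C j k) x) \<partial>N)"
  proof (rule nn_integral_mono)
    fix x assume x: "x \<in> space N"
    define j0 where "j0 = col (act u x)"
    define k0 where "k0 = col (act v x)"
    have jk: "j0 < r" "k0 < r"
      using measurable_space[OF col_act[OF u] x] measurable_space[OF col_act[OF v] x] by (auto simp: j0_def k0_def)
    have "(\<Sum>j<r. \<Sum>k<r. ennreal (?q j k) * indicator (?C j k) x) =
        (\<Sum>j<r. \<Sum>k<r. if k = k0 then (if j = j0 then ennreal (?q j k) else 0) else 0)"
      using x by (intro sum.cong refl) (auto simp: indicator_def j0_def k0_def)
    also have "\<dots> = ennreal (?q j0 k0)" using jk by (simp add: sum.delta)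
    finally have R: "(\<Sum>j<r. \<Sum>k<r. ennreal (?q j k) * indicator (?C j k) x) = ennreal (?q j0 k0)" .
    show "emeasure (kernel x) {l \<in> space L. (x, l) \<in> ?S} \<le> (\<Sum>j<r. \<Sum>k<r. ennreal (?q j k) * indicator (?C j k) x)"
      unfolding R
    proof (cases "(u, v) \<in> T x")
      case True
      interpret tree_field A "vlaw x" "edens x" "T x" K using x by (rule tree_field)
      interpret k: prob_space "kernel x" using x by (rule kernel_prob)
      have "measure (kernel x) {l \<in> space (kernel x). (l u, l v) \<in> P} =
          (\<Sum>(a, b)\<in>P. vlaw x u a * vlaw x v b * edens x u v a b)"
        unfolding kernel_def by (rule measure_field_edge[OF True P])
      then have "emeasure (kernel x) {l \<in> space L. (l u, l v) \<in> P} = ennreal (?q j0 k0)"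
        using x by (simp add: k.emeasure_eq_measure space_kernel vlaw_def edens_def j0_def k0_def)
      then show "emeasure (kernel x) {l \<in> space L. (x, l) \<in> ?S} \<le> ennreal (?q j0 k0)"
        using x True by (simp add: space_ext)
    qed (simp add: space_ext)
  qed
  also have "\<dots> = (\<Sum>j<r. \<integral>\<^sup>+x. (\<Sum>k<r. ennreal (?q j k) * indicator (?C j k) x) \<partial>N)"
    by (rule nn_integral_sum) (intro borel_measurable_sum borel_measurable_times_ennreal borel_measurable_const
      borel_measurable_indicator C)
  also have "\<dots> = (\<Sum>j<r. \<Sum>k<r. \<integral>\<^sup>+x. ennreal (?q j k) * indicator (?C j k) x \<partial>N)"
    by (intro sum.cong refl nn_integral_sum borel_measurable_times_ennreal borel_measurable_const
      borel_measurable_indicator C)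
  also have "\<dots> = (\<Sum>j<r. \<Sum>k<r. ennreal (?q j k) * emeasure N (?C j k))"
    by (intro sum.cong refl nn_integral_cmult_indicator C)
  also have "\<dots> = (\<Sum>j<r. \<Sum>k<r. ennreal (measure N (?C j k) * ?q j k))"
    using q by (intro sum.cong refl) (simp add: N.emeasure_eq_measure ennreal_mult'[symmetric] mult.commute)
  also have "\<dots> = ennreal (\<Sum>j<r. \<Sum>k<r. measure N (?C j k) * ?q j k)"
    using q by (simp add: sum_ennreal sum_nonneg)
  finally have "emeasure ext ?S \<le> ennreal (\<Sum>j<r. \<Sum>k<r. measure N (?C j k) * ?q j k)" .
  then have "enn2real (emeasure ext ?S) \<le> (\<Sum>j<r. \<Sum>k<r. measure N (?C j k) * ?q j k)"
    by (intro enn2real_leI sum_nonneg mult_nonneg_nonneg) (auto simp: law_nonneg dens_nonneg)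
  then show ?thesis by (simp add: measure_def[of ext])
qed

end

section \<open>Forests in approximately treeable groups\<close>

text \<open>A simple path that avoids the edge \<open>(u, v)\<close> and joins its ends closes up
  with that edge to a cycle.\<close>

lemma acyclic_graph_forest:
  assumes ac: "acyclic_graph \<G>" and anti: "antisym \<G>" and irr: "irrefl \<G>"
  shows "forest \<G>"
  unfolding forest_def
proof clarify
  fix u v assume uv: "(u, v) \<in> \<G>" and l: "linked (\<G> - {(u, v)}) u v"
  let ?R = "(\<G> - {(u, v)}) \<union> (\<G> - {(u, v)})\<inverse>"
  have ne: "u \<noteq> v" using irr uv by (auto simp: irrefl_def)
  have "(\<lambda>x y. (x, y) \<in> ?R)\<^sup>*\<^sup>* u v" 
  proof -
    have "{(x, y). (x, y) \<in> ?R} = ?R" by blast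
    then show ?thesis using l by (simp only: linked_def rtranclp_rtrancl_eq)
  qed
  then obtain xs where "rtrancl_path (\<lambda>x y. (x, y) \<in> ?R) u xs v"
    unfolding rtranclp_eq_rtrancl_path by blast
  then obtain ys where p: "rtrancl_path (\<lambda>x y. (x, y) \<in> ?R) u ys v" and d: "distinct (u # ys)"
    by (rule rtrancl_path_distinct)
  have ys: "ys \<noteq> []" using p ne by (auto elim: rtrancl_path.cases)
  then have last: "last ys = v" using p by (rule rtrancl_path_last[rotated])
  have step: "((u # ys) ! k, ys ! k) \<in> ?R" if "k < length ys" for k
    using rtrancl_path_nth[OF p that] by simp
  \<comment> \<open>A path of a single step could only use the opposite edge \<open>(v, u)\<close>,
    which antisymmetry forbids; so the cycle has at least three vertices.\<close>
  have "length ys \<noteq> 1"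
  proof
    assume "length ys = 1"
    then have "ys = [v]" using last by (cases ys) auto
    then have "(u, v) \<in> ?R" using step[of 0] by simp
    then have "(v, u) \<in> \<G>" by auto
    then show False using anti uv ne by (auto dest: antisymD)
  qed
  then have len: "3 \<le> length (u # ys)" using ys by (cases ys) (auto simp: Suc_le_eq)
  have "((u # ys) ! k, (u # ys) ! (Suc k mod length (u # ys))) \<in> \<G> \<union> \<G>\<inverse>" if k: "k < length (u # ys)" for k
  proof (cases "k = length ys")
    case True
    then have "(u # ys) ! k = v" using last ys by (simp add: last_conv_nth nth_Cons')
    then show ?thesis using True uv by simp
  next
    case False
    then show ?thesis using step[of k] k by auto
  qed
  then show False using ac len d unfolding acyclic_graph_def by blast
qed

lemma forest_vimage:
  assumes "forest \<G>" "inj_on \<sigma> K" "T \<subseteq> K \<times> K" "\<And>u v. (u, v) \<in> T \<Longrightarrow> (\<sigma> u, \<sigma> v) \<in> \<G>"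
  shows "forest T"
  unfolding forest_def
proof clarify
  fix u v assume uv: "(u, v) \<in> T" and l: "linked (T - {(u, v)}) u v"
  have "linked (\<G> - {(\<sigma> u, \<sigma> v)}) (\<sigma> u) (\<sigma> v)"
  proof (rule linked_image[OF l])
    fix x y assume xy: "(x, y) \<in> T - {(u, v)}"
    then have "x \<in> K" "y \<in> K" "u \<in> K" "v \<in> K" using uv assms(3) by auto
    then have "(\<sigma> x, \<sigma> y) \<noteq> (\<sigma> u, \<sigma> v)" using xy inj_on_eq_iff[OF assms(2)] by auto
    then show "(\<sigma> x, \<sigma> y) \<in> \<G> - {(\<sigma> u, \<sigma> v)}" using assms(4) xy by auto
  qed
  then show False using assms(1,4) uv unfolding forest_def by blast
qed

text \<open>Freeness identifies almost every orbit with \<open>G\<close>, so the graph on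
  \<open>W\<close> can be read as a forest on \<open>G\<close> that depends equivariantly on the
  point. A path between points of \<open>H\<close> visits finitely many vertices, so by continuity
  of the measure one finite window \<open>F\<close> contains the needed paths with probability above
  \<open>1 - \<epsilon>\<close>.\<close>

lemma approx_treeable_forest:
  fixes G :: "('g, 'b) monoid_scheme"
  assumes cG: "countable (carrier G)" and tr: "approx_treeable TYPE('w) G"
    and H: "finite H" "H \<subseteq> carrier G" and e: "0 < \<epsilon>"
  obtains W :: "'w measure" and a and T :: "'w \<Rightarrow> ('g \<times> 'g) set" and F D
  where "pmp_action G W a" "\<And>x. T x \<subseteq> carrier G \<times> carrier G" "\<And>x. forest (T x)"
    "\<And>u v. u \<in> carrier G \<Longrightarrow> v \<in> carrier G \<Longrightarrow> {x \<in> space W. (u, v) \<in> T x} \<in> sets W"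
    "\<And>g u v x. g \<in> carrier G \<Longrightarrow> u \<in> carrier G \<Longrightarrow> v \<in> carrier G \<Longrightarrow> x \<in> space W \<Longrightarrow>
      (u, v) \<in> T (a g x) \<longleftrightarrow> (u \<otimes>\<^bsub>G\<^esub> g, v \<otimes>\<^bsub>G\<^esub> g) \<in> T x"
    "finite F" "F \<subseteq> carrier G" "H \<subseteq> F"
    "D \<in> sets W" "measure W D > 1 - \<epsilon>"
    "\<And>x h k. x \<in> D \<Longrightarrow> h \<in> H \<Longrightarrow> k \<in> H \<Longrightarrow> linked (T x \<inter> F \<times> F) h k"
proof -
  obtain W :: "'w measure" and a where free: "free_pmp_action G W a" and at: "approx_treeable_action G W a"
    using tr unfolding approx_treeable_def by blast
  have pmp: "pmp_action G W a" using free by (simp add: free_pmp_action_def)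
  interpret group G by (rule pmp_actionD(3)[OF pmp])
  interpret W: prob_space W by (rule pmp_actionD(1)[OF pmp])
  note act = pmp_actionD[OF pmp]
  let ?K = "carrier G"
  \<comment> \<open>With \<open>\<epsilon>' \<le> 1\<close> the bound \<open>1 - \<epsilon>'\<close>
    is nonnegative, so the event in \<open>big\<close> has positive measure. This yields its
    measurability below, as a nonmeasurable set has \<open>measure\<close> zero.\<close>
  define \<epsilon>' where "\<epsilon>' = min \<epsilon> 1"
  have "0 < \<epsilon>'" using e by (simp add: \<epsilon>'_def)
  then obtain \<G> where dm: "directed_measurable_graph G W a \<G>" and ac: "acyclic_graph \<G>"
    and big: "measure W {x \<in> space W. \<forall>h\<in>H. \<forall>k\<in>H. (a h x, a k x) \<in> component_rel (space W) \<G>} > 1 - \<epsilon>'"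
    using at H unfolding approx_treeable_action_def by blast
  have \<G>: "\<G> \<subseteq> orbit_rel G W a" "\<G> \<in> sets (restrict_space (W \<Otimes>\<^sub>M W) (orbit_rel G W a))" "antisym \<G>" "irrefl \<G>"
    using dm by (auto simp: directed_measurable_graph_def)
  have forest: "forest \<G>" using ac \<G>(3,4) by (rule acyclic_graph_forest)
  have "AE x in W. \<forall>g\<in>?K - {\<one>\<^bsub>G\<^esub>}. a g x \<noteq> x"
    using free cG by (subst AE_ball_countable) (auto simp: free_pmp_action_def)
  then obtain N where N: "{x \<in> space W. \<not> (\<forall>g\<in>?K - {\<one>\<^bsub>G\<^esub>}. a g x \<noteq> x)} \<subseteq> N" "emeasure W N = 0" "N \<in> sets W"
    by (rule AE_E)
  \<comment> \<open>The union of the orbits that avoid a null set containing all nonfree points: an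
    invariant conull set. Discarding whole orbits keeps \<open>T\<close> equivariant.\<close>
  define Z where "Z = {x \<in> space W. \<forall>h\<in>?K. a h x \<notin> N}"
  have vim: "{x \<in> space W. a h x \<in> N} \<in> sets W" if "h \<in> ?K" for h
    using measurable_sets[OF act(4)[OF that] N(3)] by (simp add: vimage_def Int_def conj_commute)
  have "space W - Z = (\<Union>h\<in>?K. {x \<in> space W. a h x \<in> N})" by (auto simp: Z_def)
  moreover have "(\<Union>h\<in>?K. {x \<in> space W. a h x \<in> N}) \<in> null_sets W"
  proof (rule null_sets_UN'[OF cG])
    fix h assume h: "h \<in> ?K"
    have "measure W {x \<in> space W. a h x \<in> N} = 0"
      using pmp_measure_vimage[OF pmp h N(3)] N(2) by (simp add: measure_def)
    then show "{x \<in> space W. a h x \<in> N} \<in> null_sets W"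
      using vim[OF h] by (simp add: null_sets_def W.emeasure_eq_measure)
  qed
  ultimately have nullZ: "space W - Z \<in> null_sets W" by simp
  have Zsub: "Z \<subseteq> space W" by (auto simp: Z_def)
  then have "Z = space W - (space W - Z)" by auto
  then have Z: "Z \<in> sets W" using nullZ by (metis null_setsD2 sets.compl_sets)
  have Z_inv: "a g x \<in> Z \<longleftrightarrow> x \<in> Z" if g: "g \<in> ?K" and x: "x \<in> space W" for g x
  proof -
    have 1: "a h (a g x) = a (h \<otimes>\<^bsub>G\<^esub> g) x" if "h \<in> ?K" for h using that g x act(8) by simp
    have 2: "a h x = a (h \<otimes>\<^bsub>G\<^esub> inv\<^bsub>G\<^esub> g) (a g x)" if "h \<in> ?K" for h
      using that g x by (simp add: act(8)[symmetric] m_assoc)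
    show ?thesis
    proof
      assume "a g x \<in> Z"
      then have "a h x \<notin> N" if "h \<in> ?K" for h
        unfolding 2[OF that] using that g by (simp add: Z_def)
      then show "x \<in> Z" using x by (simp add: Z_def)
    next
      assume "x \<in> Z"
      then have "a h (a g x) \<notin> N" if "h \<in> ?K" for h
        unfolding 1[OF that] using that g by (simp add: Z_def)
      then show "a g x \<in> Z" using act(6)[OF g x] by (simp add: Z_def)
    qed
  qed
  have inj: "inj_on (\<lambda>u. a u x) ?K" if x: "x \<in> Z" for x
  proof (rule inj_onI)
    fix u v assume uv: "u \<in> ?K" "v \<in> ?K" "a u x = a v x"
    have xs: "x \<in> space W" using x Zsub by auto
    have "a (inv\<^bsub>G\<^esub> u \<otimes>\<^bsub>G\<^esub> v) x = a (inv\<^bsub>G\<^esub> u) (a u x)" using uv xs by (simp add: act(8))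
    also have "\<dots> = a (inv\<^bsub>G\<^esub> u \<otimes>\<^bsub>G\<^esub> u) x" using uv xs by (intro act(8)[symmetric]) auto
    also have "\<dots> = x" using uv xs by (simp add: act(7))
    finally have fx: "a (inv\<^bsub>G\<^esub> u \<otimes>\<^bsub>G\<^esub> v) x = x" .
    have "x \<notin> N" using x act(7)[OF xs] unfolding Z_def by force
    then have "\<forall>g\<in>?K - {\<one>\<^bsub>G\<^esub>}. a g x \<noteq> x" using N(1) xs by blast
    then have "inv\<^bsub>G\<^esub> u \<otimes>\<^bsub>G\<^esub> v = \<one>\<^bsub>G\<^esub>" using fx uv by auto
    then show "u = v" using uv by (metis inv_closed inv_inv inv_equality)
  qed
  define T where "T x = (if x \<in> Z then {(u, v) \<in> ?K \<times> ?K. (a u x, a v x) \<in> \<G>} else {})" for x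
  have T_sub: "T x \<subseteq> ?K \<times> ?K" for x by (auto simp: T_def)
  have T_forest: "forest (T x)" for x
  proof (cases "x \<in> Z")
    case True
    show ?thesis by (rule forest_vimage[OF forest inj[OF True] T_sub]) (use True in \<open>auto simp: T_def\<close>)
  qed (simp add: T_def forest_def)
  have orb: "(a u x, a v x) \<in> orbit_rel G W a" if "u \<in> ?K" "v \<in> ?K" "x \<in> space W" for u v x
  proof -
    have "a v x = a (v \<otimes>\<^bsub>G\<^esub> inv\<^bsub>G\<^esub> u) (a u x)" using that by (simp add: act(8)[symmetric] m_assoc)
    then show ?thesis using that act(6) by (auto simp: orbit_rel_def orbit_def)
  qed
  \<comment> \<open>\<open>\<G>\<close> is measurable only relative to the orbit relation. The pairs
    \<open>(a u x, a v x)\<close> always lie in that relation, so a measurable \<open>B\<close> that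
    cuts out \<open>\<G>\<close> there has the same preimages.\<close>
  obtain B where B: "B \<in> sets (W \<Otimes>\<^sub>M W)" "\<G> = orbit_rel G W a \<inter> B"
    using \<G>(2) by (auto simp: sets_restrict_space)
  have T_sets: "{x \<in> space W. (u, v) \<in> T x} \<in> sets W" if uv: "u \<in> ?K" "v \<in> ?K" for u v
  proof -
    have "(\<lambda>x. (a u x, a v x)) -` B \<inter> space W \<in> sets W"
      by (rule measurable_sets[OF measurable_Pair[OF act(4) act(4)] B(1)]) (use uv in auto)
    then have "Z \<inter> ((\<lambda>x. (a u x, a v x)) -` B \<inter> space W) \<in> sets W" using Z by (rule sets.Int[rotated])
    also have "Z \<inter> ((\<lambda>x. (a u x, a v x)) -` B \<inter> space W) = {x \<in> space W. (u, v) \<in> T x}"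
      using uv orb B(2) by (auto simp: T_def)
    finally show ?thesis .
  qed
  have T_equiv: "(u, v) \<in> T (a g x) \<longleftrightarrow> (u \<otimes>\<^bsub>G\<^esub> g, v \<otimes>\<^bsub>G\<^esub> g) \<in> T x"
    if "g \<in> ?K" "u \<in> ?K" "v \<in> ?K" "x \<in> space W" for g u v x
    using that Z_inv by (simp add: T_def act(8))
  \<comment> \<open>A path of \<open>\<G>\<close> from \<open>a h x\<close> stays in the orbit and
    lifts step by step to a path of \<open>T x\<close>; injectivity of the orbit map identifies its
    endpoint as \<open>k\<close>.\<close>
  have T_linked: "linked (T x) h k"
    if x: "x \<in> Z" and hk: "h \<in> ?K" "k \<in> ?K" and c: "(a h x, a k x) \<in> component_rel (space W) \<G>" for x h k
  proof -
    have xs: "x \<in> space W" using x Zsub by auto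
    have "\<exists>m\<in>?K. y = a m x \<and> linked (T x) h m" if "(a h x, y) \<in> (\<G> \<union> \<G>\<inverse>)\<^sup>*" for y
      using that
    proof (induction rule: rtrancl_induct)
      case base
      show ?case using hk(1) by (intro bexI[of _ h]) auto
    next
      case (step y z)
      then obtain m where y: "y = a m x" "m \<in> ?K" "linked (T x) h m" by auto
      have "\<exists>g\<in>?K. z = a g y"
      proof (cases "(y, z) \<in> \<G>")
        case True
        then show ?thesis using \<G>(1) by (auto simp: orbit_rel_def orbit_def)
      next
        case False
        then have "(z, y) \<in> orbit_rel G W a" using step.hyps(2) \<G>(1) by auto
        then obtain g where g: "g \<in> ?K" "y = a g z" "z \<in> space W" by (auto simp: orbit_rel_def orbit_def)
        then have "z = a (inv\<^bsub>G\<^esub> g) y" by (simp add: act(8)[symmetric] act(7))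
        then show ?thesis using g by auto
      qed
      then obtain g where g: "g \<in> ?K" "z = a (g \<otimes>\<^bsub>G\<^esub> m) x" using y xs by (auto simp: act(8))
      then have "(m, g \<otimes>\<^bsub>G\<^esub> m) \<in> T x \<or> (g \<otimes>\<^bsub>G\<^esub> m, m) \<in> T x"
        using step.hyps(2) y x by (auto simp: T_def)
      then have "linked (T x) m (g \<otimes>\<^bsub>G\<^esub> m)"
        by (elim disjE) (rule linked_edge, assumption, rule linked_sym, rule linked_edge)
      with y(3) have "linked (T x) h (g \<otimes>\<^bsub>G\<^esub> m)" by (rule linked_trans)
      then show ?case using g y(2) by (intro bexI[of _ "g \<otimes>\<^bsub>G\<^esub> m"]) auto
    qed
    moreover have "(a h x, a k x) \<in> (\<G> \<union> \<G>\<inverse>)\<^sup>*" using c by (auto simp: component_rel_def)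
    ultimately obtain m where "m \<in> ?K" "a k x = a m x" "linked (T x) h m" by blast
    then show ?thesis using inj_onD[OF inj[OF x]] hk by metis
  qed
  define F where "F n = H \<union> {k \<in> ?K. to_nat_on ?K k \<le> n}" for n
  have "finite {k \<in> ?K. to_nat_on ?K k \<le> n}" for n
    by (rule inj_on_finite[of "to_nat_on ?K" _ "{..n}"])
       (use inj_on_to_nat_on[OF cG] in \<open>auto intro: inj_on_subset\<close>)
  then have F: "finite (F n)" "F n \<subseteq> ?K" "H \<subseteq> F n" for n using H by (auto simp: F_def)
  define D where "D n = {x \<in> space W. \<forall>h\<in>H. \<forall>k\<in>H. linked (T x \<inter> F n \<times> F n) h k}" for n
  have D: "D n \<in> sets W" for n
  proof -
    let ?P = "F n \<times> F n"
    have "{x \<in> space W. e \<in> T x \<longleftrightarrow> e \<in> E} \<in> sets W" if "e \<in> ?P" for e E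
    proof -
      have "fst e \<in> ?K" "snd e \<in> ?K" using that F(2)[of n] by auto
      then have s: "{x \<in> space W. e \<in> T x} \<in> sets W" using T_sets[of "fst e" "snd e"] by simp
      then show ?thesis
      proof (cases "e \<in> E")
        case False
        have "{x \<in> space W. e \<in> T x \<longleftrightarrow> e \<in> E} = space W - {x \<in> space W. e \<in> T x}" using False by auto
        then show ?thesis using s by simp
      qed simp
    qed
    then have "{x \<in> space W. \<forall>e\<in>?P. e \<in> T x \<longleftrightarrow> e \<in> E} \<in> sets W" for E
      using F(1) by (intro sets.sets_Collect_finite_All) auto
    \<comment> \<open>Membership in \<open>D n\<close> depends only on the trace of
      \<open>T x\<close> on the finite square, so \<open>D n\<close> is a finite union over the
      possible traces.\<close>
    then have "(\<Union>E\<in>{E \<in> Pow ?P. \<forall>h\<in>H. \<forall>k\<in>H. linked E h k}. {x \<in> space W. \<forall>e\<in>?P. e \<in> T x \<longleftrightarrow> e \<in> E}) \<in> sets W"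
      using F(1)[of n] by (intro sets.finite_UN) auto
    also have "(\<Union>E\<in>{E \<in> Pow ?P. \<forall>h\<in>H. \<forall>k\<in>H. linked E h k}. {x \<in> space W. \<forall>e\<in>?P. e \<in> T x \<longleftrightarrow> e \<in> E}) = D n"
      (is "?L = _")
    proof
      show "?L \<subseteq> D n"
      proof
        fix x assume "x \<in> ?L"
        then obtain E where E: "E \<subseteq> ?P" "\<forall>h\<in>H. \<forall>k\<in>H. linked E h k" "x \<in> space W" "\<forall>e\<in>?P. e \<in> T x \<longleftrightarrow> e \<in> E"
          by blast
        then have "T x \<inter> ?P = E" by blast
        then show "x \<in> D n" using E by (simp add: D_def)
      qed
      show "D n \<subseteq> ?L"
      proof
        fix x assume x: "x \<in> D n"
        show "x \<in> ?L"
          by (rule UN_I[of "T x \<inter> ?P"]) (use x in \<open>auto simp: D_def\<close>)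
      qed
    qed
    finally show ?thesis .
  qed
  have "D m \<subseteq> D n" if "m \<le> n" for m n
  proof -
    have "F m \<subseteq> F n" using that by (auto simp: F_def)
    then have "T x \<inter> F m \<times> F m \<subseteq> T x \<inter> F n \<times> F n" for x by blast
    then have "linked (T x \<inter> F n \<times> F n) h k" if "linked (T x \<inter> F m \<times> F m) h k" for x h k
      using that by (rule linked_mono[rotated])
    then show ?thesis unfolding D_def by auto
  qed
  then have "incseq D" by (simp add: incseq_def)
  then have lim: "(\<lambda>n. measure W (D n)) \<longlonglongrightarrow> measure W (\<Union>n. D n)"
    using D by (intro W.finite_Lim_measure_incseq) auto
  let ?C = "{x \<in> space W. \<forall>h\<in>H. \<forall>k\<in>H. (a h x, a k x) \<in> component_rel (space W) \<G>}"
  have C: "?C \<in> sets W"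
  proof (rule ccontr)
    assume "?C \<notin> sets W"
    then have "measure W ?C = 0" by (rule measure_notin_sets)
    then show False using big by (simp add: \<epsilon>'_def)
  qed
  have "Z \<inter> ?C \<subseteq> (\<Union>n. D n)"
  proof
    fix x assume x: "x \<in> Z \<inter> ?C"
    obtain E where E: "E \<subseteq> T x" "finite E" "\<forall>h\<in>H. \<forall>k\<in>H. linked (T x) h k \<longrightarrow> linked E h k"
      using linked_finite_skeleton[OF H(1)] by blast
    define n where "n = Max (insert 0 (to_nat_on ?K ` (fst ` E \<union> snd ` E)))"
    have "E \<subseteq> F n \<times> F n"
    proof
      fix e assume eE: "e \<in> E"
      then have "fst e \<in> ?K" "snd e \<in> ?K" using E(1) T_sub[of x] by auto
      moreover have "to_nat_on ?K (fst e) \<le> n" "to_nat_on ?K (snd e) \<le> n"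
        unfolding n_def using eE E(2) by (auto intro!: Max_ge)
      ultimately show "e \<in> F n \<times> F n" by (cases e) (auto simp: F_def)
    qed
    moreover have "linked (T x) h k" if "h \<in> H" "k \<in> H" for h k
      by (rule T_linked) (use x that H(2) in auto)
    ultimately have "linked (T x \<inter> F n \<times> F n) h k" if "h \<in> H" "k \<in> H" for h k
      using E(1,3) that by (meson le_inf_iff linked_mono)
    then show "x \<in> (\<Union>n. D n)" using x by (auto simp: D_def)
  qed
  have "1 - \<epsilon> \<le> 1 - \<epsilon>'" by (simp add: \<epsilon>'_def)
  also have "\<dots> < measure W ?C" by (rule big)
  also have "\<dots> = measure W (Z \<inter> ?C)"
  proof (rule W.finite_measure_eq_AE)
    have "AE x in W. x \<in> Z" by (rule AE_I[OF _ _ null_setsD2[OF nullZ]]) (use nullZ in auto)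
    then show "AE x in W. x \<in> ?C \<longleftrightarrow> x \<in> Z \<inter> ?C" by eventually_elim auto
  qed (use C Z in auto)
  also have "\<dots> \<le> measure W (\<Union>n. D n)"
    using \<open>Z \<inter> ?C \<subseteq> (\<Union>n. D n)\<close> D by (intro W.finite_measure_mono) auto
  finally have "eventually (\<lambda>n. 1 - \<epsilon> < measure W (D n)) sequentially"
    using lim by (rule order_tendstoD(1)[rotated])
  then obtain n where n: "1 - \<epsilon> < measure W (D n)" unfolding eventually_sequentially by blast
  show thesis
    by (rule that[OF pmp T_sub T_forest T_sets T_equiv F[of n] D n]) (simp_all add: D_def)
qed

section \<open>Discretised conditional distributions\<close>

text \<open>The level sets of the rounded Radon-Nikodym densities of \<open>\<alpha> = a\<close> over \<open>X\<close>, together with \<open>\<beta>\<close>.\<close>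

lemma conditional_partition:
  fixes \<alpha> :: "'y \<Rightarrow> 'l" and \<beta> :: "'x \<Rightarrow> nat" and n :: nat
  assumes Y: "prob_space Y" and \<phi>: "\<phi> \<in> measurable Y X" and dphi: "distr Y X \<phi> = X"
    and A: "finite A" and \<alpha>: "\<And>a. a \<in> A \<Longrightarrow> {y \<in> space Y. \<alpha> y = a} \<in> sets Y"
    and \<beta>: "\<beta> \<in> measurable X (count_space {..<q})" and n: "0 < n"
  obtains r :: nat and \<gamma> :: "'x \<Rightarrow> nat" and t :: "nat \<Rightarrow> nat" and \<zeta> :: "nat \<Rightarrow> 'l \<Rightarrow> real"
  where "\<gamma> \<in> measurable X (count_space {..<r})" "\<And>x. x \<in> space X \<Longrightarrow> t (\<gamma> x) = \<beta> x"
    "\<And>a j B. a \<in> A \<Longrightarrow> B \<in> sets X \<Longrightarrow> B \<subseteq> {x \<in> space X. \<gamma> x = j} \<Longrightarrow>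
      \<bar>measure Y {y \<in> space Y. \<alpha> y = a \<and> \<phi> y \<in> B} - \<zeta> j a * measure X B\<bar> \<le> measure X B / n"
proof -
  interpret Y: prob_space Y by fact
  interpret X: prob_space X using Y.prob_space_distr[OF \<phi>] dphi by simp
  define S where "S a B = {y \<in> space Y. \<alpha> y = a \<and> \<phi> y \<in> B}" for a B
  have S_eq: "S a B = {y \<in> space Y. \<alpha> y = a} \<inter> (\<phi> -` B \<inter> space Y)" for a B by (auto simp: S_def)
  have S: "S a B \<in> sets Y" if "a \<in> A" "B \<in> sets X" for a B
    unfolding S_eq using \<alpha> that measurable_sets[OF \<phi>] by blast
  have S_le: "measure Y (S a B) \<le> measure X B" if "B \<in> sets X" for a B
  proof -
    have "measure Y (S a B) \<le> measure Y (\<phi> -` B \<inter> space Y)"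
      unfolding S_eq using measurable_sets[OF \<phi> that] by (intro Y.finite_measure_mono) auto
    also have "\<dots> = measure (distr Y X \<phi>) B" by (rule measure_distr[OF \<phi> that, symmetric])
    finally show ?thesis by (simp add: dphi)
  qed
  have "\<exists>f\<in>borel_measurable X. \<forall>B\<in>sets X. emeasure Y (S a B) = (\<integral>\<^sup>+x. f x * indicator B x \<partial>X)" if a: "a \<in> A" for a
  proof -
    define M where "M = distr (restrict_space Y {y \<in> space Y. \<alpha> y = a}) X \<phi>"
    have sM: "sets M = sets X" by (simp add: M_def)
    have eM: "emeasure M B = emeasure Y (S a B)" if B: "B \<in> sets X" for B
    proof -
      have "\<phi> \<in> measurable (restrict_space Y {y \<in> space Y. \<alpha> y = a}) X"
        using \<phi> by (rule measurable_restrict_space1)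
      then have "emeasure M B = emeasure (restrict_space Y {y \<in> space Y. \<alpha> y = a})
          (\<phi> -` B \<inter> space (restrict_space Y {y \<in> space Y. \<alpha> y = a}))"
        unfolding M_def using B by (rule emeasure_distr)
      also have "\<phi> -` B \<inter> space (restrict_space Y {y \<in> space Y. \<alpha> y = a}) = S a B"
        by (auto simp: S_def space_restrict_space)
      also have "emeasure (restrict_space Y {y \<in> space Y. \<alpha> y = a}) (S a B) = emeasure Y (S a B)"
        using \<alpha>[OF a] by (intro emeasure_restrict_space) (auto simp: S_def)
      finally show ?thesis .
    qed
    have "finite_measure M"
    proof
      show "emeasure M (space M) \<noteq> \<infinity>"
        using eM[of "space X"] sets_eq_imp_space_eq[OF sM] by simp
    qed
    moreover have "absolutely_continuous X M"
      unfolding absolutely_continuous_def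
    proof
      fix B assume B: "B \<in> null_sets X"
      then have "measure X B = 0" by (simp add: measure_eq_0_null_sets)
      moreover have "B \<in> sets X" using B by auto
      ultimately have "measure Y (S a B) = 0" using S_le[of B a] measure_nonneg[of Y "S a B"] by linarith
      then show "B \<in> null_sets M" using B eM[of B] by (auto simp: null_sets_def sM Y.emeasure_eq_measure)
    qed
    ultimately obtain f where f: "f \<in> borel_measurable X" "density X f = M"
      using X.Radon_Nikodym_finite_measure sM by blast
    have "emeasure Y (S a B) = (\<integral>\<^sup>+x. f x * indicator B x \<partial>X)" if B: "B \<in> sets X" for B
      using emeasure_density[OF f(1) B] eM[OF B] f(2) by simp
    then show ?thesis using f(1) by blast
  qed
  then obtain f where f: "\<And>a. a \<in> A \<Longrightarrow> f a \<in> borel_measurable X"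
    "\<And>a B. a \<in> A \<Longrightarrow> B \<in> sets X \<Longrightarrow> emeasure Y (S a B) = (\<integral>\<^sup>+x. f a x * indicator B x \<partial>X)"
    by metis
  \<comment> \<open>The densities are at most one only almost everywhere; values of one or more,
    infinite ones included, are put into the top level \<open>n\<close>.\<close>
  define lev where "lev a x = (if 1 \<le> f a x then n else nat \<lfloor>n * enn2real (f a x)\<rfloor>)" for a x
  have lev_le: "lev a x \<le> n" for a x
  proof (cases "1 \<le> f a x")
    case False
    then have "enn2real (f a x) \<le> 1" by (intro enn2real_leI) auto
    then have "n * enn2real (f a x) \<le> n" by (simp add: mult_left_le)
    then have "\<lfloor>n * enn2real (f a x)\<rfloor> \<le> int n" by linarith
    then show ?thesis using False by (simp add: lev_def)
  qed (simp add: lev_def)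
  define C where "C = {..<q} \<times> (A \<rightarrow>\<^sub>E {..n})"
  have finC: "finite C" unfolding C_def using A by (intro finite_cartesian_product finite_PiE) auto
  then obtain e where e: "bij_betw e C {..<card C}" using ex_bij_betw_finite_nat atLeast0LessThan by metis
  define vec where "vec x = (\<beta> x, \<lambda>a\<in>A. lev a x)" for x
  define \<gamma> where "\<gamma> x = e (vec x)" for x
  define d where "d = the_inv_into C e"
  have vec: "vec x \<in> C" if "x \<in> space X" for x
    using measurable_space[OF \<beta> that] lev_le by (auto simp: vec_def C_def)
  have d: "d (\<gamma> x) = vec x" if "x \<in> space X" for x
    unfolding d_def \<gamma>_def using e vec[OF that] by (simp add: bij_betw_def the_inv_into_f_f)
  have level: "{x \<in> space X. vec x = c} \<in> sets X" if c: "c \<in> C" for c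
  proof -
    have lm: "lev a \<in> measurable X (count_space UNIV)" if "a \<in> A" for a
      unfolding lev_def[abs_def] using f(1)[OF that] by measurable
    then have "{x \<in> space X. lev a x = k} \<in> sets X" if "a \<in> A" for a k
      using that by (intro count_space_vimage_sets)
    then have "{x \<in> space X. \<forall>a\<in>A. lev a x = snd c a} \<inter> {x \<in> space X. \<beta> x = fst c} \<in> sets X"
      using A by (intro sets.Int sets.sets_Collect_finite_All count_space_vimage_sets[OF \<beta>])
    also have "{x \<in> space X. \<forall>a\<in>A. lev a x = snd c a} \<inter> {x \<in> space X. \<beta> x = fst c} = {x \<in> space X. vec x = c}"
    proof -
      have "snd c \<in> A \<rightarrow>\<^sub>E {..n}" using c by (auto simp: C_def)
      then have "(\<lambda>a\<in>A. lev a x) = snd c \<longleftrightarrow> (\<forall>a\<in>A. lev a x = snd c a)" for x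
        by (auto simp: fun_eq_iff PiE_iff extensional_def)
      then show ?thesis by (auto simp: vec_def prod_eq_iff)
    qed
    finally show ?thesis .
  qed
  have \<gamma>_meas: "\<gamma> \<in> measurable X (count_space {..<card C})"
  proof (rule measurable_count_space_eq2[THEN iffD2], simp, intro conjI ballI)
    show "\<gamma> \<in> space X \<rightarrow> {..<card C}" using vec e by (auto simp: \<gamma>_def bij_betw_def)
    fix j assume "j \<in> {..<card C}"
    then have "j \<in> e ` C" by (simp only: bij_betw_imp_surj_on[OF e])
    then obtain c where c: "c \<in> C" "j = e c" by blast
    have "\<gamma> x = j \<longleftrightarrow> vec x = c" if "x \<in> space X" for x
      unfolding \<gamma>_def c(2) using inj_on_eq_iff[OF bij_betw_imp_inj_on[OF e] vec[OF that] c(1)] .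
    then have "\<gamma> -` {j} \<inter> space X = {x \<in> space X. vec x = c}" by auto
    then show "\<gamma> -` {j} \<inter> space X \<in> sets X" using level[OF c(1)] by simp
  qed
  show thesis
  proof (rule that[of \<gamma> "card C" "\<lambda>j. fst (d j)" "\<lambda>j a. snd (d j) a / n"])
    show "\<gamma> \<in> measurable X (count_space {..<card C})" by (rule \<gamma>_meas)
    show "fst (d (\<gamma> x)) = \<beta> x" if "x \<in> space X" for x using d[OF that] by (simp add: vec_def)
    \<comment> \<open>The estimate is wanted for every measurable part \<open>B\<close> of a colour
      class, not only for the whole class: later \<open>B\<close> also prescribes the colour of a
      translate.\<close>
    fix a j B assume a: "a \<in> A" and B: "B \<in> sets X" "B \<subseteq> {x \<in> space X. \<gamma> x = j}"
    define k where "k = snd (d j) a"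
    have k: "lev a x = k" if "x \<in> B" for x
    proof -
      have "x \<in> space X" "\<gamma> x = j" using B(2) that by auto
      then show ?thesis using d[of x] a by (auto simp: k_def vec_def)
    qed
    have lower: "ennreal (k / n) \<le> f a x" if "x \<in> B" for x
    proof (cases "1 \<le> f a x")
      case True
      then show ?thesis using k[OF that] n by (simp add: lev_def)
    next
      case False
      then have fin: "f a x < Orderings.top" by (metis ennreal_one_less_top less_trans not_le)
      have "k = nat \<lfloor>n * enn2real (f a x)\<rfloor>" using k[OF that] False by (simp add: lev_def)
      then have "real k \<le> n * enn2real (f a x)" by (simp add: of_nat_nat)
      then have "k / n \<le> enn2real (f a x)" using n by (simp add: field_simps)
      then have "ennreal (k / n) \<le> ennreal (enn2real (f a x))" by (rule ennreal_leI)
      then show ?thesis using fin by simp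
    qed
    have eS: "measure Y (S a B) = enn2real (\<integral>\<^sup>+x. f a x * indicator B x \<partial>X)"
      using f(2)[OF a B(1)] by (simp add: measure_def)
    have "ennreal (k / n) * emeasure X B = (\<integral>\<^sup>+x. ennreal (k / n) * indicator B x \<partial>X)"
      by (rule nn_integral_cmult_indicator[OF B(1), symmetric])
    also have "\<dots> \<le> (\<integral>\<^sup>+x. f a x * indicator B x \<partial>X)"
      using lower by (intro nn_integral_mono) (auto simp: indicator_def)
    also have "\<dots> = ennreal (measure Y (S a B))"
      using f(2)[OF a B(1)] by (simp add: Y.emeasure_eq_measure)
    finally have low: "k / n * measure X B \<le> measure Y (S a B)"
      by (simp add: X.emeasure_eq_measure ennreal_mult'[symmetric])
    have up: "measure Y (S a B) \<le> k / n * measure X B + measure X B / n"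
    \<comment> \<open>In the top level there is no pointwise upper bound on the density; the
      domination \<open>S_le\<close> replaces it.\<close>
    proof (cases "k = n")
      case True
      then show ?thesis using S_le[OF B(1), of a] n by (simp add: add_increasing2)
    next
      case False
      have "f a x \<le> ennreal ((k + 1) / n)" if "x \<in> B" for x
      proof -
        have lt: "\<not> 1 \<le> f a x" using k[OF that] False by (auto simp: lev_def)
        then have fin: "f a x < Orderings.top" by (metis ennreal_one_less_top less_trans not_le)
        have "k = nat \<lfloor>n * enn2real (f a x)\<rfloor>" using k[OF that] lt by (simp add: lev_def)
        then have "n * enn2real (f a x) \<le> k + 1" by linarith
        then have "enn2real (f a x) \<le> (k + 1) / n" using n by (simp add: field_simps)
        then have "ennreal (enn2real (f a x)) \<le> ennreal ((k + 1) / n)" by (rule ennreal_leI)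
        then show ?thesis using fin by simp
      qed
      then have "(\<integral>\<^sup>+x. f a x * indicator B x \<partial>X) \<le> (\<integral>\<^sup>+x. ennreal ((k + 1) / n) * indicator B x \<partial>X)"
        by (intro nn_integral_mono) (auto simp: indicator_def)
      also have "\<dots> = ennreal ((k + 1) / n) * emeasure X B"
        by (rule nn_integral_cmult_indicator[OF B(1)])
      also have "\<dots> = ennreal ((k + 1) / n * measure X B)"
        unfolding X.emeasure_eq_measure by (rule ennreal_mult[symmetric]) auto
      finally have "measure Y (S a B) \<le> (k + 1) / n * measure X B"
        unfolding eS by (intro enn2real_leI) auto
      then show ?thesis by (simp add: add_divide_distrib distrib_right)
    qed
    show "\<bar>measure Y {y \<in> space Y. \<alpha> y = a \<and> \<phi> y \<in> B} - snd (d j) a / n * measure X B\<bar> \<le> measure X B / n"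
      using low up by (simp add: S_def k_def abs_le_iff)
  qed
qed

section \<open>Transferring extensions\<close>

text \<open>The enriched colouring: \<open>\<alpha>'\<close> codes the whole pattern of
  \<open>\<alpha>\<close> along \<open>J\<close> as one real label, and \<open>obs f\<close> reads
  off the entry at \<open>f\<close>.\<close>

lemma finite_observables:
  fixes \<alpha> :: "'y \<Rightarrow> nat"
  assumes Y: "pmp_action G Y b" and J: "finite J" "J \<subseteq> carrier G"
    and \<alpha>: "\<alpha> \<in> measurable Y (count_space {..<p})"
  obtains A :: "real set" and \<alpha>' :: "'y \<Rightarrow> real" and obs :: "'g \<Rightarrow> real \<Rightarrow> nat"
  where "finite A" "\<And>y. y \<in> space Y \<Longrightarrow> \<alpha>' y \<in> A"
    "\<And>a f. a \<in> A \<Longrightarrow> f \<in> J \<Longrightarrow> obs f a < p"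
    "\<And>y f. y \<in> space Y \<Longrightarrow> f \<in> J \<Longrightarrow> obs f (\<alpha>' y) = \<alpha> (b f y)"
    "\<And>a. {y \<in> space Y. \<alpha>' y = a} \<in> sets Y"
proof -
  let ?P = "J \<rightarrow>\<^sub>E {..<p}"
  have "finite ?P" using J(1) by (simp add: finite_PiE)
  then obtain e where e: "bij_betw e ?P {..<card ?P}" using ex_bij_betw_finite_nat atLeast0LessThan by metis
  have inj: "inj_on e ?P" using e by (rule bij_betw_imp_inj_on)
  define pat where "pat y = (\<lambda>f\<in>J. \<alpha> (b f y))" for y
  define \<alpha>' where "\<alpha>' y = real (e (pat y))" for y
  define obs where "obs f a = the_inv_into ?P e (nat \<lfloor>a\<rfloor>) f" for f and a :: real
  have pat: "pat y \<in> ?P" if "y \<in> space Y" for y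
    using measurable_space[OF \<alpha>] pmp_actionD(6)[OF Y] that J(2) by (auto simp: pat_def)
  have bf: "(\<lambda>y. \<alpha> (b f y)) \<in> measurable Y (count_space {..<p})" if "f \<in> J" for f
    using that J(2) by (intro measurable_compose[OF pmp_actionD(4)[OF Y] \<alpha>]) auto
  have level: "{y \<in> space Y. pat y = c} \<in> sets Y" if c: "c \<in> ?P" for c
  proof -
    have "{y \<in> space Y. pat y = c} = {y \<in> space Y. \<forall>f\<in>J. \<alpha> (b f y) = c f}"
      using c by (auto simp: pat_def fun_eq_iff PiE_iff extensional_def)
    also have "\<dots> \<in> sets Y" using J(1) bf by (intro sets.sets_Collect_finite_All count_space_vimage_sets)
    finally show ?thesis .
  qed
  have sets: "{y \<in> space Y. \<alpha>' y = a} \<in> sets Y" for a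
  proof -
    have "{y \<in> space Y. \<alpha>' y = a} = (\<Union>c\<in>{c \<in> ?P. real (e c) = a}. {y \<in> space Y. pat y = c})"
      using pat by (auto simp: \<alpha>'_def)
    also have "\<dots> \<in> sets Y" using \<open>finite ?P\<close> level by (intro sets.finite_UN) auto
    finally show ?thesis .
  qed
  have obs_e: "obs f (real (e c)) = c f" if "c \<in> ?P" for c f
    using that by (simp add: obs_def the_inv_into_f_f[OF inj])
  show thesis
  proof (rule that[of "real ` e ` ?P" \<alpha>' obs])
    show "finite (real ` e ` ?P)" using \<open>finite ?P\<close> by simp
    show "\<alpha>' y \<in> real ` e ` ?P" if "y \<in> space Y" for y using pat[OF that] by (simp add: \<alpha>'_def)
    show "obs f a < p" if a: "a \<in> real ` e ` ?P" and "f \<in> J" for a f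
    proof -
      obtain c where c: "c \<in> ?P" "a = real (e c)" using a by auto
      have "c f \<in> {..<p}" using c(1) \<open>f \<in> J\<close> by (rule PiE_mem)
      then show ?thesis using obs_e[OF c(1)] c(2) by simp
    qed
    show "obs f (\<alpha>' y) = \<alpha> (b f y)" if "y \<in> space Y" "f \<in> J" for y f
      using obs_e[OF pat[OF that(1)]] that(2) by (simp add: \<alpha>'_def pat_def)
  qed (rule sets)
qed

text \<open>The densities \<open>dens g j k\<close> describe the joint law of \<open>\<alpha> y\<close> and \<open>\<alpha> (g y)\<close> given the colours
  \<open>j\<close> and \<open>k\<close> of the images of \<open>y\<close> and \<open>g y\<close>, corrected to have the marginals \<open>law j\<close> and \<open>law k\<close>.\<close>

lemma transition_densities:
  fixes \<alpha> :: "'y \<Rightarrow> real" and \<beta> :: "'x \<Rightarrow> nat" and n :: nat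
  assumes pY: "pmp_action G Y b" and pX: "pmp_action G X act" and fm: "factor_map G Y b X act \<phi>"
    and A: "finite A" and \<alpha>A: "\<And>y. y \<in> space Y \<Longrightarrow> \<alpha> y \<in> A"
    and \<alpha>: "\<And>a. {y \<in> space Y. \<alpha> y = a} \<in> sets Y"
    and \<beta>: "\<beta> \<in> measurable X (count_space {..<q})" and n: "0 < n"
  obtains r :: nat and \<gamma> :: "'x \<Rightarrow> nat" and t :: "nat \<Rightarrow> nat" and law :: "nat \<Rightarrow> real \<Rightarrow> real"
    and dens :: "'g \<Rightarrow> nat \<Rightarrow> nat \<Rightarrow> real \<Rightarrow> real \<Rightarrow> real"
  where "\<gamma> \<in> measurable X (count_space {..<r})" "\<And>x. x \<in> space X \<Longrightarrow> t (\<gamma> x) = \<beta> x"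
    "\<And>j a. 0 \<le> law j a" "\<And>j. (\<Sum>a\<in>A. law j a) = 1" "\<And>g j k a c. 0 \<le> dens g j k a c"
    "\<And>g j k a. a \<in> A \<Longrightarrow> law j a \<noteq> 0 \<Longrightarrow> (\<Sum>c\<in>A. law k c * dens g j k a c) = 1"
    "\<And>g j k c. c \<in> A \<Longrightarrow> law k c \<noteq> 0 \<Longrightarrow> (\<Sum>a\<in>A. law j a * dens g j k a c) = 1"
    "\<And>j a. a \<in> A \<Longrightarrow> measure X {x \<in> space X. \<gamma> x = j} * law j a =
      measure Y {y \<in> space Y. \<alpha> y = a \<and> \<gamma> (\<phi> y) = j}"
    "\<And>g j k P. g \<in> carrier G \<Longrightarrow> P \<subseteq> A \<times> A \<Longrightarrow> (\<And>y. y \<in> space Y \<Longrightarrow> (\<alpha> y, \<alpha> (b g y)) \<notin> P) \<Longrightarrow>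
      measure X {x \<in> space X. \<gamma> x = j \<and> \<gamma> (act g x) = k} > 0 \<Longrightarrow>
      (\<Sum>(a, c)\<in>P. law j a * law k c * dens g j k a c) \<le> 4 * card A / n"
proof -
  interpret Y: prob_space Y by (rule pmp_actionD(1)[OF pY])
  interpret X: prob_space X by (rule pmp_actionD(1)[OF pX])
  interpret group G by (rule pmp_actionD(3)[OF pX])
  have \<phi>: "\<phi> \<in> measurable Y X" "distr Y X \<phi> = X"
    and eqv: "\<And>g y. g \<in> carrier G \<Longrightarrow> y \<in> space Y \<Longrightarrow> \<phi> (b g y) = act g (\<phi> y)"
    using fm by (auto simp: factor_map_def)
  obtain r :: nat and \<gamma> :: "'x \<Rightarrow> nat" and t :: "nat \<Rightarrow> nat" and \<zeta> :: "nat \<Rightarrow> real \<Rightarrow> real"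
    where \<gamma>: "\<gamma> \<in> measurable X (count_space {..<r})" and t: "\<And>x. x \<in> space X \<Longrightarrow> t (\<gamma> x) = \<beta> x"
    and \<zeta>: "\<And>a j B. a \<in> A \<Longrightarrow> B \<in> sets X \<Longrightarrow> B \<subseteq> {x \<in> space X. \<gamma> x = j} \<Longrightarrow>
      \<bar>measure Y {y \<in> space Y. \<alpha> y = a \<and> \<phi> y \<in> B} - \<zeta> j a * measure X B\<bar> \<le> measure X B / n"
    by (rule conditional_partition[OF pmp_actionD(1)[OF pY] \<phi> A \<alpha> \<beta> n]) (rule that)
  obtain y0 where y0: "y0 \<in> space Y" using Y.not_empty by auto
  define a0 where "a0 = \<alpha> y0"
  have a0: "a0 \<in> A" unfolding a0_def using y0 by (rule \<alpha>A)
  define C where "C j = {x \<in> space X. \<gamma> x = j}" for j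
  define D where "D g j k = {x \<in> space X. \<gamma> x = j \<and> \<gamma> (act g x) = k}" for g j k
  define m where "m g j k = measure X (D g j k)" for g j k
  define S where "S a B = {y \<in> space Y. \<alpha> y = a \<and> \<phi> y \<in> B}" for a B
  have S: "S a B \<in> sets Y" if "B \<in> sets X" for a B
  proof -
    have "{y \<in> space Y. \<alpha> y = a} \<inter> (\<phi> -` B \<inter> space Y) \<in> sets Y"
      by (rule sets.Int[OF \<alpha> measurable_sets[OF \<phi>(1) that]])
    also have "{y \<in> space Y. \<alpha> y = a} \<inter> (\<phi> -` B \<inter> space Y) = S a B" by (auto simp: S_def)
    finally show ?thesis .
  qed
  have total: "(\<Sum>a\<in>A. measure Y (S a B)) = measure X B" if B: "B \<in> sets X" for B
  proof -
    have "(\<Sum>a\<in>A. measure Y (S a B)) = measure Y (\<Union>a\<in>A. S a B)"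
      using S[OF B] A by (intro Y.finite_measure_finite_Union[symmetric]) (auto simp: disjoint_family_on_def S_def)
    also have "(\<Union>a\<in>A. S a B) = \<phi> -` B \<inter> space Y" using \<alpha>A by (auto simp: S_def)
    also have "measure Y \<dots> = measure X B" using measure_distr[OF \<phi>(1) B] \<phi>(2) by simp
    finally show ?thesis .
  qed
  have C: "C j \<in> sets X" for j unfolding C_def by (rule count_space_vimage_sets[OF \<gamma>])
  have D: "D g j k \<in> sets X" if "g \<in> carrier G" for g j k
    unfolding D_def by (rule colour_pair_sets[OF pX \<gamma> that])
  \<comment> \<open>On a null colour class the conditional law is undefined; the point mass at
    \<open>a0\<close> serves as a probability vector there.\<close>
  define law where "law j a = (if measure X (C j) > 0 then measure Y (S a (C j)) / measure X (C j)
    else if a = a0 then 1 else 0)" for j a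
  have law_nonneg: "0 \<le> law j a" for j a by (simp add: law_def)
  have law_sum: "(\<Sum>a\<in>A. law j a) = 1" for j
  proof (cases "measure X (C j) > 0")
    case True
    then have "(\<Sum>a\<in>A. law j a) = (\<Sum>a\<in>A. measure Y (S a (C j))) / measure X (C j)"
      by (simp add: law_def sum_divide_distrib)
    then show ?thesis using True by (simp add: total C)
  next
    case False
    then show ?thesis using A a0 by (simp add: law_def)
  qed
  have law_C: "measure X (C j) * law j a = measure Y (S a (C j))" if a: "a \<in> A" for j a
  proof (cases "measure X (C j) > 0")
    case False
    then have z: "measure X (C j) = 0" using measure_nonneg[of X "C j"] by linarith
    have "measure Y (S a (C j)) \<le> (\<Sum>a\<in>A. measure Y (S a (C j)))"
      using a A by (intro member_le_sum) auto
    then have "measure Y (S a (C j)) \<le> 0" using total[OF C, of j] z by simp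
    then have "measure Y (S a (C j)) = 0" using measure_nonneg[of Y "S a (C j)"] by linarith
    then show ?thesis using z by simp
  qed (simp add: law_def)
  \<comment> \<open>Both the class \<open>C j\<close> and its part \<open>B\<close> have conditional
    laws within \<open>1 / n\<close> of \<open>\<zeta> j\<close>, so conditioning further inside a
    class raises a probability by at most \<open>2 / n\<close>.\<close>
  have law_close: "measure Y (S a B) / measure X B \<le> law j a + 2 / n"
    if a: "a \<in> A" and B: "B \<in> sets X" "B \<subseteq> C j" "0 < measure X B" for a B j
  proof -
    have "measure X B \<le> measure X (C j)" using B C by (intro X.finite_measure_mono)
    then have Cp: "0 < measure X (C j)" using B(3) by linarith
    have "measure Y (S a B) \<le> \<zeta> j a * measure X B + measure X B / n"
      using \<zeta>[OF a B(1), of j] B(2) unfolding S_def C_def by (auto simp: abs_le_iff)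
    then have 1: "measure Y (S a B) / measure X B \<le> \<zeta> j a + 1 / n"
      using B(3) by (simp add: divide_le_eq distrib_right)
    have "\<zeta> j a * measure X (C j) - measure X (C j) / n \<le> measure Y (S a (C j))"
      using \<zeta>[OF a C, of j j] unfolding S_def C_def by (auto simp: abs_le_iff)
    then have "\<zeta> j a - 1 / n \<le> measure Y (S a (C j)) / measure X (C j)"
      using Cp by (simp add: le_divide_eq left_diff_distrib)
    then have "\<zeta> j a - 1 / n \<le> law j a" using Cp by (simp add: law_def)
    with 1 show ?thesis by (simp add: add_divide_distrib[symmetric])
  qed
  define R where "R g j k a c = {y \<in> space Y. \<alpha> y = a \<and> \<alpha> (b g y) = c \<and> \<phi> y \<in> D g j k}" for g j k a c
  define \<kappa> where "\<kappa> g j k a c = measure Y (R g j k a c) / m g j k" for g j k a c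
  have R: "R g j k a c \<in> sets Y" if g: "g \<in> carrier G" for g j k a c
  proof -
    have "S a (D g j k) \<inter> (b g -` {y \<in> space Y. \<alpha> y = c} \<inter> space Y) \<in> sets Y"
      by (rule sets.Int[OF S[OF D[OF g]] measurable_sets[OF pmp_actionD(4)[OF pY g] \<alpha>]])
    also have "S a (D g j k) \<inter> (b g -` {y \<in> space Y. \<alpha> y = c} \<inter> space Y) = R g j k a c"
      using pmp_actionD(6)[OF pY g] by (auto simp: S_def R_def)
    finally show ?thesis .
  qed
  have row: "(\<Sum>c\<in>A. measure Y (R g j k a c)) = measure Y (S a (D g j k))" if g: "g \<in> carrier G" for g j k a
  proof -
    have "(\<Sum>c\<in>A. measure Y (R g j k a c)) = measure Y (\<Union>c\<in>A. R g j k a c)"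
      using R[OF g] A by (intro Y.finite_measure_finite_Union[symmetric]) (auto simp: disjoint_family_on_def R_def)
    also have "(\<Union>c\<in>A. R g j k a c) = S a (D g j k)"
      using \<alpha>A pmp_actionD(6)[OF pY g] by (auto simp: S_def R_def)
    finally show ?thesis .
  qed
  have inv_act: "act (inv\<^bsub>G\<^esub> g) (act g x) = x" if "g \<in> carrier G" "x \<in> space X" for g x
    using that by (simp add: pmp_actionD(8)[OF pX, symmetric] pmp_actionD(7)[OF pX])
  \<comment> \<open>Column sums become row sums by moving the base point to \<open>b g y\<close>,
    which swaps the two colours and inverts \<open>g\<close>.\<close>
  have col: "(\<Sum>a\<in>A. measure Y (R g j k a c)) = measure Y (S c (D (inv\<^bsub>G\<^esub> g) k j))" if g: "g \<in> carrier G" for g j k c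
  proof -
    have "(\<Sum>a\<in>A. measure Y (R g j k a c)) = measure Y (\<Union>a\<in>A. R g j k a c)"
      using R[OF g] A by (intro Y.finite_measure_finite_Union[symmetric]) (auto simp: disjoint_family_on_def R_def)
    also have "(\<Union>a\<in>A. R g j k a c) = {y \<in> space Y. b g y \<in> S c (D (inv\<^bsub>G\<^esub> g) k j)}"
      using \<alpha>A pmp_actionD(6)[OF pY g] pmp_actionD(6)[OF pX g] inv_act[OF g] eqv[OF g] measurable_space[OF \<phi>(1)]
      by (auto simp: S_def R_def D_def)
    also have "measure Y \<dots> = measure Y (S c (D (inv\<^bsub>G\<^esub> g) k j))"
      by (rule pmp_measure_vimage[OF pY g S[OF D]]) (use g in simp)
    finally show ?thesis .
  qed
  have m_inv: "m (inv\<^bsub>G\<^esub> g) k j = m g j k" if g: "g \<in> carrier G" for g j k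
  proof -
    have "m (inv\<^bsub>G\<^esub> g) k j = measure X {x \<in> space X. act g x \<in> D (inv\<^bsub>G\<^esub> g) k j}"
      unfolding m_def by (rule pmp_measure_vimage[OF pX g D, symmetric]) (use g in simp)
    also have "{x \<in> space X. act g x \<in> D (inv\<^bsub>G\<^esub> g) k j} = D g j k"
      using pmp_actionD(6)[OF pX g] inv_act[OF g] by (auto simp: D_def)
    finally show ?thesis by (simp add: m_def)
  qed
  have \<kappa>0: "0 \<le> \<kappa> g j k a c" for g j k a c by (simp add: \<kappa>_def m_def)
  define dens where "dens g j k = (SOME w. close_coupling A (law j) (law k) (\<kappa> g j k) w)" for g j k
  have ok: "\<forall>g j k. close_coupling A (law j) (law k) (\<kappa> g j k) (dens g j k)"
    unfolding dens_def
    by (intro allI, rule someI_ex[OF close_coupling_exists[OF A \<kappa>0 law_nonneg law_sum law_nonneg law_sum]])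
  have dens0: "0 \<le> dens g j k a c" for g j k a c
    using ok[rule_format, of j k g] unfolding close_coupling_def by (elim conjE) simp
  have right: "(\<Sum>c\<in>A. law k c * dens g j k a c) = 1" if "a \<in> A" "law j a \<noteq> 0" for g j k a
    using ok[rule_format, of j k g] that unfolding close_coupling_def by (elim conjE) simp
  have left: "(\<Sum>a\<in>A. law j a * dens g j k a c) = 1" if "c \<in> A" "law k c \<noteq> 0" for g j k c
    using ok[rule_format, of j k g] that unfolding close_coupling_def by (elim conjE) simp
  have close: "(\<Sum>(a, b)\<in>P. law j a * law k b * dens g j k a b) \<le> (\<Sum>(a, b)\<in>P. \<kappa> g j k a b) + 2 * card A * \<eta>"
    if "(\<Sum>a\<in>A. \<Sum>b\<in>A. \<kappa> g j k a b) = 1" "\<forall>a\<in>A. (\<Sum>b\<in>A. \<kappa> g j k a b) \<le> law j a + \<eta>"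
      "\<forall>b\<in>A. (\<Sum>a\<in>A. \<kappa> g j k a b) \<le> law k b + \<eta>" "0 \<le> \<eta>" "P \<subseteq> A \<times> A" for g j k P and \<eta> :: real
    using ok[rule_format, of j k g] that unfolding close_coupling_def by (elim conjE) blast
  show thesis
  proof (rule that[OF \<gamma> t law_nonneg law_sum dens0 right left])
    show "measure X {x \<in> space X. \<gamma> x = j} * law j a = measure Y {y \<in> space Y. \<alpha> y = a \<and> \<gamma> (\<phi> y) = j}"
      if "a \<in> A" for j a
    proof -
      have "S a (C j) = {y \<in> space Y. \<alpha> y = a \<and> \<gamma> (\<phi> y) = j}"
        using measurable_space[OF \<phi>(1)] by (auto simp: S_def C_def)
      then show ?thesis using law_C[OF that, of j] by (simp add: C_def)
    qed
    fix g j k P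
    assume g: "g \<in> carrier G" and P: "P \<subseteq> A \<times> A" and nP: "\<And>y. y \<in> space Y \<Longrightarrow> (\<alpha> y, \<alpha> (b g y)) \<notin> P"
      and "0 < measure X {x \<in> space X. \<gamma> x = j \<and> \<gamma> (act g x) = k}"
    then have mpos: "0 < m g j k" by (simp add: m_def D_def)
    have rowsum: "(\<Sum>c\<in>A. \<kappa> g j k a c) = measure Y (S a (D g j k)) / m g j k" for a
      by (simp add: \<kappa>_def sum_divide_distrib[symmetric] row[OF g])
    have colsum: "(\<Sum>a\<in>A. \<kappa> g j k a c) = measure Y (S c (D (inv\<^bsub>G\<^esub> g) k j)) / m (inv\<^bsub>G\<^esub> g) k j" for c
      by (simp add: \<kappa>_def sum_divide_distrib[symmetric] col[OF g] m_inv[OF g])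
    \<comment> \<open>\<open>close\<close> is used with \<open>\<eta> = 2 / n\<close>. The pairs in
      \<open>P\<close> never occur on \<open>Y\<close>, so their \<open>\<kappa>\<close>-mass is
      zero and only the correction \<open>2 * card A * (2 / n)\<close> remains.\<close>
    have "(\<Sum>(a, c)\<in>P. law j a * law k c * dens g j k a c) \<le> (\<Sum>(a, c)\<in>P. \<kappa> g j k a c) + 2 * card A * (2 / n)"
    proof (rule close[OF _ _ _ _ P])
      show "(\<Sum>a\<in>A. \<Sum>b\<in>A. \<kappa> g j k a b) = 1"
        using mpos by (simp add: rowsum sum_divide_distrib[symmetric] total[OF D[OF g]] m_def)
      show "\<forall>a\<in>A. (\<Sum>b\<in>A. \<kappa> g j k a b) \<le> law j a + 2 / n"
        unfolding rowsum m_def using mpos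
        by (intro ballI law_close D[OF g]) (auto simp: D_def C_def m_def)
      have gi: "inv\<^bsub>G\<^esub> g \<in> carrier G" using g by simp
      show "\<forall>b\<in>A. (\<Sum>a\<in>A. \<kappa> g j k a b) \<le> law k b + 2 / n"
        unfolding colsum m_def using mpos m_inv[OF g, of k j]
        by (intro ballI law_close D[OF gi]) (auto simp: D_def C_def m_def)
    qed simp
    also have "(\<Sum>(a, c)\<in>P. \<kappa> g j k a c) = 0"
    proof (rule sum.neutral, clarify)
      fix a c assume "(a, c) \<in> P"
      then have "R g j k a c = {}" using nP by (auto simp: R_def)
      then show "\<kappa> g j k a c = 0" by (simp add: \<kappa>_def)
    qed
    finally show "(\<Sum>(a, c)\<in>P. law j a * law k c * dens g j k a c) \<le> 4 * card A / n" by simp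
  qed
qed

section \<open>Products, composition of factors and small perturbations\<close>

lemma pmp_product:
  assumes X: "pmp_action G X a" and W: "pmp_action G W c"
  defines "Z \<equiv> X \<Otimes>\<^sub>M W"
  defines "z \<equiv> \<lambda>g. \<lambda>y\<in>space (X \<Otimes>\<^sub>M W). (a g (fst y), c g (snd y))"
  shows "pmp_action G Z z" "factor_map G Z z X a fst"
proof -
  interpret X: prob_space X by (rule pmp_actionD(1)[OF X])
  interpret W: prob_space W by (rule pmp_actionD(1)[OF W])
  interpret XW: pair_prob_space X W ..
  have sp: "space Z = space X \<times> space W" by (simp add: Z_def space_pair_measure)
  have zm: "z g \<in> measurable Z Z" if g: "g \<in> carrier G" for g
  proof -
    have "(\<lambda>y. (a g (fst y), c g (snd y))) \<in> Z \<rightarrow>\<^sub>M Z"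
      unfolding Z_def
      by (intro measurable_Pair measurable_compose[OF measurable_fst pmp_actionD(4)[OF X g]]
        measurable_compose[OF measurable_snd pmp_actionD(4)[OF W g]])
    then show ?thesis by (rule measurable_cong[THEN iffD1, rotated]) (simp add: z_def Z_def)
  qed
  show "pmp_action G Z z"
    unfolding pmp_action_def
  proof (intro conjI ballI)
    show "prob_space Z" unfolding Z_def by (rule XW.P.prob_space_axioms)
    show "group_action G (space Z) z"
    proof (rule group_actionI[OF pmp_actionD(3)[OF X]])
      show "z g \<in> extensional (space Z)" for g by (simp add: z_def Z_def)
      show "z g y \<in> space Z" if "g \<in> carrier G" "y \<in> space Z" for g y
        using measurable_space[OF zm] that by blast
      show "z \<one>\<^bsub>G\<^esub> y = y" if "y \<in> space Z" for y
        using that pmp_actionD(7)[OF X] pmp_actionD(7)[OF W] by (cases y) (auto simp: z_def Z_def space_pair_measure)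
      show "z (g \<otimes>\<^bsub>G\<^esub> h) y = z g (z h y)" if "g \<in> carrier G" "h \<in> carrier G" "y \<in> space Z" for g h y
        using that pmp_actionD(6,8)[OF X] pmp_actionD(6,8)[OF W] by (cases y) (auto simp: z_def Z_def space_pair_measure)
    qed
    fix g assume g: "g \<in> carrier G"
    show "z g \<in> measurable Z Z" using g by (rule zm)
    have "distr Z Z (z g) = distr (X \<Otimes>\<^sub>M W) (X \<Otimes>\<^sub>M W) (\<lambda>(x, w). (a g x, c g w))"
      unfolding Z_def by (rule distr_cong) (auto simp: z_def)
    also have "\<dots> = distr X X (a g) \<Otimes>\<^sub>M distr W W (c g)"
      by (rule pair_measure_distr[symmetric])
        (auto intro: pmp_actionD(4)[OF X g] pmp_actionD(4)[OF W g] W.prob_space_distr prob_space_imp_sigma_finite)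
    finally show "distr Z Z (z g) = Z"
      by (simp add: pmp_actionD(5)[OF X g] pmp_actionD(5)[OF W g] Z_def)
  qed
  show "factor_map G Z z X a fst"
    unfolding factor_map_def
  proof (intro conjI ballI)
    show "fst \<in> Z \<rightarrow>\<^sub>M X" unfolding Z_def by (rule measurable_fst)
    show "distr Z X fst = X" unfolding Z_def by (rule W.distr_pair_fst)
  qed (auto simp: z_def Z_def)
qed

lemma factor_map_compose:
  assumes 1: "factor_map G Y b Z z \<psi>" and 2: "factor_map G Z z X a \<phi>"
  shows "factor_map G Y b X a (\<phi> \<circ> \<psi>)"
proof -
  have m: "\<psi> \<in> measurable Y Z" "\<phi> \<in> measurable Z X" using 1 2 by (auto simp: factor_map_def)
  have "distr Y X (\<phi> \<circ> \<psi>) = distr (distr Y Z \<psi>) X \<phi>" by (rule distr_distr[OF m(2,1), symmetric])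
  then show ?thesis
    using 1 2 m measurable_space[OF m(1)] by (auto simp: factor_map_def)
qed

lemma (in finite_measure) measure_diff_le:
  assumes "A \<in> sets M" "B \<in> sets M" "C \<in> sets M"
    and "\<And>x. x \<in> space M \<Longrightarrow> x \<notin> C \<Longrightarrow> x \<in> A \<longleftrightarrow> x \<in> B"
  shows "\<bar>measure M A - measure M B\<bar> \<le> measure M C"
proof -
  have "measure M P \<le> measure M P' + measure M C"
    if "P \<in> sets M" "P' \<in> sets M" "\<And>x. x \<in> space M \<Longrightarrow> x \<notin> C \<Longrightarrow> x \<in> P \<Longrightarrow> x \<in> P'" for P P'
  proof -
    have "measure M P \<le> measure M (P' \<union> C)"
      using that assms(3) sets.sets_into_space[OF that(1)] by (intro finite_measure_mono) auto
    also have "\<dots> \<le> measure M P' + measure M C"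
      using that assms(3) by (intro measure_subadditive) auto
    finally show ?thesis .
  qed
  from this[of A B] this[of B A] assms show ?thesis by (auto simp: abs_le_iff)
qed

lemma linked_constant:
  assumes "linked E h k" "\<And>u v. (u, v) \<in> E \<Longrightarrow> \<tau> u = \<tau> v"
  shows "\<tau> h = \<tau> k"
  using assms(1) unfolding linked_def by (induction rule: rtrancl_induct) (use assms(2) in fastforce)+

lemma (in group) shift_cancel:
  "x \<in> carrier G \<Longrightarrow> u \<in> carrier G \<Longrightarrow> v \<in> carrier G \<Longrightarrow>
    (x \<otimes> inv v) \<otimes> (v \<otimes> inv u) = x \<otimes> inv u"
  by (metis inv_closed inv_solve_right m_assoc m_closed)

text \<open>\<open>\<gamma>\<close>, \<open>Q\<close> and \<open>\<delta>\<close> are fixed before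
  \<open>X'\<close> appears, and so are the vertex laws and edge densities, which come from
  \<open>X\<close> and \<open>Y\<close>. The space \<open>X'\<close> enters only through its
  colour-pair statistics; this is what makes the result applicable to the factors of an
  ultraproduct.\<close>

lemma finitary_extension:
  fixes G :: "('g, 'm) monoid_scheme" and Y :: "'y measure" and X :: "'x measure"
    and \<alpha> :: "'y \<Rightarrow> nat" and \<beta> :: "'x \<Rightarrow> nat"
  assumes cG: "countable (carrier G)" and tr: "approx_treeable TYPE('w) G"
    and pY: "pmp_action G Y b" and pX: "pmp_action G X act" and fm: "factor_map G Y b X act \<phi>"
    and \<alpha>: "\<alpha> \<in> measurable Y (count_space {..<p})" and \<beta>: "\<beta> \<in> measurable X (count_space {..<q})"
    and S: "finite S" "S \<subseteq> carrier G" and e: "0 < \<epsilon>"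
  obtains r :: nat and \<gamma> :: "'x \<Rightarrow> nat" and t :: "nat \<Rightarrow> nat" and Q and \<delta> :: real
  where "\<gamma> \<in> measurable X (count_space {..<r})" "\<And>x. x \<in> space X \<Longrightarrow> t (\<gamma> x) = \<beta> x"
    "finite Q" "Q \<subseteq> carrier G" "0 < \<delta>"
    "\<And>(X' :: 'z measure) act' \<gamma>'. pmp_action G X' act' \<Longrightarrow> \<gamma>' \<in> measurable X' (count_space {..<r}) \<Longrightarrow>
      (\<And>g j k. g \<in> Q \<Longrightarrow> j < r \<Longrightarrow> k < r \<Longrightarrow> \<bar>measure X' {x \<in> space X'. \<gamma>' x = j \<and> \<gamma>' (act' g x) = k} -
        measure X {x \<in> space X. \<gamma> x = j \<and> \<gamma> (act g x) = k}\<bar> < \<delta>) \<Longrightarrow>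
      \<exists>(Y' :: (('z \<times> 'w) \<times> ('g \<Rightarrow> real)) measure) b' \<phi>' \<alpha>'.
        pmp_action G Y' b' \<and> factor_map G Y' b' X' act' \<phi>' \<and> \<alpha>' \<in> measurable Y' (count_space {..<p}) \<and>
        (\<forall>\<pi>\<in>S \<rightarrow>\<^sub>E {..<p}. \<forall>j.
          \<bar>measure Y' {y \<in> space Y'. pattern_map G b' S \<alpha>' y = \<pi> \<and> t (\<gamma>' (\<phi>' y)) = j} -
           measure Y {y \<in> space Y. pattern_map G b S \<alpha> y = \<pi> \<and> \<beta> (\<phi> y) = j}\<bar> < \<epsilon>)"
proof -
  interpret Y: prob_space Y by (rule pmp_actionD(1)[OF pY])
  interpret X: prob_space X by (rule pmp_actionD(1)[OF pX])
  interpret group G by (rule pmp_actionD(3)[OF pX])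
  have \<phi>: "\<phi> \<in> measurable Y X" "distr Y X \<phi> = X"
    and eqv: "\<And>g y. g \<in> carrier G \<Longrightarrow> y \<in> space Y \<Longrightarrow> \<phi> (b g y) = act g (\<phi> y)"
    using fm by (auto simp: factor_map_def)
  obtain y0 where y0: "y0 \<in> space Y" using Y.not_empty by auto
  have p: "0 < p" using measurable_space[OF \<alpha> y0] by auto
  \<comment> \<open>The pattern at \<open>y\<close> reads the labels at the inverses of
    \<open>S\<close>; they are to be compared with the label at the unit.\<close>
  define H where "H = insert \<one>\<^bsub>G\<^esub> ((\<lambda>s. inv\<^bsub>G\<^esub> s) ` S)"
  have H: "finite H" "H \<subseteq> carrier G" using S by (auto simp: H_def)
  have e4: "0 < \<epsilon> / 4" using e by simp
  obtain W :: "'w measure" and c and T and F D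
    where pW: "pmp_action G W c" and T_sub: "\<And>x. T x \<subseteq> carrier G \<times> carrier G" and T_forest: "\<And>x. forest (T x)"
    and T_sets: "\<And>u v. u \<in> carrier G \<Longrightarrow> v \<in> carrier G \<Longrightarrow> {x \<in> space W. (u, v) \<in> T x} \<in> sets W"
    and T_equiv: "\<And>g u v x. g \<in> carrier G \<Longrightarrow> u \<in> carrier G \<Longrightarrow> v \<in> carrier G \<Longrightarrow> x \<in> space W \<Longrightarrow>
      (u, v) \<in> T (c g x) \<longleftrightarrow> (u \<otimes>\<^bsub>G\<^esub> g, v \<otimes>\<^bsub>G\<^esub> g) \<in> T x"
    and F: "finite F" "F \<subseteq> carrier G" "H \<subseteq> F"
    and D_sets: "D \<in> sets W" and D_big: "measure W D > 1 - \<epsilon> / 4"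
    and D_linked: "\<And>x h k. x \<in> D \<Longrightarrow> h \<in> H \<Longrightarrow> k \<in> H \<Longrightarrow> linked (T x \<inter> F \<times> F) h k"
    by (rule approx_treeable_forest[OF cG tr H e4]) (rule that)
  \<comment> \<open>The label at vertex \<open>u\<close> describes the point \<open>u x\<close>. To
    know the colour of \<open>s^-1 x\<close> it must record \<open>\<alpha>\<close> at the translate
    by \<open>inv s \<otimes> inv u\<close>; the unit lets a label reveal its own colour.\<close>
  define J where "J = insert \<one>\<^bsub>G\<^esub> ((\<lambda>(s, u). inv\<^bsub>G\<^esub> s \<otimes>\<^bsub>G\<^esub> inv\<^bsub>G\<^esub> u) ` (S \<times> F))"
  have J: "finite J" "J \<subseteq> carrier G" using S F by (auto simp: J_def)
  have J_mem: "inv\<^bsub>G\<^esub> s \<otimes>\<^bsub>G\<^esub> inv\<^bsub>G\<^esub> u \<in> J" if "s \<in> S" "u \<in> F" for s u using that by (auto simp: J_def)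
  obtain A :: "real set" and \<alpha>p :: "'y \<Rightarrow> real" and obs :: "'g \<Rightarrow> real \<Rightarrow> nat"
    where A: "finite A" and \<alpha>pA: "\<And>y. y \<in> space Y \<Longrightarrow> \<alpha>p y \<in> A"
    and obs_less: "\<And>a f. a \<in> A \<Longrightarrow> f \<in> J \<Longrightarrow> obs f a < p"
    and obs: "\<And>y f. y \<in> space Y \<Longrightarrow> f \<in> J \<Longrightarrow> obs f (\<alpha>p y) = \<alpha> (b f y)"
    and \<alpha>p: "\<And>a. {y \<in> space Y. \<alpha>p y = a} \<in> sets Y"
    by (rule finite_observables[OF pY J \<alpha>]) (rule that)
  \<comment> \<open>\<open>N1\<close> counts the candidate edges inside the window. Each is
    inconsistent with probability at most \<open>4 * card A / n\<close>, up to the transfer error,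
    and \<open>n\<close> is taken so large that all of them together cost at most
    \<open>\<epsilon> / 4\<close>.\<close>
  define N1 where "N1 = (real (card F))\<^sup>2"
  have N1: "0 \<le> N1" by (simp add: N1_def)
  obtain n :: nat where n': "16 * N1 * card A / \<epsilon> < n" using reals_Archimedean2 by blast
  have "0 \<le> 16 * N1 * card A / \<epsilon>" using N1 e by simp
  then have n: "0 < n" using n' by linarith
  have n_bound: "N1 * (4 * card A / n) \<le> \<epsilon> / 4"
    using n' n e by (simp add: field_simps)
  obtain r :: nat and \<gamma> :: "'x \<Rightarrow> nat" and t :: "nat \<Rightarrow> nat" and law :: "nat \<Rightarrow> real \<Rightarrow> real"
    and dens :: "'g \<Rightarrow> nat \<Rightarrow> nat \<Rightarrow> real \<Rightarrow> real \<Rightarrow> real"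
    where \<gamma>: "\<gamma> \<in> measurable X (count_space {..<r})" and t: "\<And>x. x \<in> space X \<Longrightarrow> t (\<gamma> x) = \<beta> x"
    and law: "\<And>j a. 0 \<le> law j a" "\<And>j. (\<Sum>a\<in>A. law j a) = 1" and dens: "\<And>g j k a c. 0 \<le> dens g j k a c"
    and right: "\<And>g j k a. a \<in> A \<Longrightarrow> law j a \<noteq> 0 \<Longrightarrow> (\<Sum>c\<in>A. law k c * dens g j k a c) = 1"
    and left: "\<And>g j k c. c \<in> A \<Longrightarrow> law k c \<noteq> 0 \<Longrightarrow> (\<Sum>a\<in>A. law j a * dens g j k a c) = 1"
    and law_X: "\<And>j a. a \<in> A \<Longrightarrow> measure X {x \<in> space X. \<gamma> x = j} * law j a =
      measure Y {y \<in> space Y. \<alpha>p y = a \<and> \<gamma> (\<phi> y) = j}"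
    and dens_X: "\<And>g j k P. g \<in> carrier G \<Longrightarrow> P \<subseteq> A \<times> A \<Longrightarrow> (\<And>y. y \<in> space Y \<Longrightarrow> (\<alpha>p y, \<alpha>p (b g y)) \<notin> P) \<Longrightarrow>
      measure X {x \<in> space X. \<gamma> x = j \<and> \<gamma> (act g x) = k} > 0 \<Longrightarrow>
      (\<Sum>(a, c)\<in>P. law j a * law k c * dens g j k a c) \<le> 4 * card A / n"
    apply (rule transition_densities[OF pY pX fm A \<alpha>pA \<alpha>p \<beta> n])
     apply assumption
    subgoal premises prems by (rule that[OF prems(2-)])
    done
  define E where "E g j k P = (\<Sum>(a, c)\<in>P. law j a * law k c * dens g j k a c)" for g j k P
  have E0: "0 \<le> E g j k P" for g j k P
    unfolding E_def using law(1) dens by (intro sum_nonneg) auto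
  have E1: "E g j k P \<le> 1" if "P \<subseteq> A \<times> A" for g j k P
  proof -
    have "E g j k P \<le> (\<Sum>(a, c)\<in>A \<times> A. law j a * law k c * dens g j k a c)"
      unfolding E_def using that A law(1) dens by (intro sum_mono2) auto
    also have "\<dots> = (\<Sum>a\<in>A. law j a * (\<Sum>c\<in>A. law k c * dens g j k a c))"
      by (simp add: sum.cartesian_product[symmetric] sum_distrib_left mult.assoc)
    also have "\<dots> = (\<Sum>a\<in>A. law j a)"
    proof (intro sum.cong refl)
      fix a assume "a \<in> A"
      then show "law j a * (\<Sum>c\<in>A. law k c * dens g j k a c) = law j a"
        using right[of a j k g] by (cases "law j a = 0") auto
    qed
    finally show ?thesis by (simp add: law(2))
  qed
  \<comment> \<open>Pairs of labels at \<open>u\<close> and \<open>v\<close> that disagree on the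
    colour of some \<open>s^-1 x\<close>. Labels coming from a point of \<open>Y\<close> never do
    (\<open>Inc_Y\<close>).\<close>
  define Inc where "Inc u v = {(a, c) \<in> A \<times> A. \<exists>s\<in>S.
    obs (inv\<^bsub>G\<^esub> s \<otimes>\<^bsub>G\<^esub> inv\<^bsub>G\<^esub> u) a \<noteq> obs (inv\<^bsub>G\<^esub> s \<otimes>\<^bsub>G\<^esub> inv\<^bsub>G\<^esub> v) c}" for u v
  have Inc_sub: "Inc u v \<subseteq> A \<times> A" for u v by (auto simp: Inc_def)
  have Inc_Y: "(\<alpha>p y, \<alpha>p (b (v \<otimes>\<^bsub>G\<^esub> inv\<^bsub>G\<^esub> u) y)) \<notin> Inc u v"
    if uv: "u \<in> F" "v \<in> F" and y: "y \<in> space Y" for u v y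
  proof -
    have K: "u \<in> carrier G" "v \<in> carrier G" using uv F by auto
    then have g: "v \<otimes>\<^bsub>G\<^esub> inv\<^bsub>G\<^esub> u \<in> carrier G" by simp
    have "obs (inv\<^bsub>G\<^esub> s \<otimes>\<^bsub>G\<^esub> inv\<^bsub>G\<^esub> u) (\<alpha>p y) = obs (inv\<^bsub>G\<^esub> s \<otimes>\<^bsub>G\<^esub> inv\<^bsub>G\<^esub> v) (\<alpha>p (b (v \<otimes>\<^bsub>G\<^esub> inv\<^bsub>G\<^esub> u) y))"
      if s: "s \<in> S" for s
    proof -
      have sK: "inv\<^bsub>G\<^esub> s \<in> carrier G" using s S by auto
      have "obs (inv\<^bsub>G\<^esub> s \<otimes>\<^bsub>G\<^esub> inv\<^bsub>G\<^esub> v) (\<alpha>p (b (v \<otimes>\<^bsub>G\<^esub> inv\<^bsub>G\<^esub> u) y)) =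
          \<alpha> (b (inv\<^bsub>G\<^esub> s \<otimes>\<^bsub>G\<^esub> inv\<^bsub>G\<^esub> v) (b (v \<otimes>\<^bsub>G\<^esub> inv\<^bsub>G\<^esub> u) y))"
        by (rule obs[OF pmp_actionD(6)[OF pY g y] J_mem[OF s uv(2)]])
      also have "b (inv\<^bsub>G\<^esub> s \<otimes>\<^bsub>G\<^esub> inv\<^bsub>G\<^esub> v) (b (v \<otimes>\<^bsub>G\<^esub> inv\<^bsub>G\<^esub> u) y) = b (inv\<^bsub>G\<^esub> s \<otimes>\<^bsub>G\<^esub> inv\<^bsub>G\<^esub> u) y"
        using pmp_actionD(8)[OF pY _ g y, of "inv\<^bsub>G\<^esub> s \<otimes>\<^bsub>G\<^esub> inv\<^bsub>G\<^esub> v"] sK K shift_cancel[OF sK K] by simp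
      also have "\<alpha> \<dots> = obs (inv\<^bsub>G\<^esub> s \<otimes>\<^bsub>G\<^esub> inv\<^bsub>G\<^esub> u) (\<alpha>p y)"
        by (rule obs[OF y J_mem[OF s uv(1)], symmetric])
      finally show ?thesis ..
    qed
    then show ?thesis by (simp add: Inc_def)
  qed
  \<comment> \<open>The elements that relate the ends of edges; the unit is added to control the
    measures of single colour classes.\<close>
  define Q where "Q = insert \<one>\<^bsub>G\<^esub> ((\<lambda>(u, v). v \<otimes>\<^bsub>G\<^esub> inv\<^bsub>G\<^esub> u) ` (F \<times> F))"
  have Q: "finite Q" "Q \<subseteq> carrier G" using F by (auto simp: Q_def)
  \<comment> \<open>\<open>(N1 + 1) * (r + 1)^2\<close> dominates both \<open>N1 * r^2\<close>, the
    number of combinations of an edge with a pair of colours, and \<open>r\<close>, the number of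
    colours; and it is never zero.\<close>
  define \<delta> where "\<delta> = \<epsilon> / (4 * (N1 + 1) * (real r + 1)\<^sup>2)"
  have den: "0 < 4 * (N1 + 1) * (real r + 1)\<^sup>2" using N1 by (intro mult_pos_pos) auto
  have \<delta>: "0 < \<delta>" unfolding \<delta>_def using e den by simp
  have \<delta>_mul: "x * \<delta> \<le> \<epsilon> / 4" if "0 \<le> x" "x \<le> (N1 + 1) * (real r + 1)\<^sup>2" for x
  proof -
    have "x * \<delta> \<le> ((N1 + 1) * (real r + 1)\<^sup>2) * \<delta>" using that \<delta> by (intro mult_right_mono) auto
    also have "\<dots> = \<epsilon> / 4" using den unfolding \<delta>_def by (simp add: field_simps)
    finally show ?thesis .
  qed
  have r2: "(real r)\<^sup>2 \<le> (real r + 1)\<^sup>2" by (intro power_mono) auto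
  have "N1 * (real r)\<^sup>2 \<le> (N1 + 1) * (real r + 1)\<^sup>2" using N1 r2 by (intro mult_mono) auto
  then have \<delta>1: "N1 * (real r)\<^sup>2 * \<delta> \<le> \<epsilon> / 4" using N1 by (intro \<delta>_mul) auto
  have "real r \<le> (real r + 1)\<^sup>2" by (simp add: power2_eq_square algebra_simps)
  also have "\<dots> \<le> (N1 + 1) * (real r + 1)\<^sup>2" using N1 by (simp add: mult_le_cancel_right1)
  finally have \<delta>2: "real r * \<delta> \<le> \<epsilon> / 4" by (intro \<delta>_mul) auto
  show thesis
  proof (rule that[OF \<gamma> t Q \<delta>])
    fix X' :: "'z measure" and act' \<gamma>'
    assume pX': "pmp_action G X' act'" and \<gamma>': "\<gamma>' \<in> measurable X' (count_space {..<r})"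
      and near: "\<And>g j k. g \<in> Q \<Longrightarrow> j < r \<Longrightarrow> k < r \<Longrightarrow> \<bar>measure X' {x \<in> space X'. \<gamma>' x = j \<and> \<gamma>' (act' g x) = k} -
        measure X {x \<in> space X. \<gamma> x = j \<and> \<gamma> (act g x) = k}\<bar> < \<delta>"
    interpret X': prob_space X' by (rule pmp_actionD(1)[OF pX'])
    interpret W: prob_space W by (rule pmp_actionD(1)[OF pW])
    define Z where "Z = X' \<Otimes>\<^sub>M W"
    define z where "z = (\<lambda>g. \<lambda>y\<in>space (X' \<Otimes>\<^sub>M W). (act' g (fst y), c g (snd y)))"
    have pZ: "pmp_action G Z z" and fZ: "factor_map G Z z X' act' fst"
      unfolding Z_def z_def by (rule pmp_product[OF pX' pW])+
    have spZ: "space Z = space X' \<times> space W" by (simp add: Z_def space_pair_measure)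
    have z_eq: "z g x = (act' g (fst x), c g (snd x))" if "x \<in> space Z" for g x
      using that by (simp add: z_def Z_def)
    have fstZ: "fst \<in> Z \<rightarrow>\<^sub>M X'" and sndZ: "snd \<in> Z \<rightarrow>\<^sub>M W" unfolding Z_def by simp_all
    \<comment> \<open>\<open>X'\<close> need not be free, so the forests are supplied by the second
      factor \<open>W\<close>, while the colours are read in \<open>X'\<close>.\<close>
    interpret M: markov_extension G Z z A law dens "\<lambda>x. \<gamma>' (fst x)" r "\<lambda>x. T (snd x)"
    proof
      show "pmp_action G Z z" "countable (carrier G)" "finite A" by fact+
      show "(\<lambda>x. \<gamma>' (fst x)) \<in> Z \<rightarrow>\<^sub>M count_space {..<r}" by (rule measurable_compose[OF fstZ \<gamma>'])
      show "{x \<in> space Z. (u, v) \<in> T (snd x)} \<in> sets Z" if "u \<in> carrier G" "v \<in> carrier G" for u v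
      proof -
        have "{x \<in> space Z. (u, v) \<in> T (snd x)} = snd -` {w \<in> space W. (u, v) \<in> T w} \<inter> space Z"
          by (auto simp: spZ)
        then show ?thesis using measurable_sets[OF sndZ T_sets[OF that]] by simp
      qed
      show "(u, v) \<in> T (snd (z g x)) \<longleftrightarrow> (u \<otimes>\<^bsub>G\<^esub> g, v \<otimes>\<^bsub>G\<^esub> g) \<in> T (snd x)"
        if "g \<in> carrier G" "u \<in> carrier G" "v \<in> carrier G" "x \<in> space Z" for g u v x
        using that T_equiv[of g u v "snd x"] by (auto simp: z_eq spZ)
    qed (use law dens right left T_sub T_forest in auto)
    interpret ext: prob_space M.ext by (rule M.prob_space_ext)
    define \<phi>' where "\<phi>' = (fst \<circ> fst :: ('z \<times> 'w) \<times> ('g \<Rightarrow> real) \<Rightarrow> 'z)"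
    \<comment> \<open>Labels lie in \<open>A\<close> almost surely, not everywhere; the default
      \<open>0\<close> is a legal colour since \<open>0 < p\<close>.\<close>
    define \<alpha>' where "\<alpha>' y = (if snd y \<one>\<^bsub>G\<^esub> \<in> A then obs \<one>\<^bsub>G\<^esub> (snd y \<one>\<^bsub>G\<^esub>) else 0)" for y :: "('z \<times> 'w) \<times> ('g \<Rightarrow> real)"
    have f\<phi>': "factor_map G M.ext M.eact X' act' \<phi>'"
      unfolding \<phi>'_def by (rule factor_map_compose[OF M.factor_ext fZ])
    then have \<phi>'_meas: "\<phi>' \<in> M.ext \<rightarrow>\<^sub>M X'" by (simp add: factor_map_def)
    have lab: "{y \<in> space M.ext. snd y v \<in> B} \<in> sets M.ext" if "v \<in> carrier G" "B \<in> sets borel" for v B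
      using measurable_sets[OF M.label_measurable[OF that(1)] that(2)] by (simp add: vimage_def Int_def conj_commute)
    have \<alpha>'_meas: "\<alpha>' \<in> M.ext \<rightarrow>\<^sub>M count_space {..<p}"
    proof (rule measurable_count_space_eq2[THEN iffD2], simp, intro conjI ballI)
      show "\<alpha>' \<in> space M.ext \<rightarrow> {..<p}" using p obs_less by (auto simp: \<alpha>'_def J_def)
      fix j
      let ?B = "{a \<in> A. obs \<one>\<^bsub>G\<^esub> a = j} \<union> (if j = 0 then - A else {})"
      have finA: "A \<in> sets borel" "{a \<in> A. obs \<one>\<^bsub>G\<^esub> a = j} \<in> sets borel"
        using A by (auto intro!: borel_closed finite_imp_closed)
      have "\<alpha>' -` {j} \<inter> space M.ext = {y \<in> space M.ext. snd y \<one>\<^bsub>G\<^esub> \<in> ?B}"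
        by (auto simp: \<alpha>'_def split: if_splits)
      also have "\<dots> \<in> sets M.ext" using finA by (intro lab) auto
      finally show "\<alpha>' -` {j} \<inter> space M.ext \<in> sets M.ext" .
    qed
    have "\<bar>measure M.ext {y \<in> space M.ext. pattern_map G M.eact S \<alpha>' y = \<pi> \<and> t (\<gamma>' (\<phi>' y)) = j} -
           measure Y {y \<in> space Y. pattern_map G b S \<alpha> y = \<pi> \<and> \<beta> (\<phi> y) = j}\<bar> < \<epsilon>"
      if \<pi>: "\<pi> \<in> S \<rightarrow>\<^sub>E {..<p}" for \<pi> j
    proof -
      define A\<pi> where "A\<pi> = {a \<in> A. \<forall>s\<in>S. obs (inv\<^bsub>G\<^esub> s) a = \<pi> s}"
      have A\<pi>: "finite A\<pi>" "A\<pi> \<subseteq> A" using A by (auto simp: A\<pi>_def)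
      have one: "\<one>\<^bsub>G\<^esub> \<in> F" using F(3) by (auto simp: H_def)
      have invF: "inv\<^bsub>G\<^esub> s \<in> F" if "s \<in> S" for s using F(3) that by (auto simp: H_def)
      have invJ: "inv\<^bsub>G\<^esub> s \<in> J" if "s \<in> S" for s
        using J_mem[OF that one] that S by auto
      define P1 where "P1 = {y \<in> space M.ext. pattern_map G M.eact S \<alpha>' y = \<pi> \<and> t (\<gamma>' (\<phi>' y)) = j}"
      \<comment> \<open>\<open>P1\<close> asks for the actual pattern, \<open>P2\<close> for the
        pattern announced by the label at the unit alone. They can differ only on
        \<open>Bad\<close>: base point outside \<open>D\<close>, a label outside \<open>A\<close>,
        or an edge with inconsistent labels.\<close>
      define P2 where "P2 = {y \<in> space M.ext. snd y \<one>\<^bsub>G\<^esub> \<in> A\<pi> \<and> t (\<gamma>' (\<phi>' y)) = j}"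
      define Bw where "Bw = space M.ext - ((\<lambda>y. snd (fst y)) -` D \<inter> space M.ext)"
      define Bo where "Bo u = {y \<in> space M.ext. snd y u \<in> - A}" for u
      define Be where "Be e = {y \<in> space M.ext. (fst e, snd e) \<in> T (snd (fst y)) \<and> (snd y (fst e), snd y (snd e)) \<in> Inc (fst e) (snd e)}" for e
      define Bad where "Bad = Bw \<union> (\<Union>u\<in>F. Bo u) \<union> (\<Union>e\<in>F \<times> F. Be e)"
      have t\<gamma>': "(\<lambda>y. t (\<gamma>' (\<phi>' y))) \<in> M.ext \<rightarrow>\<^sub>M count_space UNIV"
        by (rule measurable_compose[OF measurable_compose[OF \<phi>'_meas \<gamma>']]) simp
      have P1_sets: "P1 \<in> sets M.ext"
        unfolding P1_def by (rule pattern_sets[OF M.pmp_ext S \<alpha>'_meas t\<gamma>' \<pi>])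
      have P2_sets: "P2 \<in> sets M.ext"
      proof -
        have "{y \<in> space M.ext. snd y \<one>\<^bsub>G\<^esub> \<in> A\<pi>} \<inter> {y \<in> space M.ext. t (\<gamma>' (\<phi>' y)) = j} \<in> sets M.ext"
          using A\<pi>(1) by (intro sets.Int lab count_space_vimage_sets[OF t\<gamma>']) (auto intro: borel_closed finite_imp_closed)
        also have "{y \<in> space M.ext. snd y \<one>\<^bsub>G\<^esub> \<in> A\<pi>} \<inter> {y \<in> space M.ext. t (\<gamma>' (\<phi>' y)) = j} = P2"
          by (auto simp: P2_def)
        finally show ?thesis .
      qed
      have wmeas: "(\<lambda>y. snd (fst y)) \<in> M.ext \<rightarrow>\<^sub>M W" by (rule measurable_compose[OF M.fst_measurable sndZ])
      have Bw_sets: "Bw \<in> sets M.ext"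
        unfolding Bw_def by (rule sets.compl_sets[OF measurable_sets[OF wmeas D_sets]])
      have Bo_sets: "Bo u \<in> sets M.ext" if "u \<in> F" for u
        unfolding Bo_def using that F(2) A by (intro lab) (auto intro!: borel_open open_Compl finite_imp_closed)
      have Be_sets: "Be e \<in> sets M.ext" if "e \<in> F \<times> F" for e
      proof -
        have K: "fst e \<in> carrier G" "snd e \<in> carrier G" using that F(2) by auto
        have "{y \<in> space M.ext. (snd y (fst e), snd y (snd e)) \<in> Inc (fst e) (snd e)} \<in> sets M.ext"
        proof -
          have "finite (Inc (fst e) (snd e))" 
            by (rule finite_subset[OF Inc_sub finite_cartesian_product[OF A A]])
          moreover have "{y \<in> space M.ext. (snd y (fst e), snd y (snd e)) \<in> Inc (fst e) (snd e)} =
              (\<Union>q\<in>Inc (fst e) (snd e). {y \<in> space M.ext. snd y (fst e) \<in> {fst q}} \<inter> {y \<in> space M.ext. snd y (snd e) \<in> {snd q}})"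
            by force
          ultimately show ?thesis using K by (simp only:) (intro sets.finite_UN sets.Int lab, auto)
        qed
        moreover have "fst -` {x \<in> space Z. (fst e, snd e) \<in> T (snd x)} \<inter> space M.ext \<in> sets M.ext"
          by (rule measurable_sets[OF M.fst_measurable M.T_sets[OF K]])
        ultimately have "{y \<in> space M.ext. (snd y (fst e), snd y (snd e)) \<in> Inc (fst e) (snd e)} \<inter>
            (fst -` {x \<in> space Z. (fst e, snd e) \<in> T (snd x)} \<inter> space M.ext) \<in> sets M.ext" by (rule sets.Int)
        also have "{y \<in> space M.ext. (snd y (fst e), snd y (snd e)) \<in> Inc (fst e) (snd e)} \<inter>
            (fst -` {x \<in> space Z. (fst e, snd e) \<in> T (snd x)} \<inter> space M.ext) = Be e"
          by (auto simp: Be_def M.space_ext)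
        finally show ?thesis .
      qed
      have Bad_sets: "Bad \<in> sets M.ext"
        unfolding Bad_def using Bw_sets Bo_sets Be_sets F(1) by (intro sets.Un sets.finite_UN) auto

      have same: "y \<in> P1 \<longleftrightarrow> y \<in> P2" if y: "y \<in> space M.ext" "y \<notin> Bad" for y
      proof -
        let ?E = "T (snd (fst y)) \<inter> F \<times> F"
        have inA: "snd y u \<in> A" if "u \<in> F" for u using y that by (auto simp: Bad_def Bo_def)
        have "obs (inv\<^bsub>G\<^esub> s) (snd y \<one>\<^bsub>G\<^esub>) = \<alpha>' (M.eact (inv\<^bsub>G\<^esub> s) y)" if s: "s \<in> S" for s
        proof -
          \<comment> \<open>\<open>?\<tau> u\<close> is the colour of \<open>s^-1 x\<close>
            according to vertex \<open>u\<close>. It is constant along consistent edges; at the unit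
            it is the announced colour and at \<open>inv s\<close> the actual one.\<close>
          let ?\<tau> = "\<lambda>u. obs (inv\<^bsub>G\<^esub> s \<otimes>\<^bsub>G\<^esub> inv\<^bsub>G\<^esub> u) (snd y u)"
          have sK: "s \<in> carrier G" using s S by auto
          have "snd (fst y) \<in> D" using y by (auto simp: Bad_def Bw_def)
          then have "linked ?E \<one>\<^bsub>G\<^esub> (inv\<^bsub>G\<^esub> s)" using s by (intro D_linked) (auto simp: H_def)
          then have "?\<tau> \<one>\<^bsub>G\<^esub> = ?\<tau> (inv\<^bsub>G\<^esub> s)"
          proof (rule linked_constant)
            fix u v assume uv: "(u, v) \<in> ?E"
            then have "y \<notin> Be (u, v)" using y(2) by (auto simp: Bad_def)
            then have "(snd y u, snd y v) \<notin> Inc u v" using uv y(1) by (simp add: Be_def)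
            then show "?\<tau> u = ?\<tau> v" using inA uv s by (auto simp: Inc_def)
          qed
          then have "obs (inv\<^bsub>G\<^esub> s) (snd y \<one>\<^bsub>G\<^esub>) = obs \<one>\<^bsub>G\<^esub> (snd y (inv\<^bsub>G\<^esub> s))"
            using sK by simp
          moreover have "snd (M.eact (inv\<^bsub>G\<^esub> s) y) \<one>\<^bsub>G\<^esub> = snd y (inv\<^bsub>G\<^esub> s)"
            using M.eact_label[OF _ one_closed y(1), of "inv\<^bsub>G\<^esub> s"] sK by simp
          ultimately show ?thesis using inA[OF invF[OF s]] by (simp add: \<alpha>'_def)
        qed
        then have "pattern_map G M.eact S \<alpha>' y = \<pi> \<longleftrightarrow> snd y \<one>\<^bsub>G\<^esub> \<in> A\<pi>"
          using inA[OF one] by (auto simp: pattern_map_eq_iff[OF \<pi>] A\<pi>_def)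
        then show ?thesis by (simp add: P1_def P2_def)
      qed
      have close12: "\<bar>measure M.ext P1 - measure M.ext P2\<bar> \<le> measure M.ext Bad"
        by (rule ext.measure_diff_le[OF P1_sets P2_sets Bad_sets same])

      have mBw: "measure M.ext Bw < \<epsilon> / 4"
      proof -
        have "distr M.ext W (\<lambda>y. snd (fst y)) = W"
        proof -
          have "distr M.ext W (snd \<circ> fst) = distr (distr M.ext Z fst) W snd"
            by (rule distr_distr[OF sndZ M.fst_measurable, symmetric])
          also have "distr M.ext Z fst = Z" using M.factor_ext by (simp add: factor_map_def)
          also have "distr Z W snd = W"
          proof (rule measure_eqI)
            fix B assume "B \<in> sets (distr Z W snd)"
            then have B: "B \<in> sets W" by simp
            have "emeasure (distr Z W snd) B = emeasure Z (snd -` B \<inter> space Z)" by (rule emeasure_distr[OF sndZ B])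
            also have "snd -` B \<inter> space Z = space X' \<times> B" using sets.sets_into_space[OF B] by (auto simp: spZ)
            also have "emeasure Z \<dots> = emeasure W B"
              unfolding Z_def using B by (simp add: W.emeasure_pair_measure_Times X'.emeasure_space_1)
            finally show "emeasure (distr Z W snd) B = emeasure W B" .
          qed simp
          finally show ?thesis by (simp add: comp_def)
        qed
        then have "measure W D = measure M.ext ((\<lambda>y. snd (fst y)) -` D \<inter> space M.ext)"
          using measure_distr[OF wmeas D_sets] by simp
        then show ?thesis
          unfolding Bw_def using D_big ext.prob_compl[OF measurable_sets[OF wmeas D_sets]] by linarith
      qed
      have mBo: "measure M.ext (Bo u) = 0" if u: "u \<in> F" for u
      proof -
        have uK: "u \<in> carrier G" using u F by auto
        have nA: "- A \<in> sets borel" using A by (auto intro!: borel_open open_Compl finite_imp_closed)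
        let ?L = "\<lambda>j. {y \<in> space M.ext. \<gamma>' (fst (z u (fst y))) = j \<and> snd y u \<in> - A}"
        have L0: "measure M.ext (?L j) = 0" for j
          unfolding M.measure_label[OF uK nA] by (simp add: sum.neutral)
        have "\<gamma>' (fst (z u (fst y))) < r" if "y \<in> space M.ext" for y
          using measurable_space[OF M.col_act[OF uK]] that by (auto simp: M.space_ext)
        then have "Bo u = (\<Union>j<r. ?L j)" by (auto simp: Bo_def)
        moreover have "?L j \<in> sets M.ext" for j
        proof -
          have "{y \<in> space M.ext. \<gamma>' (fst (z u (fst y))) = j} \<inter> {y \<in> space M.ext. snd y u \<in> - A} \<in> sets M.ext"
            by (intro sets.Int lab[OF uK nA] count_space_vimage_sets[OF measurable_compose[OF M.fst_measurable M.col_act[OF uK]]])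
          also have "{y \<in> space M.ext. \<gamma>' (fst (z u (fst y))) = j} \<inter> {y \<in> space M.ext. snd y u \<in> - A} = ?L j" by auto
          finally show ?thesis .
        qed
        ultimately have "measure M.ext (Bo u) \<le> (\<Sum>j<r. measure M.ext (?L j))"
          by (simp only:) (intro ext.finite_measure_subadditive_finite, auto)
        also have "\<dots> = 0" by (simp only: L0 sum.neutral_const)
        finally show ?thesis using measure_nonneg[of M.ext "Bo u"] by linarith
      qed
      have mBe: "measure M.ext (Be e) \<le> 4 * card A / n + (real r)\<^sup>2 * \<delta>" if ein: "e \<in> F \<times> F" for e
      proof -
        obtain u v where e_eq: "e = (u, v)" and uv: "u \<in> F" "v \<in> F" using ein by auto
        have K: "u \<in> carrier G" "v \<in> carrier G" using uv F by auto
        define g where "g = v \<otimes>\<^bsub>G\<^esub> inv\<^bsub>G\<^esub> u"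
        have gK: "g \<in> carrier G" and gQ: "g \<in> Q" using K uv by (auto simp: g_def Q_def)
        define m where "m j k = measure X {x \<in> space X. \<gamma> x = j \<and> \<gamma> (act g x) = k}" for j k
        \<comment> \<open>Translating by \<open>u\<close> turns the colours at \<open>u x\<close>
          and \<open>v x\<close> into those at \<open>x\<close> and \<open>g x\<close>, whose
          statistics are close to those of \<open>X\<close>.\<close>
        have mZ: "measure Z {x \<in> space Z. \<gamma>' (fst (z u x)) = j \<and> \<gamma>' (fst (z v x)) = k} \<le> m j k + \<delta>"
          if "j < r" "k < r" for j k
        proof -
          let ?C = "{x \<in> space X'. \<gamma>' x = j \<and> \<gamma>' (act' g x) = k}"
          have C: "?C \<in> sets X'" by (rule colour_pair_sets[OF pX' \<gamma>' gK])
          have gu: "act' g (act' u x) = act' v x" if "x \<in> space X'" for x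
            using that gK K by (simp add: pmp_actionD(8)[OF pX', symmetric] g_def m_assoc)
          have C': "{x \<in> space X'. act' u x \<in> ?C} \<in> sets X'"
            using measurable_sets[OF pmp_actionD(4)[OF pX' K(1)] C] by (simp add: vimage_def Int_def conj_commute)
          have "\<gamma>' (fst (z u x)) = j \<and> \<gamma>' (fst (z v x)) = k \<longleftrightarrow> fst x \<in> {x \<in> space X'. act' u x \<in> ?C}"
            if x: "x \<in> space Z" for x
          proof -
            have fx: "fst x \<in> space X'" using x by (auto simp: spZ)
            show ?thesis
              unfolding z_eq[OF x] fst_conv using fx pmp_actionD(6)[OF pX' K(1) fx] by (simp add: gu)
          qed
          then have "{x \<in> space Z. \<gamma>' (fst (z u x)) = j \<and> \<gamma>' (fst (z v x)) = k} =
              fst -` {x \<in> space X'. act' u x \<in> ?C} \<inter> space Z" by blast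
          then have "measure Z {x \<in> space Z. \<gamma>' (fst (z u x)) = j \<and> \<gamma>' (fst (z v x)) = k} =
              measure (distr Z X' fst) {x \<in> space X'. act' u x \<in> ?C}"
            using measure_distr[OF fstZ C'] by simp
          also have "\<dots> = measure X' {x \<in> space X'. act' u x \<in> ?C}" using fZ by (simp add: factor_map_def)
          also have "\<dots> = measure X' ?C" by (rule pmp_measure_vimage[OF pX' K(1) C])
          also have "\<dots> \<le> m j k + \<delta>" using near[OF gQ that] unfolding m_def by linarith
          finally show ?thesis .
        qed
        have m_sum: "(\<Sum>j<r. \<Sum>k<r. m j k) = 1"
        proof -
          let ?C = "\<lambda>q. {x \<in> space X. \<gamma> x = fst q \<and> \<gamma> (act g x) = snd q}"
          have C: "?C q \<in> sets X" for q by (rule colour_pair_sets[OF pX \<gamma> gK])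
          have "(\<Sum>j<r. \<Sum>k<r. m j k) = (\<Sum>q\<in>{..<r} \<times> {..<r}. measure X (?C q))"
            unfolding m_def sum.cartesian_product by (intro sum.cong) auto
          also have "\<dots> = measure X (\<Union>q\<in>{..<r} \<times> {..<r}. ?C q)"
            using C by (intro X.finite_measure_finite_Union[symmetric]) (auto simp: disjoint_family_on_def)
          also have "(\<Union>q\<in>{..<r} \<times> {..<r}. ?C q) = space X"
            using measurable_space[OF \<gamma>] pmp_actionD(6)[OF pX gK] by fastforce
          finally show ?thesis by (simp add: X.prob_space)
        qed
        have m0: "0 \<le> m j k" for j k by (simp add: m_def)
        \<comment> \<open>A colour pair of positive measure in \<open>X\<close> has a small
          conditional probability of inconsistency. A pair that is null in \<open>X\<close> may
          still have measure up to \<open>\<delta>\<close> in \<open>X'\<close>, with no control on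
          the density; so the excess \<open>\<delta>\<close> is paid with the trivial bound
          one.\<close>
        have E_le: "(m j k + \<delta>) * E g j k (Inc u v) \<le> m j k * (4 * card A / n) + \<delta>" for j k
        proof -
          have "m j k * E g j k (Inc u v) \<le> m j k * (4 * card A / n)"
          proof (cases "m j k > 0")
            case True
            then show ?thesis
              unfolding E_def
              by (intro mult_left_mono dens_X gK Inc_sub) (use Inc_Y[OF uv] in \<open>auto simp: g_def m_def\<close>)
          next
            case False
            then show ?thesis using m0[of j k] by simp
          qed
          moreover have "\<delta> * E g j k (Inc u v) \<le> \<delta>" using \<delta> E1[OF Inc_sub] by (simp add: mult_left_le)
          ultimately show ?thesis by (simp add: distrib_right)
        qed
        have "Be e = {y \<in> space M.ext. (u, v) \<in> T (snd (fst y)) \<and> (snd y u, snd y v) \<in> Inc u v}"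
          by (simp add: Be_def e_eq)
        also have "measure M.ext \<dots> \<le> (\<Sum>j<r. \<Sum>k<r. measure Z {x \<in> space Z. \<gamma>' (fst (z u x)) = j \<and> \<gamma>' (fst (z v x)) = k} *
            E g j k (Inc u v))"
          unfolding E_def g_def by (rule M.measure_edge[OF K Inc_sub])
        also have "\<dots> \<le> (\<Sum>j<r. \<Sum>k<r. m j k * (4 * card A / n) + \<delta>)"
        proof (intro sum_mono)
          fix j k assume "j \<in> {..<r}" "k \<in> {..<r}"
          then have "measure Z {x \<in> space Z. \<gamma>' (fst (z u x)) = j \<and> \<gamma>' (fst (z v x)) = k} * E g j k (Inc u v) \<le>
              (m j k + \<delta>) * E g j k (Inc u v)"
            using mZ E0 by (intro mult_right_mono) auto
          also note E_le
          finally show "measure Z {x \<in> space Z. \<gamma>' (fst (z u x)) = j \<and> \<gamma>' (fst (z v x)) = k} * E g j k (Inc u v) \<le>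
              m j k * (4 * card A / n) + \<delta>" .
        qed
        also have "\<dots> = (\<Sum>j<r. \<Sum>k<r. m j k) * (4 * card A / n) + (real r)\<^sup>2 * \<delta>"
          by (simp only: sum.distrib sum_distrib_right) (simp add: power2_eq_square)
        finally show ?thesis by (simp add: m_sum)
      qed
      have mBad: "measure M.ext Bad < \<epsilon> / 4 + \<epsilon> / 4 + \<epsilon> / 4"
      proof -
        have "measure M.ext Bad \<le> measure M.ext (Bw \<union> (\<Union>u\<in>F. Bo u)) + measure M.ext (\<Union>e\<in>F \<times> F. Be e)"
          unfolding Bad_def using Bw_sets Bo_sets Be_sets F(1)
          by (intro measure_subadditive sets.Un sets.finite_UN) auto
        also have "measure M.ext (Bw \<union> (\<Union>u\<in>F. Bo u)) \<le> measure M.ext Bw + measure M.ext (\<Union>u\<in>F. Bo u)"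
          using Bw_sets Bo_sets F(1) by (intro measure_subadditive sets.finite_UN) auto
        also have "measure M.ext (\<Union>u\<in>F. Bo u) \<le> (\<Sum>u\<in>F. measure M.ext (Bo u))"
          using Bo_sets F(1) by (intro ext.finite_measure_subadditive_finite) auto
        also have "(\<Sum>u\<in>F. measure M.ext (Bo u)) = 0" by (simp add: mBo)
        also have "measure M.ext (\<Union>e\<in>F \<times> F. Be e) \<le> (\<Sum>e\<in>F \<times> F. measure M.ext (Be e))"
          using Be_sets F(1) by (intro ext.finite_measure_subadditive_finite) auto
        also have "\<dots> \<le> (\<Sum>e\<in>F \<times> F. 4 * card A / n + (real r)\<^sup>2 * \<delta>)" using mBe by (rule sum_mono)
        also have "\<dots> = N1 * (4 * card A / n) + N1 * (real r)\<^sup>2 * \<delta>"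
          by (simp add: N1_def card_cartesian_product power2_eq_square distrib_left)
        finally show ?thesis using mBw n_bound \<delta>1 by linarith
      qed

      define R where "R = {k. k < r \<and> t k = j}"
      have R: "finite R" "card R \<le> r" by (auto simp: R_def intro: card_mono[of "{..<r}", simplified])
      have A\<pi>_borel: "A\<pi> \<in> sets borel" using A\<pi>(1) by (auto intro: borel_closed finite_imp_closed)
      have L: "(\<Sum>a\<in>A. law k a * indicator A\<pi> a) = (\<Sum>a\<in>A\<pi>. law k a)" for k
        using A A\<pi>(2) by (simp add: indicator_def if_distrib sum.If_cases Int_absorb1 cong: if_cong)
      have L_le: "0 \<le> (\<Sum>a\<in>A\<pi>. law k a)" "(\<Sum>a\<in>A\<pi>. law k a) \<le> 1" for k
        using sum_mono2[OF A A\<pi>(2), of "law k"] law by (auto intro: sum_nonneg)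
      \<comment> \<open>\<open>law k\<close> is the exact conditional law on \<open>Y\<close>. So
        the measure of \<open>P2\<close> and that of the pattern on \<open>Y\<close> are the same
        linear combination of measures of colour classes, evaluated in \<open>X'\<close> and in
        \<open>X\<close>; they differ by at most \<open>r * \<delta>\<close>.\<close>
      have P2_eq: "measure M.ext P2 = (\<Sum>k\<in>R. measure X' {x \<in> space X'. \<gamma>' x = k} * (\<Sum>a\<in>A\<pi>. law k a))"
      proof -
        let ?C = "\<lambda>k. {y \<in> space M.ext. \<gamma>' (fst (z \<one>\<^bsub>G\<^esub> (fst y))) = k \<and> snd y \<one>\<^bsub>G\<^esub> \<in> A\<pi>}"
        have z1: "fst (z \<one>\<^bsub>G\<^esub> x) = fst x" if "x \<in> space Z" for x
          using pmp_actionD(7)[OF pZ that] by simp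
        have C_sets: "?C k \<in> sets M.ext" for k
        proof -
          have "{y \<in> space M.ext. \<gamma>' (fst (z \<one>\<^bsub>G\<^esub> (fst y))) = k} \<inter> {y \<in> space M.ext. snd y \<one>\<^bsub>G\<^esub> \<in> A\<pi>} \<in> sets M.ext"
            by (intro sets.Int lab[OF one_closed A\<pi>_borel]
              count_space_vimage_sets[OF measurable_compose[OF M.fst_measurable M.col_act[OF one_closed]]])
          also have "{y \<in> space M.ext. \<gamma>' (fst (z \<one>\<^bsub>G\<^esub> (fst y))) = k} \<inter> {y \<in> space M.ext. snd y \<one>\<^bsub>G\<^esub> \<in> A\<pi>} = ?C k" by auto
          finally show ?thesis .
        qed
        have "\<gamma>' (\<phi>' y) < r" if "y \<in> space M.ext" for y
          using measurable_space[OF \<gamma>' measurable_space[OF \<phi>'_meas that]] by simp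
        then have P2_UN: "P2 = (\<Union>k\<in>R. ?C k)"
          unfolding P2_def R_def \<phi>'_def by (auto simp: z1 M.space_ext)
        have "measure M.ext P2 = (\<Sum>k\<in>R. measure M.ext (?C k))"
          unfolding P2_UN using C_sets R(1) by (intro ext.finite_measure_finite_Union) (auto simp: disjoint_family_on_def)
        also have "\<dots> = (\<Sum>k\<in>R. measure X' {x \<in> space X'. \<gamma>' x = k} * (\<Sum>a\<in>A\<pi>. law k a))"
        proof (intro sum.cong refl)
          fix k
          have "{x \<in> space Z. \<gamma>' (fst (z \<one>\<^bsub>G\<^esub> x)) = k} = fst -` {x \<in> space X'. \<gamma>' x = k} \<inter> space Z"
            by (auto simp: z1 spZ)
          then have "measure Z {x \<in> space Z. \<gamma>' (fst (z \<one>\<^bsub>G\<^esub> x)) = k} = measure (distr Z X' fst) {x \<in> space X'. \<gamma>' x = k}"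
            using measure_distr[OF fstZ count_space_vimage_sets[OF \<gamma>']] by simp
          also have "\<dots> = measure X' {x \<in> space X'. \<gamma>' x = k}" using fZ by (simp add: factor_map_def)
          finally show "measure M.ext (?C k) = measure X' {x \<in> space X'. \<gamma>' x = k} * (\<Sum>a\<in>A\<pi>. law k a)"
            unfolding M.measure_label[OF one_closed A\<pi>_borel] L by simp
        qed
        finally show ?thesis .
      qed
      have Y_eq: "measure Y {y \<in> space Y. pattern_map G b S \<alpha> y = \<pi> \<and> \<beta> (\<phi> y) = j} =
          (\<Sum>k\<in>R. measure X {x \<in> space X. \<gamma> x = k} * (\<Sum>a\<in>A\<pi>. law k a))"
      proof -
        let ?C = "\<lambda>q. {y \<in> space Y. \<alpha>p y = snd q \<and> \<gamma> (\<phi> y) = fst q}"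
        have C_sets: "?C q \<in> sets Y" for q
        proof -
          have "{y \<in> space Y. \<alpha>p y = snd q} \<inter> {y \<in> space Y. \<gamma> (\<phi> y) = fst q} \<in> sets Y"
            by (intro sets.Int \<alpha>p count_space_vimage_sets[OF measurable_compose[OF \<phi>(1) \<gamma>]])
          also have "{y \<in> space Y. \<alpha>p y = snd q} \<inter> {y \<in> space Y. \<gamma> (\<phi> y) = fst q} = ?C q" by auto
          finally show ?thesis .
        qed
        have pat: "pattern_map G b S \<alpha> y = \<pi> \<longleftrightarrow> \<alpha>p y \<in> A\<pi>" if y: "y \<in> space Y" for y
          using \<alpha>pA[OF y] obs[OF y invJ] by (simp add: pattern_map_eq_iff[OF \<pi>] A\<pi>_def)
        have "t (\<gamma> (\<phi> y)) = \<beta> (\<phi> y)" "\<gamma> (\<phi> y) < r" if "y \<in> space Y" for y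
          using t[OF measurable_space[OF \<phi>(1) that]] measurable_space[OF \<gamma> measurable_space[OF \<phi>(1) that]] by auto
        then have "{y \<in> space Y. \<alpha>p y \<in> A\<pi> \<and> \<beta> (\<phi> y) = j} = (\<Union>q\<in>R \<times> A\<pi>. ?C q)"
          by (auto simp: R_def)
        moreover have "{y \<in> space Y. pattern_map G b S \<alpha> y = \<pi> \<and> \<beta> (\<phi> y) = j} =
            {y \<in> space Y. \<alpha>p y \<in> A\<pi> \<and> \<beta> (\<phi> y) = j}"
          using pat by (simp cong: conj_cong)
        ultimately have "{y \<in> space Y. pattern_map G b S \<alpha> y = \<pi> \<and> \<beta> (\<phi> y) = j} = (\<Union>q\<in>R \<times> A\<pi>. ?C q)"
          by simp
        also have "measure Y \<dots> = (\<Sum>q\<in>R \<times> A\<pi>. measure Y (?C q))"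
          using C_sets R(1) A\<pi>(1) by (intro Y.finite_measure_finite_Union) (auto simp: disjoint_family_on_def)
        also have "\<dots> = (\<Sum>k\<in>R. \<Sum>a\<in>A\<pi>. measure X {x \<in> space X. \<gamma> x = k} * law k a)"
          unfolding sum.cartesian_product by (intro sum.cong refl) (use A\<pi>(2) law_X in auto)
        finally show ?thesis by (simp add: sum_distrib_left)
      qed
      have "\<bar>measure M.ext P2 - measure Y {y \<in> space Y. pattern_map G b S \<alpha> y = \<pi> \<and> \<beta> (\<phi> y) = j}\<bar> \<le> real r * \<delta>"
      proof -
        have d: "\<bar>measure X' {x \<in> space X'. \<gamma>' x = k} - measure X {x \<in> space X. \<gamma> x = k}\<bar> \<le> \<delta>" if "k \<in> R" for k
        proof -
          have "{x \<in> space X'. \<gamma>' x = k \<and> \<gamma>' (act' \<one>\<^bsub>G\<^esub> x) = k} = {x \<in> space X'. \<gamma>' x = k}"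
            "{x \<in> space X. \<gamma> x = k \<and> \<gamma> (act \<one>\<^bsub>G\<^esub> x) = k} = {x \<in> space X. \<gamma> x = k}"
            using pmp_actionD(7)[OF pX'] pmp_actionD(7)[OF pX] by auto
          then show ?thesis using near[of "\<one>\<^bsub>G\<^esub>" k k] that by (simp add: Q_def R_def)
        qed
        have "\<bar>measure M.ext P2 - measure Y {y \<in> space Y. pattern_map G b S \<alpha> y = \<pi> \<and> \<beta> (\<phi> y) = j}\<bar> =
            \<bar>\<Sum>k\<in>R. (measure X' {x \<in> space X'. \<gamma>' x = k} - measure X {x \<in> space X. \<gamma> x = k}) * (\<Sum>a\<in>A\<pi>. law k a)\<bar>"
          unfolding P2_eq Y_eq by (simp add: sum_subtractf left_diff_distrib)
        also have "\<dots> \<le> (\<Sum>k\<in>R. \<bar>(measure X' {x \<in> space X'. \<gamma>' x = k} - measure X {x \<in> space X. \<gamma> x = k}) * (\<Sum>a\<in>A\<pi>. law k a)\<bar>)"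
          by (rule sum_abs)
        also have "\<dots> \<le> (\<Sum>k\<in>R. \<delta>)"
        proof (rule sum_mono)
          fix k assume k: "k \<in> R"
          have "\<bar>(measure X' {x \<in> space X'. \<gamma>' x = k} - measure X {x \<in> space X. \<gamma> x = k}) * (\<Sum>a\<in>A\<pi>. law k a)\<bar> \<le> \<delta> * 1"
            unfolding abs_mult by (intro mult_mono d[OF k]) (use L_le[of k] \<delta> in auto)
          then show "\<bar>(measure X' {x \<in> space X'. \<gamma>' x = k} - measure X {x \<in> space X. \<gamma> x = k}) * (\<Sum>a\<in>A\<pi>. law k a)\<bar> \<le> \<delta>"
            by simp
        qed
        also have "\<dots> = card R * \<delta>" by simp
        also have "\<dots> \<le> real r * \<delta>" using R(2) \<delta> by (intro mult_right_mono) auto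
        finally show ?thesis .
      qed
      \<comment> \<open>Four quarters of \<open>\<epsilon>\<close>: base points outside
        \<open>D\<close>, inconsistent edges, and the transfer errors for edges and for colour
        classes. The first bound is strict.\<close>
      then show ?thesis using close12 mBad \<delta>2 unfolding P1_def by linarith
    qed
    then show "\<exists>(Y' :: (('z \<times> 'w) \<times> ('g \<Rightarrow> real)) measure) b' \<phi>' \<alpha>'.
        pmp_action G Y' b' \<and> factor_map G Y' b' X' act' \<phi>' \<and> \<alpha>' \<in> measurable Y' (count_space {..<p}) \<and>
        (\<forall>\<pi>\<in>S \<rightarrow>\<^sub>E {..<p}. \<forall>j.
          \<bar>measure Y' {y \<in> space Y'. pattern_map G b' S \<alpha>' y = \<pi> \<and> t (\<gamma>' (\<phi>' y)) = j} -
           measure Y {y \<in> space Y. pattern_map G b S \<alpha> y = \<pi> \<and> \<beta> (\<phi> y) = j}\<bar> < \<epsilon>)"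
      using M.pmp_ext f\<phi>' \<alpha>'_meas by blast
  qed
qed

text \<open>The tolerance is split in three: one third for the approximate extension of
  \<open>X i\<close>, one for pulling its colouring down to \<open>X i\<close> by existential
  closedness, one for replacing \<open>\<gamma>\<close> by an internal colouring.\<close>

theorem theorem7p4:
  fixes G :: "('g, 'b) monoid_scheme"
    and X :: "'i \<Rightarrow> 'x measure"
    and a :: "'i \<Rightarrow> 'g \<Rightarrow> 'x \<Rightarrow> 'x"
    and U :: "'i filter"
  assumes "group G" and "countable (carrier G)"
    and "approx_treeable TYPE('w) G"
    and "\<And>i. ec_action TYPE('x \<times> ('g \<Rightarrow> nat)) G (X i) (a i)"
    and "ultrafilter U"
  shows "ec_action TYPE('y) G (ultraproduct U X) (ultra_action U X a)"
proof -
  have pX: "pmp_action G (X i) (a i)" for i using assms(4) by (simp add: ec_action_def)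
  interpret ultra_pmp U X G a
    by (intro ultra_pmp.intro ultra_prob.intro ultra_pmp_axioms.intro assms(5) pX pmp_actionD(1)[OF pX])
  interpret UX: prob_space UX by (rule prob_space_ultraproduct)
  show ?thesis
    unfolding ec_action_def
  proof (intro conjI allI impI)
    show pUX: "pmp_action G UX ua" by (rule pmp_ultra_action)
    fix Y :: "'y measure" and b \<phi>
    assume "pmp_action G Y b \<and> factor_map G Y b UX ua \<phi>"
    then have pY: "pmp_action G Y b" and fm: "factor_map G Y b UX ua \<phi>" by auto
    show "ec_factor_map G Y b UX ua \<phi>"
      unfolding ec_factor_map_def
    proof (intro conjI fm allI ballI impI)
      fix p q :: nat and \<alpha> \<beta> S and \<epsilon> :: real
      assume \<alpha>: "\<alpha> \<in> measurable Y (count_space {..<p})" and \<beta>: "\<beta> \<in> measurable UX (count_space {..<q})"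
        and S': "finite S \<and> S \<subseteq> carrier G" and \<epsilon>: "0 < \<epsilon>"
      then have S: "finite S" "S \<subseteq> carrier G" and e3: "0 < \<epsilon> / 3" by auto
      interpret Y: prob_space Y by (rule pmp_actionD(1)[OF pY])
      obtain y0 where "y0 \<in> space Y" using Y.not_empty by auto
      then have p: "0 < p" using measurable_space[OF \<alpha>] by fastforce
      obtain r :: nat and \<gamma> :: "('i \<Rightarrow> 'x) set \<Rightarrow> nat" and t :: "nat \<Rightarrow> nat" and Q and \<delta> :: real
        where \<gamma>: "\<gamma> \<in> measurable UX (count_space {..<r})" and t: "\<And>c. c \<in> space UX \<Longrightarrow> t (\<gamma> c) = \<beta> c"
        and Q: "finite Q" "Q \<subseteq> carrier G" and \<delta>: "0 < \<delta>"
        and extend: "\<And>(X' :: 'x measure) act' \<gamma>'. pmp_action G X' act' \<Longrightarrow> \<gamma>' \<in> measurable X' (count_space {..<r}) \<Longrightarrow>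
          (\<And>g j k. g \<in> Q \<Longrightarrow> j < r \<Longrightarrow> k < r \<Longrightarrow> \<bar>measure X' {x \<in> space X'. \<gamma>' x = j \<and> \<gamma>' (act' g x) = k} -
            measure UX {x \<in> space UX. \<gamma> x = j \<and> \<gamma> (ua g x) = k}\<bar> < \<delta>) \<Longrightarrow>
          \<exists>(Y' :: (('x \<times> 'w) \<times> ('g \<Rightarrow> real)) measure) b' \<phi>' \<alpha>'.
            pmp_action G Y' b' \<and> factor_map G Y' b' X' act' \<phi>' \<and> \<alpha>' \<in> measurable Y' (count_space {..<p}) \<and>
            (\<forall>\<pi>\<in>S \<rightarrow>\<^sub>E {..<p}. \<forall>j.
              \<bar>measure Y' {y \<in> space Y'. pattern_map G b' S \<alpha>' y = \<pi> \<and> t (\<gamma>' (\<phi>' y)) = j} -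
               measure Y {y \<in> space Y. pattern_map G b S \<alpha> y = \<pi> \<and> \<beta> (\<phi> y) = j}\<bar> < \<epsilon> / 3)"
        apply (rule finitary_extension[where 'z='x, OF assms(2,3) pY pUX fm \<alpha> \<beta> S e3])
        subgoal premises prems by (rule that[OF prems(2-)])
        done
      \<comment> \<open>\<open>t\<close> is constrained only on colours that \<open>\<gamma>\<close>
        takes; on the others its values may exceed \<open>q\<close>. The larger bound
        \<open>q'\<close> makes \<open>t (f i x)\<close> a legitimate colouring and still covers all
        \<open>j < q\<close>.\<close>
      define q' where "q' = q + Suc (\<Sum>k<r. t k)"
      have t_less: "t k < q'" if "k < r" for k
        using member_le_sum[of k "{..<r}" t] that by (simp add: q'_def)
      \<comment> \<open>\<open>\<epsilon> / 3\<close> is for exchanging \<open>h\<close> and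
        \<open>\<gamma>\<close> in the final estimate. \<open>\<delta> / 4\<close> is there because
        pair statistics change on \<open>D\<close> and on its translate, together less than
        \<open>\<delta> / 2\<close>, which leaves \<open>\<delta> / 2\<close> for the limit along
        \<open>U\<close>.\<close>
      define e where "e = min (\<epsilon> / 3) (\<delta> / 4)"
      have "0 < e" using \<epsilon> \<delta> by (simp add: e_def)
      then obtain f where f: "\<And>i. f i \<in> measurable (X i) (count_space {..<r})"
        and fe: "measure UX {c \<in> \<Omega>. ultra_fun U f c \<noteq> \<gamma> c} < e"
        using ultra_fun_approximates[OF \<gamma>] by blast
      define h where "h = ultra_fun U f"
      have h: "h \<in> measurable UX (count_space {..<r})" unfolding h_def using f by (rule ultra_fun_measurable)
      define D where "D = {c \<in> \<Omega>. h c \<noteq> \<gamma> c}"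
      have D: "D \<in> sets UX"
      proof -
        have "D = \<Omega> - (\<Union>j<r. {c \<in> \<Omega>. h c = j} \<inter> {c \<in> \<Omega>. \<gamma> c = j})"
          using measurable_space[OF h] measurable_space[OF \<gamma>] by (auto simp: D_def)
        moreover have "{c \<in> \<Omega>. h c = j} \<inter> {c \<in> \<Omega>. \<gamma> c = j} \<in> sets UX" for j
          using sets.Int[OF count_space_vimage_sets[OF h] count_space_vimage_sets[OF \<gamma>]] by simp
        ultimately show ?thesis using sets.compl_sets[of "\<Union>j<r. {c \<in> \<Omega>. h c = j} \<inter> {c \<in> \<Omega>. \<gamma> c = j}" UX] by simp
      qed
      have De: "measure UX D < e" using fe by (simp add: D_def h_def)
      let ?P = "\<lambda>i g j k. {x \<in> space (X i). f i x = j \<and> f i (a i g x) = k}"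
      let ?R = "\<lambda>g j k. measure UX {c \<in> space UX. \<gamma> c = j \<and> \<gamma> (ua g c) = k}"
      have near1: "eventually (\<lambda>i. \<bar>measure (X i) (?P i g j k) - ?R g j k\<bar> < \<delta>) U" if g: "g \<in> Q" for g j k
      proof -
        have gK: "g \<in> carrier G" using g Q by auto
        let ?h = "{c \<in> space UX. h c = j \<and> h (ua g c) = k}"
        let ?D' = "{c \<in> space UX. ua g c \<in> D}"
        have D': "?D' \<in> sets UX"
          using measurable_sets[OF pmp_actionD(4)[OF pUX gK] D] by (simp add: vimage_def Int_def conj_commute)
        have "\<bar>measure UX ?h - ?R g j k\<bar> \<le> measure UX (D \<union> ?D')"
        proof (rule UX.measure_diff_le)
          show "?h \<in> sets UX" by (rule colour_pair_sets[OF pUX h gK])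
          show "{c \<in> space UX. \<gamma> c = j \<and> \<gamma> (ua g c) = k} \<in> sets UX" by (rule colour_pair_sets[OF pUX \<gamma> gK])
          show "D \<union> ?D' \<in> sets UX" using D D' by auto
          fix c assume "c \<in> space UX" "c \<notin> D \<union> ?D'"
          then have "h c = \<gamma> c" "h (ua g c) = \<gamma> (ua g c)"
            using pmp_actionD(6)[OF pUX gK] by (auto simp: D_def)
          then show "c \<in> ?h \<longleftrightarrow> c \<in> {c \<in> space UX. \<gamma> c = j \<and> \<gamma> (ua g c) = k}" by auto
        qed
        also have "\<dots> \<le> measure UX D + measure UX ?D'" using D D' by (intro measure_subadditive) auto
        also have "measure UX ?D' = measure UX D" by (rule pmp_measure_vimage[OF pUX gK D])
        finally have 1: "\<bar>measure UX ?h - ?R g j k\<bar> < \<delta> / 2" using De by (simp add: e_def)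
        have "(\<lambda>i. ?P i g j k) \<in> IS" using colour_pair_sets[OF pX f gK] by auto
        then have "measure UX (intl (\<lambda>i. ?P i g j k)) = lim_measure (\<lambda>i. ?P i g j k)"
          by (rule measure_ultraproduct)
        moreover have "intl (\<lambda>i. ?P i g j k) = ?h"
          unfolding h_def space_ultraproduct by (rule ultra_fun_pair[OF f gK, symmetric])
        ultimately have "((\<lambda>i. measure (X i) (?P i g j k)) \<longlongrightarrow> measure UX ?h) U"
          using tendsto_lim_measure[of "\<lambda>i. ?P i g j k"] by simp
        then have "eventually (\<lambda>i. dist (measure (X i) (?P i g j k)) (measure UX ?h) < \<delta> / 2) U"
          using \<delta> by (intro tendstoD) auto
        then show ?thesis
        proof eventually_elim
          case (elim i)
          then show ?case using 1 unfolding dist_real_def by linarith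
        qed
      qed
      have near: "eventually (\<lambda>i. \<forall>g\<in>Q. \<forall>j\<in>{..<r}. \<forall>k\<in>{..<r}. \<bar>measure (X i) (?P i g j k) - ?R g j k\<bar> < \<delta>) U"
        using near1 Q(1) by (intro eventually_ball_finite ballI) auto
      let ?T = "\<lambda>\<pi> j. measure Y {y \<in> space Y. pattern_map G b S \<alpha> y = \<pi> \<and> \<beta> (\<phi> y) = j}"
      let ?M = "\<lambda>i \<alpha>' \<pi> j. {x \<in> space (X i). pattern_map G (a i) S \<alpha>' x = \<pi> \<and> t (f i x) = j}"
      define good where "good i \<alpha>' \<longleftrightarrow> (\<forall>\<pi>\<in>S \<rightarrow>\<^sub>E {..<p}. \<forall>j<q. \<bar>measure (X i) (?M i \<alpha>' \<pi> j) - ?T \<pi> j\<bar> < 2 * \<epsilon> / 3)" for i \<alpha>'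
      have tf: "(\<lambda>x. t (f i x)) \<in> measurable (X i) (count_space {..<q'})" for i
        by (rule measurable_compose[OF f]) (use t_less in auto)
      have ex_good: "eventually (\<lambda>i. \<exists>\<alpha>'\<in>measurable (X i) (count_space {..<p}). good i \<alpha>') U"
        using near
      proof eventually_elim
        case (elim i)
        obtain Y' :: "(('x \<times> 'w) \<times> ('g \<Rightarrow> real)) measure" and b' \<phi>' \<alpha>'
          where Y': "pmp_action G Y' b'" "factor_map G Y' b' (X i) (a i) \<phi>'" "\<alpha>' \<in> measurable Y' (count_space {..<p})"
          and c1: "\<And>\<pi> j. \<pi> \<in> S \<rightarrow>\<^sub>E {..<p} \<Longrightarrow>
              \<bar>measure Y' {y \<in> space Y'. pattern_map G b' S \<alpha>' y = \<pi> \<and> t (f i (\<phi>' y)) = j} - ?T \<pi> j\<bar> < \<epsilon> / 3"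
          using extend[OF pX f, of i] elim by auto
        \<comment> \<open>The extension lives on another type than the one in the assumption;
          \<open>ec_action_any_type\<close> bridges this.\<close>
        have "ec_action TYPE(('x \<times> 'w) \<times> ('g \<Rightarrow> real)) G (X i) (a i)" using assms(4) by (rule ec_action_any_type)
        then have "ec_factor_map G Y' b' (X i) (a i) \<phi>'" using Y' by (simp add: ec_action_def)
        then have "\<exists>\<alpha>''\<in>measurable (X i) (count_space {..<p}). \<forall>\<pi>\<in>S \<rightarrow>\<^sub>E {..<p}. \<forall>j<q'.
            \<bar>measure Y' {y \<in> space Y'. pattern_map G b' S \<alpha>' y = \<pi> \<and> t (f i (\<phi>' y)) = j}
             - measure (X i) (?M i \<alpha>'' \<pi> j)\<bar> < \<epsilon> / 3"
          unfolding ec_factor_map_def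
          by (elim conjE) (drule spec[of _ p], drule spec[of _ q'], drule bspec[OF _ Y'(3)],
            drule bspec[OF _ tf], drule spec[of _ S], drule mp[OF _ S'], drule spec[of _ "\<epsilon> / 3"],
            erule mp[OF _ e3])
        then obtain \<alpha>'' where \<alpha>'': "\<alpha>'' \<in> measurable (X i) (count_space {..<p})"
          and c2: "\<And>\<pi> j. \<pi> \<in> S \<rightarrow>\<^sub>E {..<p} \<Longrightarrow> j < q' \<Longrightarrow>
            \<bar>measure Y' {y \<in> space Y'. pattern_map G b' S \<alpha>' y = \<pi> \<and> t (f i (\<phi>' y)) = j}
             - measure (X i) (?M i \<alpha>'' \<pi> j)\<bar> < \<epsilon> / 3"
          by blast
        have "good i \<alpha>''"
          unfolding good_def
        proof (intro ballI allI impI)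
          fix \<pi> j assume \<pi>: "\<pi> \<in> S \<rightarrow>\<^sub>E {..<p}" and j: "j < q"
          then have "j < q'" by (simp add: q'_def)
          then show "\<bar>measure (X i) (?M i \<alpha>'' \<pi> j) - ?T \<pi> j\<bar> < 2 * \<epsilon> / 3"
            using c1[OF \<pi>, of j] c2[OF \<pi>, of j] by linarith
        qed
        then show ?case using \<alpha>'' by blast
      qed
      \<comment> \<open>The ultraproduct of colourings needs one for every \<open>i\<close>. Where
        none is good, which happens for almost no \<open>i\<close>, the constant \<open>0\<close> is
        taken, legal since \<open>0 < p\<close>.\<close>
      define A where "A i = (if \<exists>\<alpha>'\<in>measurable (X i) (count_space {..<p}). good i \<alpha>'
        then SOME \<alpha>'. \<alpha>' \<in> measurable (X i) (count_space {..<p}) \<and> good i \<alpha>' else (\<lambda>_. 0))" for i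
      have A_good: "A i \<in> measurable (X i) (count_space {..<p}) \<and> good i (A i)"
        if "\<exists>\<alpha>'\<in>measurable (X i) (count_space {..<p}). good i \<alpha>'" for i
      proof -
        have "\<exists>\<alpha>'. \<alpha>' \<in> measurable (X i) (count_space {..<p}) \<and> good i \<alpha>'" using that by (simp only: Bex_def)
        from someI_ex[OF this] show ?thesis using that by (simp add: A_def)
      qed
      have A: "A i \<in> measurable (X i) (count_space {..<p})" for i
      proof (cases "\<exists>\<alpha>'\<in>measurable (X i) (count_space {..<p}). good i \<alpha>'")
        case True
        then show ?thesis using A_good by blast
      next
        case False
        then show ?thesis using p by (simp add: A_def)
      qed
      have evA: "eventually (\<lambda>i. good i (A i)) U" using ex_good by eventually_elim (use A_good in blast)
      define \<alpha>' where "\<alpha>' = ultra_fun U A"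
      have \<alpha>': "\<alpha>' \<in> measurable UX (count_space {..<p})" unfolding \<alpha>'_def using A by (rule ultra_fun_measurable)
      define h' where "h' = ultra_fun U (\<lambda>i x. t (f i x))"
      have h': "h' \<in> measurable UX (count_space {..<q'})" unfolding h'_def using tf by (rule ultra_fun_measurable)
      have h'_eq: "h' c = t (h c)" if c: "c \<in> \<Omega>" for c
      proof -
        obtain x where x: "x \<in> Pi UNIV E" "c = pt x" using c by (rule ultra_setE)
        have "eventually (\<lambda>i. f i (x i) = h c) U" using ultra_fun_point[OF f x(1), of "h c"] by (simp add: h_def x(2))
        then have "eventually (\<lambda>i. t (f i (x i)) = t (h c)) U" by eventually_elim simp
        then show ?thesis using ultra_fun_point[OF tf x(1), of "t (h c)"] by (simp add: h'_def x(2))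
      qed
      have "\<bar>?T \<pi> j - measure UX {c \<in> space UX. pattern_map G ua S \<alpha>' c = \<pi> \<and> \<beta> c = j}\<bar> < \<epsilon>"
        if \<pi>: "\<pi> \<in> S \<rightarrow>\<^sub>E {..<p}" and j: "j < q" for \<pi> j
      proof -
        let ?N = "{c \<in> space UX. pattern_map G ua S \<alpha>' c = \<pi> \<and> h' c = j}"
        have N_eq: "?N = intl (\<lambda>i. ?M i (A i) \<pi> j)"
          unfolding \<alpha>'_def h'_def space_ultraproduct by (rule ultra_fun_pattern[OF A tf S \<pi>])
        have "?M i (A i) \<pi> j \<in> sets (X i)" for i by (rule pattern_sets[OF pX S A tf \<pi>])
        then have "measure UX ?N = lim_measure (\<lambda>i. ?M i (A i) \<pi> j)"
          unfolding N_eq by (intro measure_ultraproduct) auto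
        then have "((\<lambda>i. measure (X i) (?M i (A i) \<pi> j)) \<longlongrightarrow> measure UX ?N) U"
          using tendsto_lim_measure by simp
        then have "((\<lambda>i. \<bar>measure (X i) (?M i (A i) \<pi> j) - ?T \<pi> j\<bar>) \<longlongrightarrow> \<bar>measure UX ?N - ?T \<pi> j\<bar>) U"
          by (intro tendsto_rabs tendsto_diff tendsto_const)
        moreover have "eventually (\<lambda>i. \<bar>measure (X i) (?M i (A i) \<pi> j) - ?T \<pi> j\<bar> \<le> 2 * \<epsilon> / 3) U"
          using evA by eventually_elim (use \<pi> j in \<open>auto simp: good_def intro: less_imp_le\<close>)
        \<comment> \<open>The limit keeps only a weak inequality; the strict bound on the measure of
          \<open>D\<close> makes the final one strict.\<close>
        ultimately have 1: "\<bar>measure UX ?N - ?T \<pi> j\<bar> \<le> 2 * \<epsilon> / 3"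
          by (rule tendsto_upperbound[OF _ _ U_ne])
        have "\<bar>measure UX ?N - measure UX {c \<in> space UX. pattern_map G ua S \<alpha>' c = \<pi> \<and> \<beta> c = j}\<bar> \<le> measure UX D"
        proof (rule UX.measure_diff_le[OF _ _ D])
          show "?N \<in> sets UX" by (rule pattern_sets[OF pUX S \<alpha>' h' \<pi>])
          show "{c \<in> space UX. pattern_map G ua S \<alpha>' c = \<pi> \<and> \<beta> c = j} \<in> sets UX"
            by (rule pattern_sets[OF pUX S \<alpha>' \<beta> \<pi>])
          fix c assume c: "c \<in> space UX" "c \<notin> D"
          then have "h' c = \<beta> c" using h'_eq[of c] t[of c] by (simp add: D_def)
          then show "c \<in> ?N \<longleftrightarrow> c \<in> {c \<in> space UX. pattern_map G ua S \<alpha>' c = \<pi> \<and> \<beta> c = j}" by simp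
        qed
        moreover have "measure UX D < \<epsilon> / 3" using De by (simp add: e_def)
        ultimately show ?thesis using 1 by linarith
      qed
      then show "\<exists>\<alpha>'\<in>measurable UX (count_space {..<p}). \<forall>\<pi>\<in>S \<rightarrow>\<^sub>E {..<p}. \<forall>j<q.
          \<bar>?T \<pi> j - measure UX {c \<in> space UX. pattern_map G ua S \<alpha>' c = \<pi> \<and> \<beta> c = j}\<bar> < \<epsilon>"
        using \<alpha>' by blast
    qed
  qed
qed

end
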